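(* The critical parameter of the directed-corner model on $\mathbb{Z}^2$ satisfies $p_c^{\mathrm{corn}} < 1/2$.
   Context: The directed-corner model on $\mathbb{Z}^2$ with parameter $p\in[0,1]$: put $k:=\lfloor 4p\rfloor$ and $\varepsilon:=4p-k\in[0,1)$. Independently over the vertices, each vertex decides which of its four outgoing directed edges (to its nearest neighbors) are open, as follows. If $k=0$: with probability $\varepsilon$ exactly one outgoing edge, chosen uniformly, is open, and otherwise none is. If $k=1$: one of the four outgoing edges is chosen uniformly and opened; then, with probability $\varepsilon$ (independently), one of the two outgoing edges orthogonal to it is chosen uniformly and also opened. If $k=2$: one of the four pairs northeast, northwest, southeast, southwest of outgoing edges is opened, each with probability $1/4$; then, with probability $\varepsilon$ (independently), a third edge chosen uniformly from the two remaining outgoing edges is also opened. If $k\ge 3$: three uniformly chosen outgoing edges are opened and, with probability $\varepsilon$, the fourth one as well (all four are open if $p=1$). Let $\theta_p^{\mathrm{corn}}$ be the probability that there is an infinite self-avoiding directed open path starting at the origin, and $p_c^{\mathrm{corn}}:=\sup\{p\ge0:\theta_p^{\mathrm{corn}}=0\}$. *)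

theory Defs
  imports "HOL-Probability.Probability"
begin

datatype dir = East | North | West | South

lemma UNIV_dir: "UNIV = {East, North, West, South}"
  using dir.exhaust by auto

instance dir :: finite
  by standard (simp add: UNIV_dir)

fun step :: "dir \<Rightarrow> int \<times> int" where
  "step East = (1, 0)"
| "step North = (0, 1)"
| "step West = (- 1, 0)"
| "step South = (0, - 1)"

definition orth :: "dir \<Rightarrow> dir set" where
  "orth d = {e. fst (step d) * fst (step e) + snd (step d) * snd (step e) = 0}"

(* Law of the set of open outgoing edges at a single vertex, for p in [0,1]
   (values of p outside this interval are never used).  An outgoing edge of x is
   identified with its direction.  The case p = 1 is separate because there k = 4
   and \<epsilon> = 0, while all four edges are meant to be open. *)
definition corner_pmf :: "real \<Rightarrow> dir set pmf" where
  "corner_pmf p =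
    (let k = \<lfloor>4 * p\<rfloor>; \<epsilon> = 4 * p - of_int k in
      if k = 0 then
        do {
          b \<leftarrow> bernoulli_pmf \<epsilon>;
          if b then map_pmf (\<lambda>d. {d}) (pmf_of_set UNIV) else return_pmf {}
        }
      else if k = 1 then
        do {
          d \<leftarrow> pmf_of_set UNIV;
          b \<leftarrow> bernoulli_pmf \<epsilon>;
          if b then map_pmf (\<lambda>e. {d, e}) (pmf_of_set (orth d)) else return_pmf {d}
        }
      else if k = 2 then
        do {
          C \<leftarrow> pmf_of_set {{North, East}, {North, West}, {South, East}, {South, West}};
          b \<leftarrow> bernoulli_pmf \<epsilon>;
          if b then map_pmf (\<lambda>e. insert e C) (pmf_of_set (- C)) else return_pmf C
        }
      else if p = 1 then return_pmf UNIV
      else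
        do {
          T \<leftarrow> pmf_of_set {T. card T = 3};
          b \<leftarrow> bernoulli_pmf \<epsilon>;
          return_pmf (if b then UNIV else T)
        })"

definition corner_measure :: "real \<Rightarrow> (int \<times> int \<Rightarrow> dir set) measure" where
  "corner_measure p = (\<Pi>\<^sub>M x\<in>UNIV. measure_pmf (corner_pmf p))"

definition open_edge :: "(int \<times> int \<Rightarrow> dir set) \<Rightarrow> int \<times> int \<Rightarrow> int \<times> int \<Rightarrow> bool" where
  "open_edge \<omega> x y \<longleftrightarrow> (\<exists>d\<in>\<omega> x. y = x + step d)"

definition percolates :: "(int \<times> int \<Rightarrow> dir set) \<Rightarrow> bool" where
  "percolates \<omega> \<longleftrightarrow>
    (\<exists>\<gamma> :: nat \<Rightarrow> int \<times> int. \<gamma> 0 = (0, 0) \<and> inj \<gamma> \<and> (\<forall>n. open_edge \<omega> (\<gamma> n) (\<gamma> (Suc n))))"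

definition theta_corn :: "real \<Rightarrow> real" where
  "theta_corn p = measure (corner_measure p) {\<omega> \<in> space (corner_measure p). percolates \<omega>}"

definition pc_corn :: real where
  "pc_corn = Sup {p \<in> {0..1}. theta_corn p = 0}"

end

theory Submission
  imports Defs
begin

text \<open>
  The probability of escaping from a finite box depends on the law of a vertex only through its hitting
  function, the probability that some direction in a given set \<open>A\<close> is open. For independent edges of
  density \<open>1 / 2\<close> and for the corner law at \<open>p = 1 / 2\<close> these functions agree on single directions and
  on pairs of orthogonal directions, but the corner law is strictly better on every set that contains
  two opposite directions.

  Independent edges of density \<open>1 / 2 + h\<close> percolate: at density \<open>1 / 2\<close>, self-duality rules out
  exponential decay of the escape probability, so the argument of Duminil-Copin and Tassion bounds its
  derivative from below above \<open>1 / 2\<close>. By a local surgery in the style of Aizenman and Grimmett, the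
  pivotal vertices at which opposite directions matter make up a positive fraction of all pivotal
  vertices. So the strict gain there compensates a small loss in density everywhere, which brings
  the percolating model below the corner model at some \<open>p < 1 / 2\<close>.
\<close>

section \<open>Escape from a finite set of vertices\<close>

text \<open>The surgery costs a power of the smallest weight of a vertex state. It cannot be run
  with the corner law near \<open>p = 1 / 2\<close>, which gives weight zero to the empty state that
  the surgery imposes on the new pivotal vertex. It is therefore run along the segment from
  independent edges of density \<open>1 / 2 + h\<close> to an equal mixture of these with a thinned
  corner law; on that segment every state has weight at least \<open>1 / 100\<close>. The remaining
  step, from the mixture to the corner law itself, compares hitting functions set by set. The gain
  on opposite directions is of constant size while the loss elsewhere is of order \<open>h\<close>,
  so \<open>h\<close> only has to be small. All bounds are uniform in the box, so that positivity
  survives the limit. Since the critical parameter is a supremum of zeros, the comparison has to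
  cover all parameters up to 1, including the corner laws with \<open>k = 2\<close> and
  \<open>k = 3\<close>.\<close>

declare split_paired_Ex [simp del] split_paired_All [simp del]

type_synonym config = "int \<times> int \<Rightarrow> dir set"

definition edges :: "config \<Rightarrow> (int \<times> int) rel" where
  "edges \<xi> = {(x, x + step d) |x d. d \<in> \<xi> x}"

definition exits :: "(int \<times> int) set \<Rightarrow> config \<Rightarrow> int \<times> int \<Rightarrow> bool" where
  "exits V \<xi> x \<longleftrightarrow> (\<exists>z. z \<notin> V \<and> (x, z) \<in> (edges \<xi>)\<^sup>*)"

definition confs :: "(int \<times> int) set \<Rightarrow> config set" where
  "confs V = {\<xi>. \<forall>v. v \<notin> V \<longrightarrow> \<xi> v = {}}"

text \<open>Expectation of \<open>f\<close> under the product of the weight \<open>w\<close> over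
  \<open>V\<close>. The weight is a plain real function and not a pmf, so that laws can be
  interpolated and differentiated pointwise.\<close>

definition wexp :: "(int \<times> int) set \<Rightarrow> (dir set \<Rightarrow> real) \<Rightarrow> (config \<Rightarrow> real) \<Rightarrow> real" where
  "wexp V w f = (\<Sum>\<xi>\<in>confs V. (\<Prod>v\<in>V. w (\<xi> v)) * f \<xi>)"

lemma edges_iff: "(x, y) \<in> edges \<xi> \<longleftrightarrow> (\<exists>d\<in>\<xi> x. y = x + step d)"
  unfolding edges_def by blast

lemma edgesI: "d \<in> \<xi> x \<Longrightarrow> (x, x + step d) \<in> edges \<xi>"
  by (auto simp: edges_iff simp del: split_paired_Ex)

lemma edges_mono: "(\<And>x. \<xi> x \<subseteq> \<xi>' x) \<Longrightarrow> edges \<xi> \<subseteq> edges \<xi>'"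
  by (force simp: edges_def)

lemma exits_mono: "(\<And>x. \<xi> x \<subseteq> \<xi>' x) \<Longrightarrow> exits V \<xi> x \<Longrightarrow> exits V \<xi>' x"
  unfolding exits_def using rtrancl_mono[OF edges_mono[of \<xi> \<xi>']] by blast

lemma exits_outside: "x \<notin> V \<Longrightarrow> exits V \<xi> x"
  by (auto simp: exits_def)

lemma exits_rtrancl: "(x, y) \<in> (edges \<xi>)\<^sup>* \<Longrightarrow> exits V \<xi> y \<Longrightarrow> exits V \<xi> x"
  by (auto simp: exits_def intro: rtrancl_trans)

lemma exits_step: "d \<in> \<xi> x \<Longrightarrow> exits V \<xi> (x + step d) \<Longrightarrow> exits V \<xi> x"
  by (rule exits_rtrancl[of x "x + step d"]) (auto intro: edgesI)

lemma exits_induct [consumes 1, case_names outside step]: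
  assumes "exits V \<xi> x"
    and "\<And>z. z \<notin> V \<Longrightarrow> P z"
    and "\<And>x d. d \<in> \<xi> x \<Longrightarrow> exits V \<xi> x \<Longrightarrow> exits V \<xi> (x + step d) \<Longrightarrow> P (x + step d) \<Longrightarrow> P x"
  shows "P x"
proof -
  obtain z where z: "z \<notin> V" "(x, z) \<in> (edges \<xi>)\<^sup>*"
    using assms(1) by (auto simp: exits_def)
  from z(2) show ?thesis
  proof (induction rule: converse_rtrancl_induct)
    case base
    show ?case using assms(2) z(1) .
  next
    case (step y u)
    then obtain d where d: "d \<in> \<xi> y" "u = y + step d" by (auto simp: edges_iff)
    have "exits V \<xi> u" using step(2) z(1) by (auto simp: exits_def)
    with d step show ?case using assms(3) exits_step by blast
  qed
qed

lemma not_exits_closed: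
  assumes "x \<in> Q" "Q \<subseteq> V" "\<And>y d. y \<in> Q \<Longrightarrow> d \<in> \<xi> y \<Longrightarrow> y + step d \<in> Q"
  shows "\<not> exits V \<xi> x"
proof
  assume "exits V \<xi> x"
  then have "x \<notin> Q"
    by (induction rule: exits_induct) (use assms in auto)
  with assms(1) show False by simp
qed

lemma exits_cong:
  assumes "\<And>v. v \<in> V \<Longrightarrow> \<xi> v = \<xi>' v"
  shows "exits V \<xi> x = exits V \<xi>' x"
proof -
  have "exits V \<xi>2 x" if "exits V \<xi>1 x" and "\<And>v. v \<in> V \<Longrightarrow> \<xi>1 v = \<xi>2 v" for \<xi>1 \<xi>2
    using that(1)
  proof (induction rule: exits_induct)
    case (outside z)
    then show ?case by (rule exits_outside)
  next
    case (step x d)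
    then show ?case using that(2) exits_outside exits_step by (cases "x \<in> V") auto
  qed
  from this[of \<xi> \<xi>'] this[of \<xi>' \<xi>] assms show ?thesis by auto
qed

text \<open>All added edges start at \<open>x\<close>, so everything between the first and the last
  use of one can be cut out of the path.\<close>

lemma rtrancl_star_at:
  assumes "(a, z) \<in> (R \<union> {x} \<times> Y)\<^sup>*"
  shows "(a, z) \<in> R\<^sup>* \<or> (a, x) \<in> R\<^sup>* \<and> (\<exists>y\<in>Y. (y, z) \<in> R\<^sup>*)"
  using assms
proof (induction rule: converse_rtrancl_induct)
  case (step y u)
  then show ?case by (auto intro: converse_rtrancl_into_rtrancl)
qed auto

lemma edges_upd:
  assumes "\<xi> x = {}"
  shows "edges (\<xi>(x := s)) = edges \<xi> \<union> {x} \<times> ((\<lambda>d. x + step d) ` s)"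
proof -
  have "(u, y) \<in> edges (\<xi>(x := s)) \<longleftrightarrow> (u, y) \<in> edges \<xi> \<union> {x} \<times> ((\<lambda>d. x + step d) ` s)" for u y
    by (cases "u = x") (auto simp: edges_iff assms)
  then show ?thesis by (intro set_eqI) (metis surj_pair)
qed

text \<open>An escape path needs the edges at \<open>x\<close> at most once, so the state
  \<open>s\<close> matters only through whether it contains a good direction. This is what reduces a
  law to its hitting function.\<close>

lemma exits_upd:
  assumes "\<xi> x = {}"
  shows "exits V (\<xi>(x := s)) a \<longleftrightarrow>
    exits V \<xi> a \<or> (a, x) \<in> (edges \<xi>)\<^sup>* \<and> (\<exists>d\<in>s. exits V \<xi> (x + step d))" (is "?L = ?R")
proof
  assume ?L
  then show ?R unfolding exits_def edges_upd[of \<xi>, OF assms]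
    by (blast dest: rtrancl_star_at)
next
  have sub: "edges \<xi> \<subseteq> edges (\<xi>(x := s))" by (auto simp: edges_upd assms)
  note m = rtrancl_mono[OF sub]
  assume ?R
  then show ?L
  proof
    assume "exits V \<xi> a" then show ?L using m by (auto simp: exits_def)
  next
    assume R: "(a, x) \<in> (edges \<xi>)\<^sup>* \<and> (\<exists>d\<in>s. exits V \<xi> (x + step d))"
    then obtain d where d: "d \<in> s" "exits V \<xi> (x + step d)" by auto
    have "exits V (\<xi>(x := s)) (x + step d)" using d m by (auto simp: exits_def)
    then have "exits V (\<xi>(x := s)) x" using d(1) exits_step[of d "\<xi>(x := s)" x] by auto
    then show ?L using R m exits_rtrancl by blast
  qed
qed

text \<open>The directions at \<open>x\<close> whose opening would make \<open>x\<close> pivotal for the escape from the origin.\<close>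

definition ctx :: "(int \<times> int) set \<Rightarrow> int \<times> int \<Rightarrow> config \<Rightarrow> dir set" where
  "ctx V x \<xi> = (if \<not> exits V \<xi> (0,0) \<and> ((0,0), x) \<in> (edges \<xi>)\<^sup>*
     then {d. exits V \<xi> (x + step d)} else {})"

lemma exits_upd_ctx:
  assumes "\<xi> x = {}"
  shows "exits V (\<xi>(x := s)) (0,0) \<longleftrightarrow> exits V \<xi> (0,0) \<or> s \<inter> ctx V x \<xi> \<noteq> {}"
  unfolding exits_upd[of \<xi> x, OF assms] ctx_def by auto

lemma finite_confs [simp]: "finite V \<Longrightarrow> finite (confs V)"
proof -
  assume "finite V"
  then have "finite (PiE_dflt V {} (\<lambda>_. UNIV :: dir set set))" by auto
  also have "PiE_dflt V {} (\<lambda>_. UNIV :: dir set set) = confs V"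
    by (auto simp: PiE_dflt_def confs_def)
  finally show ?thesis .
qed

lemma confs_insert_bij:
  assumes "x \<in> V"
  shows "bij_betw (\<lambda>(s, \<xi>). \<xi>(x := s)) (UNIV \<times> confs (V - {x})) (confs V)"
  by (rule bij_betw_byWitness[of _ "\<lambda>\<xi>. (\<xi> x, \<xi>(x := {}))"])
    (use assms in \<open>auto simp: confs_def fun_eq_iff split: if_splits\<close>)

lemma prod_upd:
  assumes "finite V" "x \<in> V"
  shows "(\<Prod>v\<in>V. w ((\<xi>(x := s)) v)) = w s * (\<Prod>v\<in>V - {x}. (w (\<xi> v) :: real))"
  using assms by (simp add: prod.remove[of V x])

lemma wexp_split:
  assumes "finite V" "x \<in> V"
  shows "wexp V w f = (\<Sum>s\<in>UNIV. w s * wexp (V - {x}) w (\<lambda>\<xi>. f (\<xi>(x := s))))"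
proof -
  have "wexp V w f = (\<Sum>(s, \<xi>)\<in>UNIV \<times> confs (V - {x}).
      (\<Prod>v\<in>V. w ((\<xi>(x := s)) v)) * f (\<xi>(x := s)))"
    unfolding wexp_def
    by (subst sum.reindex_bij_betw[OF confs_insert_bij[OF assms(2)], symmetric])
      (simp add: case_prod_unfold)
  also have "\<dots> = (\<Sum>s\<in>UNIV. w s * wexp (V - {x}) w (\<lambda>\<xi>. f (\<xi>(x := s))))"
    using assms unfolding wexp_def
    by (simp add: sum.cartesian_product[symmetric] prod_upd sum_distrib_left mult.assoc
        del: fun_upd_apply)
  finally show ?thesis .
qed

lemma wexp_mono:
  assumes "\<And>s. 0 \<le> w s" "\<And>\<xi>. \<xi> \<in> confs V \<Longrightarrow> f \<xi> \<le> g \<xi>"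
  shows "wexp V w f \<le> wexp V w g"
  unfolding wexp_def by (intro sum_mono mult_left_mono assms prod_nonneg ballI)

lemma wexp_cong:
  assumes "\<And>\<xi>. \<xi> \<in> confs V \<Longrightarrow> f \<xi> = g \<xi>"
  shows "wexp V w f = wexp V w g"
  unfolding wexp_def using assms by simp

lemma wexp_add: "wexp V w (\<lambda>\<xi>. f \<xi> + g \<xi>) = wexp V w f + wexp V w g"
  by (simp add: wexp_def ring_distribs sum.distrib)

lemma wexp_cmult: "wexp V w (\<lambda>\<xi>. c * f \<xi>) = c * wexp V w f"
  by (simp add: wexp_def sum_distrib_left mult_ac)

lemma wexp_sum: "wexp V w (\<lambda>\<xi>. \<Sum>i\<in>I. f i \<xi>) = (\<Sum>i\<in>I. wexp V w (f i))"
  unfolding wexp_def sum_distrib_left by (rule sum.swap)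

lemma wexp_nonneg:
  assumes "\<And>s. 0 \<le> w s" "\<And>\<xi>. \<xi> \<in> confs V \<Longrightarrow> 0 \<le> f \<xi>"
  shows "0 \<le> wexp V w f"
  unfolding wexp_def by (intro sum_nonneg mult_nonneg_nonneg prod_nonneg assms ballI)

lemma wexp_one:
  assumes "finite V" "(\<Sum>s\<in>UNIV. w s) = 1"
  shows "wexp V w (\<lambda>_. 1) = 1"
  using assms(1)
proof (induction rule: finite_induct)
  case empty
  have "confs {} = {\<lambda>_. {}}" by (auto simp: confs_def)
  then show ?case by (simp add: wexp_def)
next
  case (insert x F)
  then have "insert x F - {x} = F" by auto
  then show ?case
    using wexp_split[of "insert x F" x w "\<lambda>_. 1"] insert assms(2) by simp
qed

section \<open>Russo's formula for the escape probability\<close>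

definition exitp :: "(int \<times> int) set \<Rightarrow> (dir set \<Rightarrow> real) \<Rightarrow> real" where
  "exitp V w = wexp V w (\<lambda>\<xi>. of_bool (exits V \<xi> (0,0)))"

text \<open>\<open>w\<close> may be signed: it is also applied to the derivative of a
  weight.\<close>

definition hit :: "(dir set \<Rightarrow> real) \<Rightarrow> dir set \<Rightarrow> real" where
  "hit w A = (\<Sum>s\<in>{s. s \<inter> A \<noteq> {}}. w s)"

lemma hit_empty [simp]: "hit w {} = 0"
  by (simp add: hit_def)

text \<open>By the product rule a single vertex \<open>x\<close> carries \<open>w'\<close>. Summing
  over its state leaves \<open>hit w'\<close> of the pivotal directions; configurations that escape
  without \<open>x\<close> cancel because \<open>w'\<close> has total mass zero.\<close>

lemma exitp_has_derivative:
  assumes V: "finite V" and w: "\<And>s. ((\<lambda>t. w t s) has_real_derivative w' s) (at t)"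
    and w0: "(\<Sum>s\<in>UNIV. w' s) = 0"
  shows "((\<lambda>t. exitp V (w t)) has_real_derivative
    (\<Sum>x\<in>V. wexp (V - {x}) (w t) (\<lambda>\<xi>. hit w' (ctx V x \<xi>)))) (at t)"
proof -
  let ?f = "\<lambda>\<xi>. of_bool (exits V \<xi> (0,0)) :: real"
  have "((\<lambda>t. \<Prod>v\<in>V. w t (\<xi> v)) has_real_derivative
      (\<Sum>x\<in>V. w' (\<xi> x) * (\<Prod>v\<in>V - {x}. w t (\<xi> v)))) (at t)" for \<xi>
    by (rule has_field_derivative_prod) (rule w)
  then have "((\<lambda>t. exitp V (w t)) has_real_derivative
      (\<Sum>\<xi>\<in>confs V. (\<Sum>x\<in>V. w' (\<xi> x) * (\<Prod>v\<in>V - {x}. w t (\<xi> v))) * ?f \<xi>)) (at t)"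
    unfolding exitp_def wexp_def by (intro DERIV_sum DERIV_cmult_right)
  also have "(\<Sum>\<xi>\<in>confs V. (\<Sum>x\<in>V. w' (\<xi> x) * (\<Prod>v\<in>V - {x}. w t (\<xi> v))) * ?f \<xi>)
    = (\<Sum>x\<in>V. \<Sum>\<xi>\<in>confs V. w' (\<xi> x) * (\<Prod>v\<in>V - {x}. w t (\<xi> v)) * ?f \<xi>)"
    unfolding sum_distrib_right by (rule sum.swap)
  also have "\<dots> = (\<Sum>x\<in>V. wexp (V - {x}) (w t) (\<lambda>\<xi>. hit w' (ctx V x \<xi>)))"
  proof (rule sum.cong[OF refl])
    fix x assume x: "x \<in> V"
    have fs: "(\<Sum>s\<in>UNIV. w' s * ?f (\<xi>(x := s))) = hit w' (ctx V x \<xi>)" if "\<xi> \<in> confs (V - {x})" for \<xi>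
    proof -
      have e: "\<xi> x = {}" using that by (auto simp: confs_def)
      show ?thesis
      proof (cases "exits V \<xi> (0,0)")
        case True
        then have "ctx V x \<xi> = {}" by (simp add: ctx_def)
        with True show ?thesis using exits_upd_ctx[of \<xi> x, OF e] w0
          by (simp del: fun_upd_apply)
      next
        case False
        have "(\<Sum>s\<in>UNIV. w' s * ?f (\<xi>(x := s))) = (\<Sum>s\<in>UNIV. if s \<inter> ctx V x \<xi> \<noteq> {} then w' s else 0)"
          by (rule sum.cong) (use exits_upd_ctx[of \<xi> x, OF e] False in \<open>auto simp del: fun_upd_apply\<close>)
        also have "\<dots> = hit w' (ctx V x \<xi>)"
          unfolding hit_def by (subst sum.If_cases) auto
        finally show ?thesis .
      qed
    qed
    have "(\<Sum>\<xi>\<in>confs V. w' (\<xi> x) * (\<Prod>v\<in>V - {x}. w t (\<xi> v)) * ?f \<xi>)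
      = (\<Sum>(s, \<xi>)\<in>UNIV \<times> confs (V - {x}). w' s * (\<Prod>v\<in>V - {x}. w t (\<xi> v)) * ?f (\<xi>(x := s)))"
      by (subst sum.reindex_bij_betw[OF confs_insert_bij[OF x], symmetric])
        (simp add: case_prod_unfold)
    also have "\<dots> = (\<Sum>\<xi>\<in>confs (V - {x}). (\<Prod>v\<in>V - {x}. w t (\<xi> v)) * (\<Sum>s\<in>UNIV. w' s * ?f (\<xi>(x := s))))"
      unfolding sum_distrib_left sum.cartesian_product[symmetric]
      by (subst sum.swap) (simp only: mult_ac)
    also have "\<dots> = wexp (V - {x}) (w t) (\<lambda>\<xi>. hit w' (ctx V x \<xi>))"
      unfolding wexp_def by (rule sum.cong[OF refl]) (simp only: fs)
    finally show "(\<Sum>\<xi>\<in>confs V. w' (\<xi> x) * (\<Prod>v\<in>V - {x}. w t (\<xi> v)) * ?f \<xi>)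
      = wexp (V - {x}) (w t) (\<lambda>\<xi>. hit w' (ctx V x \<xi>))" .
  qed
  finally show ?thesis .
qed

text \<open>Along the segment the derivative weight is \<open>w1 - w0\<close>, whatever
  \<open>t\<close> is. The sign condition concerns the sum over all vertices, so that a loss at one
  vertex can be paid for by a gain at another.\<close>

lemma exitp_interpolate:
  assumes V: "finite V" and s0: "(\<Sum>s\<in>UNIV. w0 s) = 1" and s1: "(\<Sum>s\<in>UNIV. w1 s) = 1"
    and der: "\<And>t. 0 \<le> t \<Longrightarrow> t \<le> 1 \<Longrightarrow>
      0 \<le> (\<Sum>x\<in>V. wexp (V - {x}) (\<lambda>s. (1 - t) * w0 s + t * w1 s)
        (\<lambda>\<xi>. hit w1 (ctx V x \<xi>) - hit w0 (ctx V x \<xi>)))"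
  shows "exitp V w0 \<le> exitp V w1"
proof -
  let ?w = "\<lambda>t s. (1 - t) * w0 s + t * w1 s"
  have h: "hit (\<lambda>s. w1 s - w0 s) A = hit w1 A - hit w0 A" for A
    by (simp add: hit_def sum_subtractf)
  have "((\<lambda>t. exitp V (?w t)) has_real_derivative
    (\<Sum>x\<in>V. wexp (V - {x}) (?w t) (\<lambda>\<xi>. hit (\<lambda>s. w1 s - w0 s) (ctx V x \<xi>)))) (at t)" for t
    by (rule exitp_has_derivative[OF V]) (auto intro!: derivative_eq_intros simp: sum_subtractf s0 s1)
  then have "exitp V (?w 0) \<le> exitp V (?w 1)"
    using der by (intro DERIV_nonneg_imp_nondecreasing[of 0 1 "\<lambda>t. exitp V (?w t)"]) (auto simp: h)
  then show ?thesis by simp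
qed

lemma exitp_mono_hit:
  assumes V: "finite V" and s0: "(\<Sum>s\<in>UNIV. w0 s) = 1" and s1: "(\<Sum>s\<in>UNIV. w1 s) = 1"
    and n0: "\<And>s. 0 \<le> w0 s" and n1: "\<And>s. 0 \<le> w1 s"
    and le: "\<And>A. hit w0 A \<le> hit w1 A"
  shows "exitp V w0 \<le> exitp V w1"
  by (rule exitp_interpolate[OF V s0 s1])
    (auto intro!: sum_nonneg wexp_nonneg add_nonneg_nonneg simp: n0 n1 le)

section \<open>Bernoulli weights\<close>

text \<open>Expectation for independent edges, indexed by the set of open edges. Exploration
  arguments need the independence of different edges at the same vertex, which weights of vertex
  states do not display.\<close>

definition bexp :: "real \<Rightarrow> 'e set \<Rightarrow> ('e set \<Rightarrow> real) \<Rightarrow> real" where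
  "bexp p E F = (\<Sum>\<eta>\<in>Pow E. p ^ card \<eta> * (1 - p) ^ card (E - \<eta>) * F \<eta>)"

lemma bexp_Un:
  assumes "finite A" "finite B" "A \<inter> B = {}"
  shows "bexp p (A \<union> B) (\<lambda>\<eta>. f (\<eta> \<inter> A) * g (\<eta> \<inter> B)) = bexp p A f * bexp p B g"
proof -
  have bij: "bij_betw (\<lambda>(\<alpha>, \<beta>). \<alpha> \<union> \<beta>) (Pow A \<times> Pow B) (Pow (A \<union> B))"
    by (rule bij_betw_byWitness[of _ "\<lambda>\<eta>. (\<eta> \<inter> A, \<eta> \<inter> B)"]) (use assms(3) in auto)
  have "bexp p (A \<union> B) (\<lambda>\<eta>. f (\<eta> \<inter> A) * g (\<eta> \<inter> B)) =
    (\<Sum>(\<alpha>, \<beta>)\<in>Pow A \<times> Pow B. p ^ card (\<alpha> \<union> \<beta>) * (1 - p) ^ card (A \<union> B - (\<alpha> \<union> \<beta>)) *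
       (f ((\<alpha> \<union> \<beta>) \<inter> A) * g ((\<alpha> \<union> \<beta>) \<inter> B)))"
    unfolding bexp_def by (subst sum.reindex_bij_betw[OF bij, symmetric]) (simp add: case_prod_unfold)
  also have "\<dots> = (\<Sum>(\<alpha>, \<beta>)\<in>Pow A \<times> Pow B. (p ^ card \<alpha> * (1 - p) ^ card (A - \<alpha>) * f \<alpha>) *
       (p ^ card \<beta> * (1 - p) ^ card (B - \<beta>) * g \<beta>))"
  proof (rule sum.cong[OF refl], clarify)
    fix \<alpha> \<beta> assume ab: "\<alpha> \<subseteq> A" "\<beta> \<subseteq> B"
    have 1: "card (\<alpha> \<union> \<beta>) = card \<alpha> + card \<beta>"
      using ab assms by (intro card_Un_disjoint) (auto intro: finite_subset)
    have "A \<union> B - (\<alpha> \<union> \<beta>) = (A - \<alpha>) \<union> (B - \<beta>)" using ab assms by auto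
    then have 2: "card (A \<union> B - (\<alpha> \<union> \<beta>)) = card (A - \<alpha>) + card (B - \<beta>)"
      using assms by (simp, intro card_Un_disjoint) auto
    have 3: "(\<alpha> \<union> \<beta>) \<inter> A = \<alpha>" "(\<alpha> \<union> \<beta>) \<inter> B = \<beta>" using ab assms by auto
    show "p ^ card (\<alpha> \<union> \<beta>) * (1 - p) ^ card (A \<union> B - (\<alpha> \<union> \<beta>)) *
       (f ((\<alpha> \<union> \<beta>) \<inter> A) * g ((\<alpha> \<union> \<beta>) \<inter> B)) = (p ^ card \<alpha> * (1 - p) ^ card (A - \<alpha>) * f \<alpha>) *
       (p ^ card \<beta> * (1 - p) ^ card (B - \<beta>) * g \<beta>)"
      unfolding 1 2 3 by (simp add: power_add)
  qed
  also have "\<dots> = bexp p A f * bexp p B g"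
    unfolding bexp_def sum_product sum.cartesian_product ..
  finally show ?thesis .
qed

lemma bexp_one: "finite E \<Longrightarrow> bexp p E (\<lambda>_. 1) = 1"
proof (induction rule: finite_induct)
  case (insert e E)
  have "{} \<noteq> {e}" "Pow {e} = {{}, {e}}" by auto
  then have "bexp p {e} (\<lambda>_. 1) = 1" by (simp add: bexp_def)
  with insert bexp_Un[of "{e}" E p "\<lambda>_. 1" "\<lambda>_. 1"] show ?case by simp
qed (simp add: bexp_def)

lemma bexp_sum: "bexp p E (\<lambda>\<eta>. \<Sum>i\<in>I. f i \<eta>) = (\<Sum>i\<in>I. bexp p E (f i))"
  unfolding bexp_def sum_distrib_left by (rule sum.swap)

lemma bexp_cong: "(\<And>\<eta>. \<eta> \<subseteq> E \<Longrightarrow> f \<eta> = g \<eta>) \<Longrightarrow> bexp p E f = bexp p E g"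
  unfolding bexp_def by (intro sum.cong) auto

lemma bexp_mono:
  assumes "0 \<le> p" "p \<le> 1" "\<And>\<eta>. \<eta> \<subseteq> E \<Longrightarrow> f \<eta> \<le> g \<eta>"
  shows "bexp p E f \<le> bexp p E g"
  unfolding bexp_def by (intro sum_mono mult_left_mono) (use assms in auto)

lemma bexp_nonneg:
  assumes "0 \<le> p" "p \<le> 1" "\<And>\<eta>. \<eta> \<subseteq> E \<Longrightarrow> 0 \<le> f \<eta>"
  shows "0 \<le> bexp p E f"
  unfolding bexp_def by (intro sum_nonneg) (use assms in auto)

lemma bexp_subset:
  assumes "finite B" "A \<subseteq> B" "\<And>\<eta>. \<eta> \<subseteq> B \<Longrightarrow> F \<eta> = f (\<eta> \<inter> A)"
  shows "bexp p B F = bexp p A f"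
proof -
  have fA: "finite A" using assms finite_subset by blast
  have B: "A \<union> (B - A) = B" using assms(2) by auto
  have "bexp p B F = bexp p (A \<union> (B - A)) (\<lambda>\<eta>. f (\<eta> \<inter> A) * 1)"
    unfolding B by (rule bexp_cong) (simp add: assms(3))
  also have "\<dots> = bexp p A f"
    using bexp_Un[of A "B - A" p f "\<lambda>_. 1"] fA assms by (simp add: bexp_one)
  finally show ?thesis .
qed

lemma bexp_indep:
  assumes "finite E" "A \<subseteq> E" "B \<subseteq> E" "A \<inter> B = {}"
    and "\<And>\<eta>. \<eta> \<subseteq> E \<Longrightarrow> F \<eta> = f (\<eta> \<inter> A) * g (\<eta> \<inter> B)"
  shows "bexp p E F = bexp p A f * bexp p B g"
proof -
  have "bexp p E F = bexp p (A \<union> B) (\<lambda>\<eta>. f (\<eta> \<inter> A) * g (\<eta> \<inter> B))"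
    by (rule bexp_subset) (use assms in \<open>auto simp: Int_assoc Int_absorb1\<close>)
  also have "\<dots> = bexp p A f * bexp p B g"
    using assms by (intro bexp_Un) (auto intro: finite_subset)
  finally show ?thesis .
qed

lemma bexp_reindex:
  assumes "inj_on g E"
  shows "bexp p (g ` E) F = bexp p E (\<lambda>\<eta>. F (g ` \<eta>))"
proof -
  have bij: "bij_betw ((`) g) (Pow E) (Pow (g ` E))"
    using assms by (simp add: bij_betw_def inj_on_image_Pow image_Pow_surj)
  show ?thesis unfolding bexp_def
  proof (subst sum.reindex_bij_betw[OF bij, symmetric], rule sum.cong[OF refl])
    fix \<eta> assume "\<eta> \<in> Pow E"
    then have s: "\<eta> \<subseteq> E" by simp
    have "g ` E - g ` \<eta> = g ` (E - \<eta>)" using assms s by (simp add: inj_on_image_set_diff)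
    then show "p ^ card (g ` \<eta>) * (1 - p) ^ card (g ` E - g ` \<eta>) * F (g ` \<eta>) =
         p ^ card \<eta> * (1 - p) ^ card (E - \<eta>) * F (g ` \<eta>)"
      using assms s by (simp add: card_image inj_on_subset)
  qed
qed

definition bw :: "real \<Rightarrow> dir set \<Rightarrow> real" where
  "bw p s = p ^ card s * (1 - p) ^ card (- s)"

definition conf :: "((int \<times> int) \<times> dir) set \<Rightarrow> config" where
  "conf \<eta> v = {d. (v, d) \<in> \<eta>}"

lemma conf_mono: "\<eta> \<subseteq> \<eta>' \<Longrightarrow> conf \<eta> v \<subseteq> conf \<eta>' v"
  by (auto simp: conf_def)

lemma wexp_bw:
  assumes "finite V"
  shows "wexp V (bw p) f = bexp p (V \<times> UNIV) (\<lambda>\<eta>. f (conf \<eta>))"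
proof -
  have bij: "bij_betw conf (Pow (V \<times> UNIV)) (confs V)"
    by (rule bij_betw_byWitness[of _ "\<lambda>\<xi>. {(v, d). d \<in> \<xi> v}"])
      (auto simp: conf_def confs_def fun_eq_iff)
  show ?thesis unfolding wexp_def bexp_def
  proof (subst sum.reindex_bij_betw[OF bij, symmetric], rule sum.cong[OF refl])
    fix \<eta> :: "((int \<times> int) \<times> dir) set" assume "\<eta> \<in> Pow (V \<times> UNIV)"
    then have 1: "\<eta> = Sigma V (conf \<eta>)" and 2: "V \<times> UNIV - \<eta> = Sigma V (\<lambda>v. - conf \<eta> v)"
      by (auto simp: conf_def)
    have "card \<eta> = (\<Sum>v\<in>V. card (conf \<eta> v))"
      by (subst 1) (simp add: assms)
    moreover have "card (V \<times> UNIV - \<eta>) = (\<Sum>v\<in>V. card (- conf \<eta> v))"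
      by (subst 2) (simp add: assms)
    ultimately show "(\<Prod>v\<in>V. bw p (conf \<eta> v)) * f (conf \<eta>) =
       p ^ card \<eta> * (1 - p) ^ card (V \<times> UNIV - \<eta>) * f (conf \<eta>)"
      by (simp add: bw_def prod.distrib power_sum)
  qed
qed

lemma sum_bw_disjoint: "(\<Sum>s\<in>{s. s \<inter> A = {}}. bw p s) = (1 - p) ^ card A"
proof -
  have "{s. s \<inter> A = {}} = Pow (- A)" by auto
  moreover have "card (- s) = card A + card (- A - s)" if "s \<subseteq> - A" for s
  proof -
    have "- s = A \<union> (- A - s)" using that by auto
    then show ?thesis by (metis card_Un_disjoint Diff_disjoint Diff_subset_conv Int_Diff
        boolean_algebra.conj_cancel_right empty_Diff finite)
  qed
  ultimately have "(\<Sum>s\<in>{s. s \<inter> A = {}}. bw p s) = (1 - p) ^ card A * bexp p (- A) (\<lambda>_. 1)"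
    by (simp add: bw_def bexp_def sum_distrib_left power_add mult_ac)
  then show ?thesis by (simp add: bexp_one)
qed

lemma sum_bw: "(\<Sum>s\<in>UNIV. bw p s) = 1"
  using sum_bw_disjoint[where A = "{}"] by simp

lemma hit_bw: "hit (bw p) A = 1 - (1 - p) ^ card A"
proof -
  have "(\<Sum>s\<in>UNIV. bw p s) = hit (bw p) A + (\<Sum>s\<in>{s. s \<inter> A = {}}. bw p s)"
    unfolding hit_def by (subst sum.union_disjoint[symmetric]) (auto intro: sum.cong)
  then show ?thesis by (simp add: sum_bw sum_bw_disjoint)
qed

lemma bw_nonneg: "0 \<le> p \<Longrightarrow> p \<le> 1 \<Longrightarrow> 0 \<le> bw p s"
  by (simp add: bw_def)

lemma exitp_bw_mono:
  assumes "finite V" "0 \<le> p" "p \<le> q" "q \<le> 1"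
  shows "exitp V (bw p) \<le> exitp V (bw q)"
  using assms by (intro exitp_mono_hit) (auto simp: sum_bw hit_bw bw_nonneg intro!: power_mono)

section \<open>The derivative of the escape probability\<close>

definition in_edges :: "(int \<times> int) set \<Rightarrow> ((int \<times> int) \<times> dir) set" where
  "in_edges S = {(v, d). v \<in> S \<and> v + step d \<in> S}"

definition out_edges :: "(int \<times> int) set \<Rightarrow> ((int \<times> int) \<times> dir) set" where
  "out_edges S = {(v, d). v \<in> S \<and> v + step d \<notin> S}"

text \<open>The functional of Duminil-Copin and Tassion without its factor \<open>p\<close>: the
  expected number of boundary edges of \<open>S\<close> whose tail is reached from the origin inside
  \<open>S\<close>.\<close>

definition psi :: "real \<Rightarrow> (int \<times> int) set \<Rightarrow> real" where
  "psi p S = (\<Sum>(x, d)\<in>out_edges S.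
     bexp p (in_edges S) (\<lambda>\<eta>. of_bool (((0,0), x) \<in> (edges (conf \<eta>))\<^sup>*)))"

definition stuck :: "(int \<times> int) set \<Rightarrow> config \<Rightarrow> (int \<times> int) set" where
  "stuck V \<xi> = {x \<in> V. \<not> exits V \<xi> x}"

lemma conf_iff: "d \<in> conf \<eta> v \<longleftrightarrow> (v, d) \<in> \<eta>"
  by (simp add: conf_def)

lemma finite_out_edges [simp]: "finite S \<Longrightarrow> finite (out_edges S)"
  by (rule finite_subset[of _ "S \<times> UNIV"]) (auto simp: out_edges_def)

lemma finite_in_edges [simp]: "finite S \<Longrightarrow> finite (in_edges S)"
  by (rule finite_subset[of _ "S \<times> UNIV"]) (auto simp: in_edges_def)

lemma psi_nonneg: "0 \<le> p \<Longrightarrow> p \<le> 1 \<Longrightarrow> 0 \<le> psi p S"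
  unfolding psi_def by (intro sum_nonneg) (auto intro!: bexp_nonneg)

lemma sum_out_edges:
  assumes "finite S"
  shows "(\<Sum>(x, d)\<in>out_edges S. f x) = (\<Sum>x\<in>S. real (card {d. x + step d \<notin> S}) * f x)"
proof -
  have "out_edges S = Sigma S (\<lambda>x. {d. x + step d \<notin> S})" by (auto simp: out_edges_def)
  then show ?thesis by (simp add: sum.Sigma[symmetric] assms)
qed

lemma reach_upd_empty:
  assumes "(a, x) \<in> (edges \<xi>)\<^sup>*"
  shows "(a, x) \<in> (edges (\<xi>(x := {})))\<^sup>*"
proof -
  let ?R = "edges (\<xi>(x := {}))" and ?Y = "(\<lambda>d. x + step d) ` \<xi> x"
  have "edges ((\<xi>(x := {}))(x := \<xi> x)) = ?R \<union> {x} \<times> ?Y"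
    by (rule edges_upd) simp
  then have "(a, x) \<in> (?R \<union> {x} \<times> ?Y)\<^sup>*"
    using assms by (simp only: fun_upd_upd fun_upd_triv)
  from rtrancl_star_at[OF this] show ?thesis by blast
qed

text \<open>Every open edge at a vertex that cannot escape leads to another such vertex, so closing
  these edges blocks no escape.\<close>

lemma exits_upd_stuck:
  assumes "\<not> exits V \<xi> x"
  shows "exits V (\<xi>(x := {})) a \<longleftrightarrow> exits V \<xi> a"
proof -
  have m: "exits V (\<xi>(x := {})) b \<Longrightarrow> exits V \<xi> b" for b
    by (erule exits_mono[rotated]) auto
  have "exits V \<xi> a \<longleftrightarrow> exits V (\<xi>(x := {})) a \<or> (a, x) \<in> (edges (\<xi>(x := {})))\<^sup>* \<and>
      (\<exists>d\<in>\<xi> x. exits V (\<xi>(x := {})) (x + step d))"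
    using exits_upd[of "\<xi>(x := {})" x V "\<xi> x" a] by (simp only: fun_upd_upd fun_upd_triv fun_upd_same)
  moreover have "\<not> (\<exists>d\<in>\<xi> x. exits V (\<xi>(x := {})) (x + step d))"
    using m assms exits_step[of _ \<xi> x V] by blast
  ultimately show ?thesis by blast
qed

text \<open>Closing \<open>x\<close> keeps it reachable and changes no escape, so the pivotal
  directions are those that leave \<open>stuck V \<xi>\<close>. All of them are closed in
  \<open>\<xi>\<close>, since an open one would let \<open>x\<close> escape.\<close>

lemma ctx_stuck:
  assumes x: "x \<in> stuck V \<xi>" and o: "(0,0) \<in> stuck V \<xi>" and r: "((0,0), x) \<in> (edges \<xi>)\<^sup>*"
  shows "ctx V x (\<xi>(x := {})) = {d. x + step d \<notin> stuck V \<xi>}"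
    and "\<xi> x \<inter> ctx V x (\<xi>(x := {})) = {}"
proof -
  have ne: "\<not> exits V \<xi> x" "\<not> exits V \<xi> (0,0)" using x o by (auto simp: stuck_def)
  show 1: "ctx V x (\<xi>(x := {})) = {d. x + step d \<notin> stuck V \<xi>}"
    unfolding ctx_def exits_upd_stuck[OF ne(1)] using reach_upd_empty[OF r] ne(2)
    by (auto simp: stuck_def intro: exits_outside)
  show "\<xi> x \<inter> ctx V x (\<xi>(x := {})) = {}"
  proof -
    have "exits V \<xi> y" if "y \<notin> stuck V \<xi>" for y
      using that exits_outside[of y V] by (auto simp: stuck_def)
    then show ?thesis unfolding 1 using ne(1) exits_step[of _ \<xi> x V] by blast
  qed
qed

lemma bw_differentiable: "(\<lambda>t. bw t s) differentiable (at p)"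
  unfolding bw_def by (intro derivative_intros)

text \<open>The derivative \<open>w'\<close> of the weight is never computed:
  \<open>hit (bw t) A\<close> is the polynomial \<open>1 - (1 - t) ^ card A\<close>, and uniqueness
  of derivatives identifies \<open>hit w' A\<close>.\<close>

lemma exitp_bw_has_derivative:
  assumes V: "finite V"
  shows "((\<lambda>t. exitp V (bw t)) has_real_derivative
    (\<Sum>x\<in>V. wexp (V - {x}) (bw p) (\<lambda>\<xi>. real (card (ctx V x \<xi>)) * (1 - p) ^ (card (ctx V x \<xi>) - 1)))) (at p)"
proof -
  have "\<forall>s. \<exists>D. ((\<lambda>t. bw t s) has_real_derivative D) (at p)"
    using bw_differentiable unfolding real_differentiable_def by (rule allI)
  from choice[OF this] obtain w' where w': "((\<lambda>t. bw t s) has_real_derivative w' s) (at p)" for s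
    by blast
  have s: "((\<lambda>t. \<Sum>s\<in>X. bw t s) has_real_derivative (\<Sum>s\<in>X. w' s)) (at p)" for X
    by (rule DERIV_sum) (rule w')
  have "((\<lambda>t. 1) has_real_derivative (\<Sum>s\<in>UNIV. w' s)) (at p)"
    using s[of UNIV] unfolding sum_bw .
  then have w0: "(\<Sum>s\<in>UNIV. w' s) = 0"
    by (rule DERIV_unique) (rule DERIV_const)
  have 1: "((\<lambda>t. 1 - (1 - t) ^ card A) has_real_derivative hit w' A) (at p)" for A
    using s[of "{s. s \<inter> A \<noteq> {}}"] unfolding hit_def[symmetric] hit_bw .
  have 2: "((\<lambda>t. 1 - (1 - t) ^ k) has_real_derivative real k * (1 - p) ^ (k - 1)) (at p)" for k
    by (auto intro!: derivative_eq_intros)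
  have "hit w' A = real (card A) * (1 - p) ^ (card A - 1)" for A
    by (rule DERIV_unique[OF 1 2])
  then show ?thesis using exitp_has_derivative[OF V w' w0] by simp
qed

text \<open>The factor \<open>(1 - p) ^ card\<close> is the probability that all pivotal directions
  at \<open>x\<close> are closed. Hence the state of \<open>x\<close> can be put back and the sum
  becomes an expectation over configurations on all of \<open>V\<close>.\<close>

lemma wexp_ctx_bw:
  assumes V: "finite V" "x \<in> V"
  shows "wexp (V - {x}) (bw p) (\<lambda>\<xi>. real (card (ctx V x \<xi>)) * (1 - p) ^ card (ctx V x \<xi>)) =
    wexp V (bw p) (\<lambda>\<xi>. real (card (ctx V x (\<xi>(x := {})))) * of_bool (\<xi> x \<inter> ctx V x (\<xi>(x := {})) = {}))"
    (is "?L = ?R")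
proof -
  have "?R = wexp (V - {x}) (bw p) (\<lambda>\<xi>. \<Sum>s\<in>UNIV. bw p s *
      (real (card (ctx V x (\<xi>(x := {})))) * of_bool (s \<inter> ctx V x (\<xi>(x := {})) = {})))"
    unfolding wexp_split[OF V] wexp_sum wexp_cmult[symmetric] by simp
  also have "\<dots> = ?L"
  proof (rule wexp_cong)
    fix \<xi> assume "\<xi> \<in> confs (V - {x})"
    then have "\<xi>(x := {}) = \<xi>" by (auto simp: confs_def fun_eq_iff)
    then have "(\<Sum>s\<in>UNIV. bw p s *
      (real (card (ctx V x (\<xi>(x := {})))) * of_bool (s \<inter> ctx V x (\<xi>(x := {})) = {}))) =
      real (card (ctx V x \<xi>)) * (\<Sum>s\<in>UNIV. if s \<inter> ctx V x \<xi> = {} then bw p s else 0)"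
      unfolding sum_distrib_left by (intro sum.cong refl) simp
    also have "(\<Sum>s\<in>UNIV. if s \<inter> ctx V x \<xi> = {} then bw p s else 0) = (1 - p) ^ card (ctx V x \<xi>)"
      unfolding sum_bw_disjoint[symmetric] by (subst sum.If_cases) auto
    finally show "(\<Sum>s\<in>UNIV. bw p s *
      (real (card (ctx V x (\<xi>(x := {})))) * of_bool (s \<inter> ctx V x (\<xi>(x := {})) = {}))) =
      real (card (ctx V x \<xi>)) * (1 - p) ^ card (ctx V x \<xi>)" .
  qed
  finally show ?thesis by simp
qed

text \<open>Only the term with \<open>S = stuck V \<xi>\<close> survives, and for it each boundary
  edge with a reached tail is a closed pivotal direction.\<close>

lemma sum_ctx_ge:
  assumes V: "finite V"
  shows "(\<Sum>S\<in>{S. S \<subseteq> V \<and> (0,0) \<in> S}. of_bool (stuck V \<xi> = S) *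
      (\<Sum>(x, d)\<in>out_edges S. of_bool (((0,0), x) \<in> (edges \<xi>)\<^sup>*)))
    \<le> (\<Sum>x\<in>V. real (card (ctx V x (\<xi>(x := {})))) * of_bool (\<xi> x \<inter> ctx V x (\<xi>(x := {})) = {}))"
    (is "?L \<le> ?R")
proof (cases "(0,0) \<in> stuck V \<xi>")
  case False
  then have "?L = 0" by (intro sum.neutral) auto
  also have "0 \<le> ?R" by (intro sum_nonneg) auto
  finally show ?thesis .
next
  case True
  let ?N = "stuck V \<xi>"
  have N: "?N \<subseteq> V" by (auto simp: stuck_def)
  have fN: "finite ?N" using N V by (rule finite_subset)
  have "?L = (\<Sum>S\<in>{?N}. of_bool (stuck V \<xi> = S) *
      (\<Sum>(x, d)\<in>out_edges S. of_bool (((0,0), x) \<in> (edges \<xi>)\<^sup>*)))"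
    by (rule sum.mono_neutral_right) (use V N True in auto)
  also have "\<dots> = (\<Sum>x\<in>?N. real (card {d. x + step d \<notin> ?N}) * of_bool (((0,0), x) \<in> (edges \<xi>)\<^sup>*))"
    using sum_out_edges[OF fN, of "\<lambda>x. of_bool (((0,0), x) \<in> (edges \<xi>)\<^sup>*)"] by simp
  also have "\<dots> \<le> (\<Sum>x\<in>?N. real (card (ctx V x (\<xi>(x := {})))) * of_bool (\<xi> x \<inter> ctx V x (\<xi>(x := {})) = {}))"
  proof (rule sum_mono)
    fix x assume x: "x \<in> ?N"
    show "real (card {d. x + step d \<notin> ?N}) * of_bool (((0,0), x) \<in> (edges \<xi>)\<^sup>*) \<le>
        real (card (ctx V x (\<xi>(x := {})))) * of_bool (\<xi> x \<inter> ctx V x (\<xi>(x := {})) = {})"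
    proof (cases "((0,0), x) \<in> (edges \<xi>)\<^sup>*")
      case r: True
      show ?thesis using ctx_stuck[OF x True r] r by simp
    qed simp
  qed
  also have "\<dots> \<le> ?R" by (rule sum_mono2) (use V N in auto)
  finally show ?thesis .
qed

text \<open>The vertices that escape are found by exploring backwards from outside \<open>V\<close>,
  and this exploration never inspects an edge with both ends in \<open>S\<close>.\<close>

lemma stuck_cong_in_edges:
  assumes N: "stuck V (conf \<eta>) = S" and eq: "\<eta> - in_edges S = \<eta>' - in_edges S"
  shows "stuck V (conf \<eta>') = S"
proof -
  have SV: "S \<subseteq> V" using N by (auto simp: stuck_def)
  have "\<not> exits V (conf \<eta>') x" if x: "x \<in> S" for x
    using x SV
  proof (rule not_exits_closed)
    fix y d assume y: "y \<in> S" "d \<in> conf \<eta>' y"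
    show "y + step d \<in> S"
    proof (rule ccontr)
      assume n: "y + step d \<notin> S"
      then have "(y, d) \<in> \<eta>" using y eq by (auto simp: conf_iff in_edges_def)
      moreover have "exits V (conf \<eta>) (y + step d)" using n N exits_outside[of "y + step d" V] by (auto simp: stuck_def)
      ultimately have "exits V (conf \<eta>) y" using exits_step[of d "conf \<eta>"] by (auto simp: conf_iff)
      then show False using y N by (auto simp: stuck_def)
    qed
  qed
  moreover have "exits V (conf \<eta>') x" if "exits V (conf \<eta>) x" for x
    using that
  proof (induction rule: exits_induct)
    case (outside z)
    then show ?case by (rule exits_outside)
  next
    case (step x d)
    then have "x \<notin> S" using N by (auto simp: stuck_def)
    then have "(x, d) \<in> \<eta>'" using step(1) eq by (auto simp: conf_iff in_edges_def)
    then show ?case using step(4) exits_step[of d "conf \<eta>'"] by (auto simp: conf_iff)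
  qed
  ultimately show ?thesis using N SV by (auto simp: stuck_def)
qed

lemma stuck_cong_in_edges_iff:
  "\<eta> - in_edges S = \<eta>' - in_edges S \<Longrightarrow> stuck V (conf \<eta>) = S \<longleftrightarrow> stuck V (conf \<eta>') = S"
  using stuck_cong_in_edges by metis

text \<open>Given that \<open>S\<close> is the set of vertices that cannot escape, the edges inside \<open>S\<close> are still
  independent, so the derivative is at least the infimum of \<open>psi\<close> times the probability of not escaping.\<close>

lemma exitp_bw_derivative_ge:
  assumes V: "finite V" "(0,0) \<in> V" and p: "0 \<le> p" "p \<le> 1"
    and psi: "\<And>S. finite S \<Longrightarrow> (0,0) \<in> S \<Longrightarrow> 1 \<le> p * psi p S"
  shows "\<exists>D. ((\<lambda>t. exitp V (bw t)) has_real_derivative D) (at p) \<and> 1 - exitp V (bw p) \<le> D"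
proof (intro exI conjI)
  let ?E = "V \<times> (UNIV :: dir set)"
  let ?SS = "{S. S \<subseteq> V \<and> (0,0) \<in> S}"
  let ?D = "\<Sum>x\<in>V. wexp (V - {x}) (bw p) (\<lambda>\<xi>. real (card (ctx V x \<xi>)) * (1 - p) ^ (card (ctx V x \<xi>) - 1))"
  let ?P = "\<lambda>S. bexp p ?E (\<lambda>\<eta>. of_bool (stuck V (conf \<eta>) = S))"
  show "((\<lambda>t. exitp V (bw t)) has_real_derivative ?D) (at p)"
    by (rule exitp_bw_has_derivative[OF V(1)])
  have fE: "finite ?E" using V by simp
  have psi1: "1 \<le> psi p S" if "finite S" "(0,0) \<in> S" for S
  proof -
    have "p * psi p S \<le> 1 * psi p S" using p psi_nonneg[OF p] by (intro mult_right_mono) auto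
    with psi[OF that] show ?thesis by simp
  qed
  have "1 - exitp V (bw p) = bexp p ?E (\<lambda>\<eta>. \<Sum>S\<in>?SS. of_bool (stuck V (conf \<eta>) = S))"
  proof -
    have "bexp p ?E (\<lambda>\<eta>. \<Sum>S\<in>?SS. of_bool (stuck V (conf \<eta>) = S)) + exitp V (bw p) =
      bexp p ?E (\<lambda>\<eta>. (\<Sum>S\<in>?SS. of_bool (stuck V (conf \<eta>) = S)) + of_bool (exits V (conf \<eta>) (0,0)))"
      unfolding exitp_def wexp_bw[OF V(1)] by (simp add: bexp_def ring_distribs sum.distrib)
    also have "\<dots> = bexp p ?E (\<lambda>\<eta>. 1)"
    proof (rule bexp_cong)
      fix \<eta> :: "((int \<times> int) \<times> dir) set"
      have "(\<Sum>S\<in>?SS. of_bool (stuck V (conf \<eta>) = S)) = (of_bool (stuck V (conf \<eta>) \<in> ?SS) :: real)"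
        unfolding of_bool_def using V(1) by (subst sum.delta') auto
      then show "(\<Sum>S\<in>?SS. of_bool (stuck V (conf \<eta>) = S)) + of_bool (exits V (conf \<eta>) (0,0)) = (1 :: real)"
        using V(2) by (simp add: stuck_def Collect_mono_iff)
    qed
    finally show ?thesis by (simp add: bexp_one fE)
  qed
  also have "\<dots> = (\<Sum>S\<in>?SS. ?P S)" by (rule bexp_sum)
  also have "\<dots> \<le> (\<Sum>S\<in>?SS. ?P S * psi p S)"
  proof (rule sum_mono)
    fix S assume S: "S \<in> ?SS"
    have "?P S * 1 \<le> ?P S * psi p S"
      using S V finite_subset by (intro mult_left_mono psi1 bexp_nonneg p) auto
    then show "?P S \<le> ?P S * psi p S" by simp
  qed
  also have "\<dots> \<le> (\<Sum>S\<in>?SS. \<Sum>(x, d)\<in>out_edges S. bexp p ?E (\<lambda>\<eta>. of_bool (stuck V (conf \<eta>) = S) *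
      of_bool (((0,0), x) \<in> (edges (conf \<eta>))\<^sup>*)))"
  proof (rule sum_mono)
    fix S assume S: "S \<in> ?SS"
    have iE: "in_edges S \<subseteq> ?E" using S by (auto simp: in_edges_def)
    have a: "?P S = bexp p (?E - in_edges S) (\<lambda>\<eta>. of_bool (stuck V (conf \<eta>) = S))"
    proof (rule bexp_subset[OF fE])
      fix \<eta> assume "\<eta> \<subseteq> ?E"
      then have "\<eta> - in_edges S = \<eta> \<inter> (?E - in_edges S) - in_edges S" by auto
      from stuck_cong_in_edges_iff[OF this]
      show "of_bool (stuck V (conf \<eta>) = S) = of_bool (stuck V (conf (\<eta> \<inter> (?E - in_edges S))) = S)" by simp
    qed auto
    have "?P S * bexp p (in_edges S) (\<lambda>\<eta>. of_bool (((0,0), x) \<in> (edges (conf \<eta>))\<^sup>*)) \<le>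
       bexp p ?E (\<lambda>\<eta>. of_bool (stuck V (conf \<eta>) = S) * of_bool (((0,0), x) \<in> (edges (conf \<eta>))\<^sup>*))"
      (is "?L \<le> ?R") for x
    proof -
      have "?L = bexp p ?E (\<lambda>\<eta>. of_bool (stuck V (conf (\<eta> \<inter> (?E - in_edges S))) = S) *
          of_bool (((0,0), x) \<in> (edges (conf (\<eta> \<inter> in_edges S)))\<^sup>*))"
        unfolding a by (rule bexp_indep[symmetric]) (use fE iE in auto)
      also have "\<dots> \<le> ?R"
      proof (rule bexp_mono[OF p])
        fix \<eta> assume "\<eta> \<subseteq> ?E"
        then have "\<eta> - in_edges S = \<eta> \<inter> (?E - in_edges S) - in_edges S" by auto
        note 1 = stuck_cong_in_edges_iff[OF this]
        have "edges (conf (\<eta> \<inter> in_edges S)) \<subseteq> edges (conf \<eta>)"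
          by (rule edges_mono) (auto simp: conf_def)
        note 2 = rtrancl_mono[OF this]
        show "of_bool (stuck V (conf (\<eta> \<inter> (?E - in_edges S))) = S) *
          of_bool (((0,0), x) \<in> (edges (conf (\<eta> \<inter> in_edges S)))\<^sup>*) \<le>
          (of_bool (stuck V (conf \<eta>) = S) * of_bool (((0,0), x) \<in> (edges (conf \<eta>))\<^sup>*) :: real)"
          unfolding 1 using 2 by (auto simp: of_bool_def)
      qed
      finally show ?thesis .
    qed
    then show "?P S * psi p S \<le> (\<Sum>(x, d)\<in>out_edges S. bexp p ?E (\<lambda>\<eta>. of_bool (stuck V (conf \<eta>) = S) *
      of_bool (((0,0), x) \<in> (edges (conf \<eta>))\<^sup>*)))"
      unfolding psi_def sum_distrib_left by (intro sum_mono) (simp add: case_prod_unfold)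
  qed
  also have "\<dots> = bexp p ?E (\<lambda>\<eta>. \<Sum>S\<in>?SS. of_bool (stuck V (conf \<eta>) = S) *
      (\<Sum>(x, d)\<in>out_edges S. of_bool (((0,0), x) \<in> (edges (conf \<eta>))\<^sup>*)))"
    unfolding bexp_sum sum_distrib_left case_prod_unfold ..
  also have "\<dots> = wexp V (bw p) (\<lambda>\<xi>. \<Sum>S\<in>?SS. of_bool (stuck V \<xi> = S) *
      (\<Sum>(x, d)\<in>out_edges S. of_bool (((0,0), x) \<in> (edges \<xi>)\<^sup>*)))"
    unfolding wexp_bw[OF V(1)] ..
  also have "\<dots> \<le> wexp V (bw p) (\<lambda>\<xi>. \<Sum>x\<in>V. real (card (ctx V x (\<xi>(x := {})))) *
      of_bool (\<xi> x \<inter> ctx V x (\<xi>(x := {})) = {}))"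
    by (rule wexp_mono) (auto intro: bw_nonneg p sum_ctx_ge V)
  also have "\<dots> = (\<Sum>x\<in>V. wexp (V - {x}) (bw p) (\<lambda>\<xi>. real (card (ctx V x \<xi>)) * (1 - p) ^ card (ctx V x \<xi>)))"
    unfolding wexp_sum using V(1) by (simp add: wexp_ctx_bw)
  \<comment> \<open>The derivative has one factor \<open>1 - p \<le> 1\<close> fewer in each
    term.\<close>
  also have "\<dots> \<le> ?D"
    by (intro sum_mono wexp_mono mult_left_mono power_decreasing) (auto intro: bw_nonneg p simp: p)
  finally show "1 - exitp V (bw p) \<le> ?D" .
qed

section \<open>Decay below criticality\<close>

definition square :: "nat \<Rightarrow> (int \<times> int) set" where
  "square n = {- int n..int n} \<times> {- int n..int n}"

lemma finite_square [simp]: "finite (square n)"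
  by (simp add: square_def)

lemma square_mono: "m \<le> n \<Longrightarrow> square m \<subseteq> square n"
  by (auto simp: square_def)

lemma origin_in_square [simp]: "(0, 0) \<in> square n"
  by (simp add: square_def)

lemma finite_subset_square:
  assumes "finite S"
  obtains n where "S \<subseteq> square n"
proof -
  let ?f = "\<lambda>v :: int \<times> int. nat (max \<bar>fst v\<bar> \<bar>snd v\<bar>)"
  define N where "N = (\<Sum>v\<in>S. ?f v)"
  have "S \<subseteq> square N"
  proof
    fix v assume "v \<in> S"
    then have "?f v \<le> N" unfolding N_def using assms by (intro member_le_sum) auto
    moreover obtain a b where "v = (a, b)" by (cases v)
    ultimately show "v \<in> square N" unfolding square_def by auto
  qed
  then show ?thesis ..
qed

lemma step_in_square: "x \<in> square n \<Longrightarrow> x + step d \<in> square (Suc n)"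
  by (cases x; cases d) (auto simp: square_def)

lemma square_translate: "x \<in> square m \<Longrightarrow> (+) x ` square n \<subseteq> square (n + m)"
  by (cases x) (auto simp: square_def)

section \<open>Monotonicity and translation of escape events\<close>

lemma exits_conf_mono: "\<eta> \<subseteq> \<eta>' \<Longrightarrow> exits V (conf \<eta>) x \<Longrightarrow> exits V (conf \<eta>') x"
  by (erule exits_mono[rotated]) (rule conf_mono)

lemma exits_antimono:
  assumes "V' \<subseteq> V" "exits V \<xi> x"
  shows "exits V' \<xi> x"
  using assms(2,1) by (auto simp: exits_def)

lemma exits_translate:
  "exits ((+) y ` V) (conf ((\<lambda>(v, d). (y + v, d)) ` \<eta>)) (y + x) \<longleftrightarrow> exits V (conf \<eta>) x"
proof
  let ?\<eta> = "(\<lambda>(v, d). (y + v, d)) ` \<eta>"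
  have "exits V (conf \<eta>) (z - y)" if "exits ((+) y ` V) (conf ?\<eta>) z" for z
    using that
  proof (induction rule: exits_induct)
    case (outside z)
    then have "z - y \<notin> V" by (auto simp: image_iff algebra_simps)
    then show ?case by (rule exits_outside)
  next
    case (step x d)
    have "d \<in> conf \<eta> (x - y)" using step(1) by (auto simp: conf_iff)
    moreover have "x + step d - y = (x - y) + step d" by simp
    ultimately show ?case using step(4) exits_step[of d "conf \<eta>"] by metis
  qed
  from this[of "y + x"] show "exits ((+) y ` V) (conf ?\<eta>) (y + x) \<Longrightarrow> exits V (conf \<eta>) x" by simp
  assume "exits V (conf \<eta>) x"
  then show "exits ((+) y ` V) (conf ?\<eta>) (y + x)"
  proof (induction rule: exits_induct)
    case (outside z)
    then have "y + z \<notin> (+) y ` V" by auto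
    then show ?case by (rule exits_outside)
  next
    case (step x d)
    have "d \<in> conf ?\<eta> (y + x)" using step(1) by (auto simp: conf_iff)
    moreover have "y + (x + step d) = (y + x) + step d" by (simp add: add.assoc)
    ultimately show ?case using step(4) exits_step[of d "conf ?\<eta>"] by metis
  qed
qed

lemma exits_conf_restrict:
  "exits V (conf (\<eta> \<inter> V \<times> UNIV)) x \<longleftrightarrow> exits V (conf \<eta>) x"
  by (rule exits_cong) (auto simp: conf_iff)

text \<open>Edges missing from \<open>E\<close> count as closed, which only lowers the probability,
  so \<open>E\<close> may be any finite set. Escape from \<open>V\<close> entails escape from the
  translated square inside it.\<close>

lemma bexp_exits_le_translate:
  assumes p: "0 \<le> p" "p \<le> 1" and E: "finite E" and n: "(+) y ` square n \<subseteq> V"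
  shows "bexp p E (\<lambda>\<eta>. of_bool (exits V (conf \<eta>) y)) \<le> exitp (square n) (bw p)"
proof -
  let ?V = "(+) y ` square n"
  let ?g = "\<lambda>(v :: int \<times> int, d :: dir). (y + v, d)"
  let ?E = "?V \<times> (UNIV :: dir set)"
  have inj: "inj_on ?g X" for X by (auto simp: inj_on_def)
  have img: "?E = ?g ` (square n \<times> UNIV)" by (simp add: image_paired_Times)
  have "bexp p E (\<lambda>\<eta>. of_bool (exits V (conf \<eta>) y)) \<le> bexp p E (\<lambda>\<eta>. of_bool (exits ?V (conf \<eta>) y))"
    using exits_antimono[OF n] by (intro bexp_mono[OF p]) (auto simp: of_bool_def)
  also have "\<dots> = bexp p (E \<inter> ?E) (\<lambda>\<eta>. of_bool (exits ?V (conf \<eta>) y))"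
  proof (rule bexp_subset[OF E])
    fix \<eta> assume "\<eta> \<subseteq> E"
    then have "\<eta> \<inter> (E \<inter> ?E) = \<eta> \<inter> ?E" by auto
    then show "of_bool (exits ?V (conf \<eta>) y) = of_bool (exits ?V (conf (\<eta> \<inter> (E \<inter> ?E))) y)"
      by (simp add: exits_conf_restrict)
  qed simp
  also have "\<dots> = bexp p ?E (\<lambda>\<eta>. of_bool (exits ?V (conf (\<eta> \<inter> (E \<inter> ?E))) y))"
    by (rule bexp_subset[symmetric]) auto
  also have "\<dots> \<le> bexp p ?E (\<lambda>\<eta>. of_bool (exits ?V (conf \<eta>) y))"
    using exits_conf_mono[OF Int_lower1] by (intro bexp_mono[OF p]) (auto simp: of_bool_def)
  also have "\<dots> = bexp p (square n \<times> UNIV) (\<lambda>\<eta>. of_bool (exits ?V (conf (?g ` \<eta>)) (y + (0,0))))"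
    unfolding img bexp_reindex[OF inj] by (simp add: zero_prod_def[symmetric])
  also have "\<dots> = exitp (square n) (bw p)"
    unfolding exits_translate exitp_def wexp_bw[OF finite_square] ..
  finally show ?thesis .
qed

definition cluster :: "(int \<times> int) set \<Rightarrow> ((int \<times> int) \<times> dir) set \<Rightarrow> (int \<times> int) set" where
  "cluster S \<eta> = {x. ((0,0), x) \<in> (edges (conf (\<eta> \<inter> in_edges S)))\<^sup>*}"

lemma cluster_mono: "\<eta> \<subseteq> \<eta>' \<Longrightarrow> cluster S \<eta> \<subseteq> cluster S \<eta>'"
proof -
  assume "\<eta> \<subseteq> \<eta>'"
  then have "edges (conf (\<eta> \<inter> in_edges S)) \<subseteq> edges (conf (\<eta>' \<inter> in_edges S))"
    by (intro edges_mono conf_mono) auto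
  from rtrancl_mono[OF this] show ?thesis unfolding cluster_def by blast
qed

lemma origin_in_cluster: "(0, 0) \<in> cluster S \<eta>"
  by (simp add: cluster_def)

lemma cluster_step: "x \<in> cluster S \<eta> \<Longrightarrow> (x, d) \<in> \<eta> \<Longrightarrow> (x, d) \<in> in_edges S \<Longrightarrow> x + step d \<in> cluster S \<eta>"
  unfolding cluster_def
  by (auto intro!: rtrancl_into_rtrancl[of _ x _ "x + step d"] edgesI simp: conf_iff)

lemma cluster_induct [consumes 1, case_names origin step]:
  assumes "x \<in> cluster S \<eta>" "P (0,0)"
    and "\<And>x d. x \<in> cluster S \<eta> \<Longrightarrow> P x \<Longrightarrow> (x, d) \<in> \<eta> \<Longrightarrow> (x, d) \<in> in_edges S \<Longrightarrow> P (x + step d)"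
  shows "P x"
proof -
  have "((0,0), x) \<in> (edges (conf (\<eta> \<inter> in_edges S)))\<^sup>*" using assms(1) by (simp add: cluster_def)
  then show ?thesis
  proof (induction rule: rtrancl_induct)
    case (step y z)
    then obtain d where "(y, d) \<in> \<eta>" "(y, d) \<in> in_edges S" "z = y + step d" by (auto simp: edges_iff conf_iff)
    with step assms(3) show ?case by (auto simp: cluster_def)
  qed (rule assms(2))
qed

lemma cluster_subset: "(0,0) \<in> S \<Longrightarrow> cluster S \<eta> \<subseteq> S"
proof
  fix x assume "(0,0) \<in> S" "x \<in> cluster S \<eta>"
  from this(2,1) show "x \<in> S" by (induction rule: cluster_induct) (auto simp: in_edges_def)
qed

text \<open>Exploring from the origin inside \<open>S\<close> inspects only edges that start at a
  vertex already found, so edges with tail outside \<open>T\<close> cannot influence whether the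
  outcome is \<open>T\<close>.\<close>

lemma cluster_restrict: "cluster S \<eta> = T \<longleftrightarrow> cluster S (\<eta> \<inter> T \<times> UNIV) = T"
proof
  assume T: "cluster S \<eta> = T"
  have "x \<in> cluster S (\<eta> \<inter> T \<times> UNIV)" if "x \<in> cluster S \<eta>" for x
    using that
  proof (induction rule: cluster_induct)
    case (step x d)
    then show ?case using T by (intro cluster_step) auto
  qed (rule origin_in_cluster)
  then show "cluster S (\<eta> \<inter> T \<times> UNIV) = T"
    using T cluster_mono[of "\<eta> \<inter> T \<times> UNIV" \<eta> S] by auto
next
  assume T: "cluster S (\<eta> \<inter> T \<times> UNIV) = T"
  have "x \<in> T" if "x \<in> cluster S \<eta>" for x
    using that
  proof (induction rule: cluster_induct)
    case origin
    show ?case using T origin_in_cluster by blast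
  next
    case (step x d)
    then have "x + step d \<in> cluster S (\<eta> \<inter> T \<times> UNIV)" using T by (intro cluster_step) auto
    then show ?case using T by simp
  qed
  then show "cluster S \<eta> = T"
    using T cluster_mono[of "\<eta> \<inter> T \<times> UNIV" \<eta> S] by auto
qed

text \<open>Follow an escape path to its last vertex in the cluster. The next step must leave
  \<open>S\<close>, since otherwise its end would belong to the cluster, and the rest of the path
  uses no edge that starts in the cluster.\<close>

lemma exits_last_boundary_edge:
  assumes S: "(0,0) \<in> S" "S \<subseteq> V" and ex: "exits V (conf \<eta>) (0,0)"
  shows "\<exists>(x, d)\<in>out_edges S. x \<in> cluster S \<eta> \<and> (x, d) \<in> \<eta> \<and>
    exits V (conf (\<eta> - cluster S \<eta> \<times> UNIV)) (x + step d)" (is ?Q)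
proof (rule ccontr)
  assume nQ: "\<not> ?Q"
  let ?\<eta> = "\<eta> - cluster S \<eta> \<times> UNIV"
  have "exits V (conf ?\<eta>) y \<and> y \<notin> cluster S \<eta>" if "exits V (conf \<eta>) y" for y
    using that
  proof (induction rule: exits_induct)
    case (outside z)
    then show ?case using cluster_subset[OF S(1)] S(2) by (auto intro: exits_outside)
  next
    case (step y d)
    have "y \<notin> cluster S \<eta>"
    proof
      assume y: "y \<in> cluster S \<eta>"
      then have yS: "y \<in> S" using cluster_subset[OF S(1)] by auto
      show False
      proof (cases "y + step d \<in> S")
        case True
        then have "y + step d \<in> cluster S \<eta>"
          using y yS step(1) by (intro cluster_step) (auto simp: in_edges_def conf_iff)
        with step(4) show False by simp
      next
        case False
        then show False using nQ y yS step by (auto simp: out_edges_def conf_iff)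
      qed
    qed
    then show ?case using step(1,4) exits_step[of d "conf ?\<eta>" y V] by (auto simp: conf_iff)
  qed
  from this[OF ex] show False using origin_in_cluster by blast
qed

text \<open>Fixing the cluster \<open>T\<close> makes its formation, the boundary edge and the
  remaining escape depend on disjoint sets of edges, so they are independent; this takes the place
  of the van den Berg-Kesten inequality.\<close>

lemma exitp_square_decay:
  assumes S: "finite S" "(0,0) \<in> S" "S \<subseteq> square r" and p: "0 \<le> p" "p \<le> 1"
  shows "exitp (square (n + Suc r)) (bw p) \<le> p * psi p S * exitp (square n) (bw p)"
proof -
  let ?V = "square (n + Suc r)"
  let ?E = "?V \<times> (UNIV :: dir set)"
  let ?th = "exitp (square n) (bw p)"
  have SV: "S \<subseteq> ?V" using S(3) square_mono[of r "n + Suc r"] by auto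
  let ?SS = "\<lambda>x. {T. T \<subseteq> S \<and> x \<in> T}"
  let ?B = "\<lambda>\<eta> x d T. of_bool (cluster S \<eta> = T) * (of_bool ((x, d) \<in> \<eta>) *
    of_bool (exits ?V (conf (\<eta> - T \<times> UNIV)) (x + step d))) :: real"
  have fS: "finite (?SS x)" for x using S(1) by simp
  have "exitp ?V (bw p) = bexp p ?E (\<lambda>\<eta>. of_bool (exits ?V (conf \<eta>) (0,0)))"
    unfolding exitp_def wexp_bw[OF finite_square] ..
  also have "\<dots> \<le> bexp p ?E (\<lambda>\<eta>. \<Sum>(x, d)\<in>out_edges S. \<Sum>T\<in>?SS x. ?B \<eta> x d T)"
  proof (rule bexp_mono[OF p])
    fix \<eta> :: "((int \<times> int) \<times> dir) set"
    have nn: "0 \<le> ?B \<eta> x d T" for x d T by simp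
    show "of_bool (exits ?V (conf \<eta>) (0,0)) \<le> (\<Sum>(x, d)\<in>out_edges S. \<Sum>T\<in>?SS x. ?B \<eta> x d T)"
    proof (cases "exits ?V (conf \<eta>) (0,0)")
      case True
      from exits_last_boundary_edge[OF S(2) SV True] obtain x d where
        xd: "(x, d) \<in> out_edges S" "x \<in> cluster S \<eta>" "(x, d) \<in> \<eta>"
        "exits ?V (conf (\<eta> - cluster S \<eta> \<times> UNIV)) (x + step d)" by auto
      have "(1::real) = ?B \<eta> x d (cluster S \<eta>)" using xd by simp
      also have "\<dots> \<le> (\<Sum>T\<in>?SS x. ?B \<eta> x d T)"
        using fS xd(2) cluster_subset[OF S(2)] nn by (intro member_le_sum) auto
      also have "\<dots> = (\<lambda>(x, d). \<Sum>T\<in>?SS x. ?B \<eta> x d T) (x, d)" by simp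
      also have "\<dots> \<le> (\<Sum>(x, d)\<in>out_edges S. \<Sum>T\<in>?SS x. ?B \<eta> x d T)"
        by (rule member_le_sum[OF xd(1)]) (auto intro!: sum_nonneg simp: S(1))
      finally show ?thesis using True by simp
    next
      case False
      then show ?thesis by (auto intro!: sum_nonneg)
    qed
  qed
  also have "\<dots> = (\<Sum>(x, d)\<in>out_edges S. \<Sum>T\<in>?SS x. bexp p ?E (\<lambda>\<eta>. ?B \<eta> x d T))"
    unfolding bexp_sum case_prod_unfold ..
  also have "\<dots> \<le> (\<Sum>(x, d)\<in>out_edges S. \<Sum>T\<in>?SS x.
      bexp p (in_edges S) (\<lambda>\<eta>. of_bool (cluster S \<eta> = T)) * (p * ?th))"
  proof (intro sum_mono, clarify, intro sum_mono)
    fix x d T assume xd: "(x, d) \<in> out_edges S" and T: "T \<in> ?SS x"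
    \<comment> \<open>\<open>?A1\<close> decides that the cluster is \<open>T\<close>,
      \<open>?A2\<close> is the boundary edge itself, and \<open>?A3\<close> carries the escape
      after the last visit to \<open>T\<close>.\<close>
    let ?A1 = "in_edges S \<inter> T \<times> UNIV" and ?A2 = "{(x, d)}" and ?A3 = "(?V - T) \<times> (UNIV :: dir set)"
    let ?f = "\<lambda>\<eta>. of_bool (cluster S \<eta> = T) :: real"
    let ?g = "\<lambda>\<eta>. of_bool ((x, d) \<in> \<eta>) :: real"
    let ?h = "\<lambda>\<eta>. of_bool (exits ?V (conf (\<eta> - T \<times> UNIV)) (x + step d)) :: real"
    have xT: "x \<in> T" "T \<subseteq> S" "x \<in> S" "x + step d \<notin> S" using T xd by (auto simp: out_edges_def)
    have f: "?f \<eta> = ?f (\<eta> \<inter> ?A1)" for \<eta>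
    proof -
      have "cluster S (\<eta> \<inter> T \<times> UNIV) = cluster S (\<eta> \<inter> ?A1)"
        unfolding cluster_def by (rule arg_cong[of "\<eta> \<inter> T \<times> UNIV \<inter> in_edges S" "\<eta> \<inter> ?A1 \<inter> in_edges S"]) auto
      then show ?thesis using cluster_restrict[of S \<eta> T] by simp
    qed
    have h: "?h \<eta> = ?h (\<eta> \<inter> ?A3)" if "\<eta> \<subseteq> ?E" for \<eta>
    proof -
      have "\<eta> - T \<times> UNIV = \<eta> \<inter> ?A3 - T \<times> UNIV" using that by auto
      then show ?thesis by simp
    qed
    have "bexp p ?E (\<lambda>\<eta>. ?B \<eta> x d T) = bexp p ?A1 ?f * bexp p (?A2 \<union> ?A3) (\<lambda>\<eta>. ?g \<eta> * ?h \<eta>)"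
    proof (rule bexp_indep)
      fix \<eta> assume e: "\<eta> \<subseteq> ?E"
      have i: "\<eta> \<inter> (?A2 \<union> ?A3) \<inter> ?A3 = \<eta> \<inter> ?A3" by auto
      have "\<eta> \<inter> (?A2 \<union> ?A3) \<subseteq> ?E" using e by auto
      from h[OF this] have "?h (\<eta> \<inter> (?A2 \<union> ?A3)) = ?h (\<eta> \<inter> ?A3)" unfolding i .
      then show "?B \<eta> x d T = ?f (\<eta> \<inter> ?A1) * (?g (\<eta> \<inter> (?A2 \<union> ?A3)) * ?h (\<eta> \<inter> (?A2 \<union> ?A3)))"
        using f[of \<eta>] h[OF e] by simp
    qed (use xT SV in \<open>auto simp: in_edges_def\<close>)
    also have "bexp p (?A2 \<union> ?A3) (\<lambda>\<eta>. ?g \<eta> * ?h \<eta>) = bexp p ?A2 ?g * bexp p ?A3 ?h"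
    proof (rule bexp_indep)
      fix \<eta> assume "\<eta> \<subseteq> ?A2 \<union> ?A3"
      then have "\<eta> \<subseteq> ?E" using xT SV by auto
      then show "?g \<eta> * ?h \<eta> = ?g (\<eta> \<inter> ?A2) * ?h (\<eta> \<inter> ?A3)" using h by simp
    qed (use xT in auto)
    also have "bexp p ?A2 ?g = p"
    proof -
      have "{} \<noteq> {(x, d)}" "Pow {(x, d)} = {{}, {(x, d)}}" by auto
      then show ?thesis by (simp add: bexp_def)
    qed
    also have "bexp p ?A1 ?f = bexp p (in_edges S) ?f"
      by (rule bexp_subset[symmetric]) (use S(1) f in \<open>auto simp: Int_assoc[symmetric]\<close>)
    also have "bexp p (in_edges S) ?f * (p * bexp p ?A3 ?h) \<le> bexp p (in_edges S) ?f * (p * ?th)"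
    proof (intro mult_left_mono p bexp_nonneg)
      \<comment> \<open>The head of a boundary edge lies in \<open>square (Suc r)\<close>, one layer
        outside \<open>square r\<close>; hence the radius \<open>n + Suc r\<close>.\<close>
      have b: "(+) (x + step d) ` square n \<subseteq> ?V"
        by (rule square_translate, rule step_in_square) (use xT S(3) in auto)
      have "bexp p ?A3 ?h \<le> bexp p ?A3 (\<lambda>\<eta>. of_bool (exits ?V (conf \<eta>) (x + step d)))"
        using exits_conf_mono[OF Diff_subset] by (intro bexp_mono p) (auto simp: of_bool_def)
      also have "\<dots> \<le> ?th" by (rule bexp_exits_le_translate[OF p _ b]) simp
      finally show "bexp p ?A3 ?h \<le> ?th" .
    qed simp
    finally show "bexp p ?E (\<lambda>\<eta>. ?B \<eta> x d T) \<le> bexp p (in_edges S) ?f * (p * ?th)" .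
  qed
  also have "\<dots> = (\<Sum>(x, d)\<in>out_edges S. bexp p (in_edges S) (\<lambda>\<eta>. \<Sum>T\<in>?SS x. of_bool (cluster S \<eta> = T)) * (p * ?th))"
    unfolding bexp_sum sum_distrib_right ..
  also have "\<dots> = (\<Sum>(x, d)\<in>out_edges S. bexp p (in_edges S) (\<lambda>\<eta>. of_bool (((0,0), x) \<in> (edges (conf \<eta>))\<^sup>*)) * (p * ?th))"
  proof (rule sum.cong[OF refl], clarify)
    fix x d
    have "bexp p (in_edges S) (\<lambda>\<eta>. \<Sum>T\<in>?SS x. of_bool (cluster S \<eta> = T)) =
      bexp p (in_edges S) (\<lambda>\<eta>. of_bool (((0,0), x) \<in> (edges (conf \<eta>))\<^sup>*))"
    proof (rule bexp_cong)
      fix \<eta> assume "\<eta> \<subseteq> in_edges S"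
      then have "cluster S \<eta> = {x. ((0,0), x) \<in> (edges (conf \<eta>))\<^sup>*}"
        by (simp add: cluster_def Int_absorb2)
      moreover have "(\<Sum>T\<in>?SS x. of_bool (cluster S \<eta> = T)) = (of_bool (cluster S \<eta> \<in> ?SS x) :: real)"
        unfolding of_bool_def using fS by (subst sum.delta') auto
      ultimately show "(\<Sum>T\<in>?SS x. of_bool (cluster S \<eta> = T)) = (of_bool (((0,0), x) \<in> (edges (conf \<eta>))\<^sup>*) :: real)"
        using cluster_subset[OF S(2), of \<eta>] by simp
    qed
    then show "bexp p (in_edges S) (\<lambda>\<eta>. \<Sum>T\<in>?SS x. of_bool (cluster S \<eta> = T)) * (p * ?th) =
      bexp p (in_edges S) (\<lambda>\<eta>. of_bool (((0,0), x) \<in> (edges (conf \<eta>))\<^sup>*)) * (p * ?th)" by simp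
  qed
  also have "\<dots> = p * psi p S * ?th"
    unfolding psi_def sum_distrib_left sum_distrib_right by (intro sum.cong) auto
  finally show ?thesis .
qed

lemma exitp_nonneg: "(\<And>s. 0 \<le> w s) \<Longrightarrow> 0 \<le> exitp V w"
  unfolding exitp_def by (intro wexp_nonneg) auto

lemma exitp_le_1:
  assumes "finite V" "\<And>s. 0 \<le> w s" "(\<Sum>s\<in>UNIV. w s) = 1"
  shows "exitp V w \<le> 1"
proof -
  have "exitp V w \<le> wexp V w (\<lambda>_. 1)" unfolding exitp_def by (intro wexp_mono assms) auto
  then show ?thesis using wexp_one[OF assms(1,3)] by simp
qed

text \<open>Each further width \<open>Suc r\<close> costs a factor \<open>p * psi p S\<close>, so
  the decay is exponential once this factor is below 1.\<close>

lemma exitp_square_power: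
  assumes S: "finite S" "(0,0) \<in> S" "S \<subseteq> square r" and p: "0 \<le> p" "p \<le> 1"
  shows "exitp (square (k * Suc r)) (bw p) \<le> (p * psi p S) ^ k"
proof (induction k)
  case 0
  show ?case using exitp_le_1[of "square 0" "bw p"] bw_nonneg[OF p] by (simp add: sum_bw)
next
  case (Suc k)
  have "exitp (square (k * Suc r + Suc r)) (bw p) \<le> p * psi p S * exitp (square (k * Suc r)) (bw p)"
    by (rule exitp_square_decay[OF S p])
  also have "\<dots> \<le> p * psi p S * (p * psi p S) ^ k"
    by (intro mult_left_mono Suc mult_nonneg_nonneg psi_nonneg p)
  also have "k * Suc r + Suc r = Suc k * Suc r" by simp
  finally show ?case unfolding power_Suc .
qed

section \<open>Self-duality at one half\<close>

lemma sum_by_parts: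
  fixes u c :: "nat \<Rightarrow> real"
  shows "(\<Sum>j\<le>k. u j * (c (Suc j) - c j)) =
    u k * c (Suc k) - u 0 * c 0 + (\<Sum>j<k. (u j - u (Suc j)) * c (Suc j))"
  by (induction k) (simp_all add: algebra_simps)

lemma sum_by_parts_shifted:
  fixes D c :: "nat \<Rightarrow> real"
  shows "(\<Sum>i\<le>k. (D i - D (Suc i)) * c i) + (\<Sum>i<k. D (Suc i) * (c i - c (Suc i))) =
    D 0 * c 0 - D (Suc k) * c k"
  by (induction k) (simp_all add: algebra_simps)

text \<open>A discrete Stokes formula: the boundary of \<open>{a = 1}\<close> starts on the side where \<open>c = 1\<close> and ends
  where \<open>c = 0\<close>, so its net flow out of \<open>{c = 1}\<close> is one.\<close>

lemma flow_sum:
  fixes a c :: "nat \<Rightarrow> nat \<Rightarrow> real"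
  assumes a0: "\<And>j. j \<le> k \<Longrightarrow> a 0 j = 1" and a1: "\<And>j. j \<le> k \<Longrightarrow> a (Suc k) j = 0"
    and c0: "\<And>i. i \<le> k \<Longrightarrow> c i 0 = 0" and c1: "\<And>i. i \<le> k \<Longrightarrow> c i (Suc k) = 1"
  shows "(\<Sum>i\<le>k. \<Sum>j\<le>k. (a i j - a (Suc i) j) * (c i (Suc j) - c i j)) +
    (\<Sum>i<k. \<Sum>j<k. (a (Suc i) j - a (Suc i) (Suc j)) * (c i (Suc j) - c (Suc i) (Suc j))) = 1"
proof -
  define D where "D j i = a i j - a i (Suc j)" for i j
  have "(\<Sum>i\<le>k. \<Sum>j\<le>k. (a i j - a (Suc i) j) * (c i (Suc j) - c i j)) =
    (\<Sum>i\<le>k. (a i k - a (Suc i) k) + (\<Sum>j<k. (D j i - D j (Suc i)) * c i (Suc j)))"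
  proof (rule sum.cong[OF refl])
    fix i assume "i \<in> {..k}"
    then show "(\<Sum>j\<le>k. (a i j - a (Suc i) j) * (c i (Suc j) - c i j)) =
      (a i k - a (Suc i) k) + (\<Sum>j<k. (D j i - D j (Suc i)) * c i (Suc j))"
      using sum_by_parts[of "\<lambda>j. a i j - a (Suc i) j" "c i" k]
      by (simp add: c0 c1 D_def) (simp add: algebra_simps)
  qed
  also have "\<dots> = (\<Sum>i\<le>k. a i k - a (Suc i) k) + (\<Sum>j<k. \<Sum>i\<le>k. (D j i - D j (Suc i)) * c i (Suc j))"
    unfolding sum.distrib by (subst sum.swap) simp
  also have "(\<Sum>i\<le>k. a i k - a (Suc i) k) = 1"
    using sum_telescope[of "\<lambda>i. a i k" k] by (simp add: a0 a1)
  finally have 1: "(\<Sum>i\<le>k. \<Sum>j\<le>k. (a i j - a (Suc i) j) * (c i (Suc j) - c i j)) =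
    1 + (\<Sum>j<k. \<Sum>i\<le>k. (D j i - D j (Suc i)) * c i (Suc j))" .
  have 2: "(\<Sum>i<k. \<Sum>j<k. (a (Suc i) j - a (Suc i) (Suc j)) * (c i (Suc j) - c (Suc i) (Suc j))) =
    (\<Sum>j<k. \<Sum>i<k. D j (Suc i) * (c i (Suc j) - c (Suc i) (Suc j)))"
    unfolding D_def by (rule sum.swap)
  have 3: "(\<Sum>i\<le>k. (D j i - D j (Suc i)) * c i (Suc j)) + (\<Sum>i<k. D j (Suc i) * (c i (Suc j) - c (Suc i) (Suc j))) = 0"
    if "j < k" for j
    using sum_by_parts_shifted[of "D j" "\<lambda>i. c i (Suc j)" k] that by (simp add: D_def a0 a1)
  have "(\<Sum>j<k. (\<Sum>i\<le>k. (D j i - D j (Suc i)) * c i (Suc j)) +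
    (\<Sum>i<k. D j (Suc i) * (c i (Suc j) - c (Suc i) (Suc j)))) = 0"
    by (rule sum.neutral) (use 3 in blast)
  then show ?thesis unfolding 1 2 sum.distrib by linarith
qed

text \<open>A rectangle with \<open>k + 2\<close> columns and \<open>k + 1\<close> rows, without the
  vertical edges of its two outer columns. This shape is its own dual.\<close>

fun rect_edge :: "int \<Rightarrow> (int \<times> int) \<times> dir \<Rightarrow> bool" where
  "rect_edge k ((i, j), East) \<longleftrightarrow> 0 \<le> i \<and> i \<le> k \<and> 0 \<le> j \<and> j \<le> k"
| "rect_edge k ((i, j), West) \<longleftrightarrow> 1 \<le> i \<and> i \<le> k + 1 \<and> 0 \<le> j \<and> j \<le> k"
| "rect_edge k ((i, j), North) \<longleftrightarrow> 1 \<le> i \<and> i \<le> k \<and> 0 \<le> j \<and> j < k"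
| "rect_edge k ((i, j), South) \<longleftrightarrow> 1 \<le> i \<and> i \<le> k \<and> 1 \<le> j \<and> j \<le> k"

text \<open>The dual of an edge is the edge obtained by turning it clockwise about its midpoint. We identify
  the face with lower left corner \<open>(i, j)\<close> with the vertex \<open>(k - j, i)\<close>, so a downward dual crossing of the
  rectangle becomes a crossing from left to right of the same rectangle.\<close>

fun dual :: "int \<Rightarrow> (int \<times> int) \<times> dir \<Rightarrow> (int \<times> int) \<times> dir" where
  "dual k ((i, j), East) = ((k - j, i), East)"
| "dual k ((i, j), West) = ((k - j + 1, i - 1), West)"
| "dual k ((i, j), North) = ((k - j, i - 1), North)"
| "dual k ((i, j), South) = ((k - j + 1, i), South)"

definition rect :: "nat \<Rightarrow> ((int \<times> int) \<times> dir) set" where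
  "rect k = {e. rect_edge (int k) e}"

definition crossing :: "nat \<Rightarrow> ((int \<times> int) \<times> dir) set \<Rightarrow> bool" where
  "crossing k \<eta> \<longleftrightarrow> (\<exists>j\<in>{0..int k}. \<exists>z. ((0, j), (int k + 1, z)) \<in> (edges (conf \<eta>))\<^sup>*)"

lemma finite_rect: "finite (rect k)"
proof (rule finite_subset)
  show "rect k \<subseteq> ({0..int k + 1} \<times> {0..int k}) \<times> UNIV"
  proof
    fix e assume "e \<in> rect k"
    then show "e \<in> ({0..int k + 1} \<times> {0..int k}) \<times> UNIV"
      unfolding rect_def by (cases "(int k, e)" rule: rect_edge.cases) auto
  qed
qed auto

lemma inj_dual: "inj_on (dual k) A"
proof (rule inj_onI)
  fix e e' assume "dual k e = dual k e'"
  then show "e = e'"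
    by (cases "(k, e)" rule: dual.cases; cases "(k, e')" rule: dual.cases) auto
qed

lemma dual_rect: "dual (int k) ` rect k = rect k"
proof (rule endo_inj_surj)
  show "dual (int k) ` rect k \<subseteq> rect k"
  proof (rule image_subsetI)
    fix e assume "e \<in> rect k"
    then show "dual (int k) e \<in> rect k"
      unfolding rect_def by (cases "(int k, e)" rule: rect_edge.cases) auto
  qed
qed (simp_all add: finite_rect inj_dual)

lemma crossing_mono: "\<eta> \<subseteq> \<eta>' \<Longrightarrow> crossing k \<eta> \<Longrightarrow> crossing k \<eta>'"
proof -
  assume "\<eta> \<subseteq> \<eta>'"
  then have "(edges (conf \<eta>))\<^sup>* \<subseteq> (edges (conf \<eta>'))\<^sup>*"
    by (intro rtrancl_mono edges_mono conf_mono)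
  then show "crossing k \<eta> \<Longrightarrow> crossing k \<eta>'" unfolding crossing_def by blast
qed

text \<open>No open edge leaves the set \<open>S\<close> reached from the left, so its boundary
  edges are closed. Their duals form the contour of \<open>S\<close>, and \<open>T\<close> is what
  they reach from the dual starting side. If \<open>T\<close> missed the far side, the flow out of
  \<open>T\<close> along the contour would be both one and nonpositive.\<close>

lemma crossing_or_dual_crossing:
  assumes \<eta>: "\<eta> \<subseteq> rect k" and n: "\<not> crossing k \<eta>"
  shows "crossing k (dual (int k) ` (rect k - \<eta>))"
proof -
  let ?k = "int k"
  define S where "S = {x. \<exists>j\<in>{0..?k}. ((0, j), x) \<in> (edges (conf \<eta>))\<^sup>*}"
  define B where "B = {(v, d) \<in> rect k. v \<in> S \<and> v + step d \<notin> S}"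
  define T where "T = {x. \<exists>j\<in>{0..?k}. ((0, j), x) \<in> (edges (conf (dual ?k ` B)))\<^sup>*}"
  have S_step: "v + step d \<in> S" if "v \<in> S" "(v, d) \<in> \<eta>" for v d
    using that rtrancl_into_rtrancl[OF _ edgesI[of d "conf \<eta>" v]] unfolding S_def conf_iff by blast
  have T_step: "u + step d \<in> T" if "u \<in> T" "e \<in> rect k" "dual ?k e = (u, d)" "fst e \<in> S" "fst e + step (snd e) \<notin> S" for u d e
  proof -
    have "d \<in> conf (dual ?k ` B) u" unfolding conf_iff
      by (rule image_eqI[of _ _ e]) (use that in \<open>auto simp: B_def\<close>)
    then show ?thesis
      using that(1) rtrancl_into_rtrancl[OF _ edgesI[of d "conf (dual ?k ` B)" u]] unfolding T_def by blast
  qed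
  have B: "B \<subseteq> rect k - \<eta>" using S_step by (auto simp: B_def)
  have S0: "(0, j) \<in> S" if "0 \<le> j" "j \<le> ?k" for j using that by (auto simp: S_def)
  have S1: "(?k + 1, j) \<notin> S" for j using n by (auto simp: S_def crossing_def)
  have T0: "(0, j) \<in> T" if "0 \<le> j" "j \<le> ?k" for j using that by (auto simp: T_def)
  have "\<exists>j. (?k + 1, j) \<in> T"
  proof (rule ccontr)
    assume T1: "\<nexists>j. (?k + 1, j) \<in> T"
    define a where "a i j = (of_bool ((int i, int j) \<in> S) :: real)" for i j :: nat
    \<comment> \<open>In terms of faces, \<open>c i j\<close> belongs to the face just below the
      horizontal edge from \<open>(i, j)\<close> to \<open>(i + 1, j)\<close>. So
      \<open>j = 0\<close> is the target column \<open>k + 1\<close> and \<open>j = k + 1\<close> is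
      the starting column 0.\<close>
    define c where "c i j = (of_bool ((?k + 1 - int j, int i) \<in> T) :: real)" for i j :: nat
    have flow: "(\<Sum>i\<le>k. \<Sum>j\<le>k. (a i j - a (Suc i) j) * (c i (Suc j) - c i j)) +
      (\<Sum>i<k. \<Sum>j<k. (a (Suc i) j - a (Suc i) (Suc j)) * (c i (Suc j) - c (Suc i) (Suc j))) = 1"
      by (rule flow_sum) (use S0 S1 T0 T1 in \<open>auto simp: a_def c_def add.commute\<close>)
    \<comment> \<open>A positive term would be an edge leaving \<open>S\<close> whose dual leaves
      \<open>T\<close>, against the definition of \<open>T\<close>.\<close>
    have "(a i j - a (Suc i) j) * (c i (Suc j) - c i j) \<le> 0" if "i \<le> k" "j \<le> k" for i j
    proof -
      have "(?k - int j + 1, int i) \<in> T" if "(?k - int j, int i) \<in> T" "(int i, int j) \<in> S" "(int i + 1, int j) \<notin> S"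
        using T_step[of "(?k - int j, int i)" "((int i, int j), East)" East] that \<open>i \<le> k\<close> \<open>j \<le> k\<close>
        by (simp add: rect_def)
      moreover have "(?k - int j, int i) \<in> T" if "(?k - int j + 1, int i) \<in> T" "(int i, int j) \<notin> S" "(int i + 1, int j) \<in> S"
        using T_step[of "(?k - int j + 1, int i)" "((int i + 1, int j), West)" West] that \<open>i \<le> k\<close> \<open>j \<le> k\<close>
        by (simp add: rect_def)
      ultimately show ?thesis unfolding a_def c_def by (simp add: of_bool_def algebra_simps) blast
    qed
    moreover have "(a (Suc i) j - a (Suc i) (Suc j)) * (c i (Suc j) - c (Suc i) (Suc j)) \<le> 0" if "i < k" "j < k" for i j
    proof -
      have "(?k - int j, int i + 1) \<in> T" if "(?k - int j, int i) \<in> T" "(int i + 1, int j) \<in> S" "(int i + 1, int j + 1) \<notin> S"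
        using T_step[of "(?k - int j, int i)" "((int i + 1, int j), North)" North] that \<open>i < k\<close> \<open>j < k\<close>
        by (simp add: rect_def)
      moreover have "(?k - int j, int i) \<in> T" if "(?k - int j, int i + 1) \<in> T" "(int i + 1, int j) \<notin> S" "(int i + 1, int j + 1) \<in> S"
        using T_step[of "(?k - int j, int i + 1)" "((int i + 1, int j + 1), South)" South] that \<open>i < k\<close> \<open>j < k\<close>
        by (simp add: rect_def)
      ultimately show ?thesis unfolding a_def c_def by (simp add: of_bool_def algebra_simps) blast
    qed
    ultimately have "(\<Sum>i\<le>k. \<Sum>j\<le>k. (a i j - a (Suc i) j) * (c i (Suc j) - c i j)) \<le> 0"
      and "(\<Sum>i<k. \<Sum>j<k. (a (Suc i) j - a (Suc i) (Suc j)) * (c i (Suc j) - c (Suc i) (Suc j))) \<le> 0"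
      by - (intro sum_nonpos; simp)+
    with flow show False by linarith
  qed
  then have "crossing k (dual ?k ` B)" by (auto simp: T_def crossing_def)
  then show ?thesis by (rule crossing_mono[rotated]) (use B in auto)
qed

section \<open>Crossing probabilities at density one half and their consequences\<close>

lemma bexp_half_compl:
  assumes "finite E"
  shows "bexp (1/2) E (\<lambda>\<eta>. F (E - \<eta>)) = bexp (1/2) E F"
proof -
  have bij: "bij_betw (\<lambda>\<eta>. E - \<eta>) (Pow E) (Pow E)"
    by (rule bij_betw_byWitness[of _ "\<lambda>\<eta>. E - \<eta>"]) auto
  show ?thesis unfolding bexp_def
    by (subst (2) sum.reindex_bij_betw[OF bij, symmetric], rule sum.cong[OF refl])
      (auto simp: double_diff mult_ac)
qed

text \<open>At density \<open>1 / 2\<close> the closed edges have the law of the open ones, and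
  \<open>dual\<close> permutes the edges of the rectangle. So crossing and dual crossing are equally
  likely, and at least one of them occurs.\<close>

lemma crossing_prob_ge: "1 / 2 \<le> bexp (1/2) (rect k) (\<lambda>\<eta>. of_bool (crossing k \<eta>))"
proof -
  let ?b = "bexp (1/2) (rect k) (\<lambda>\<eta>. of_bool (crossing k \<eta>))"
  let ?d = "dual (int k)"
  have "1 = bexp (1/2) (rect k) (\<lambda>_. 1)" by (simp add: bexp_one finite_rect)
  also have "\<dots> \<le> bexp (1/2) (rect k) (\<lambda>\<eta>. of_bool (crossing k \<eta>) + of_bool (crossing k (?d ` (rect k - \<eta>))))"
    using crossing_or_dual_crossing by (intro bexp_mono) (auto simp: of_bool_def)
  also have "\<dots> = ?b + bexp (1/2) (rect k) (\<lambda>\<eta>. of_bool (crossing k (?d ` (rect k - \<eta>))))"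
    by (simp add: bexp_def ring_distribs sum.distrib)
  also have "bexp (1/2) (rect k) (\<lambda>\<eta>. of_bool (crossing k (?d ` (rect k - \<eta>)))) =
    bexp (1/2) (rect k) (\<lambda>\<eta>. of_bool (crossing k (?d ` \<eta>)))"
    by (rule bexp_half_compl[OF finite_rect])
  also have "\<dots> = bexp (1/2) (?d ` rect k) (\<lambda>\<eta>. of_bool (crossing k \<eta>))"
    by (rule bexp_reindex[symmetric]) (rule inj_dual)
  also have "\<dots> = ?b" unfolding dual_rect ..
  finally show ?thesis by simp
qed

text \<open>A crossing starts at one of \<open>k + 1\<close> vertices and ends \<open>k + 1\<close>
  columns further right, hence outside the square of radius \<open>k\<close> around its start; the
  union bound does the rest.\<close>

lemma exitp_half_ge: "1 / 2 \<le> (real k + 1) * exitp (square k) (bw (1/2))"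
proof -
  let ?V = "\<lambda>j. (+) (0, j) ` square k"
  have "1 / 2 \<le> bexp (1/2) (rect k) (\<lambda>\<eta>. of_bool (crossing k \<eta>))" by (rule crossing_prob_ge)
  also have "\<dots> \<le> bexp (1/2) (rect k) (\<lambda>\<eta>. \<Sum>j\<in>{0..int k}. of_bool (exits (?V j) (conf \<eta>) (0, j)))"
  proof (rule bexp_mono)
    fix \<eta>
    show "of_bool (crossing k \<eta>) \<le> (\<Sum>j\<in>{0..int k}. of_bool (exits (?V j) (conf \<eta>) (0, j)) :: real)"
    proof (cases "crossing k \<eta>")
      case True
      then obtain j z where j: "j \<in> {0..int k}" "((0, j), (int k + 1, z)) \<in> (edges (conf \<eta>))\<^sup>*"
        by (auto simp: crossing_def)
      have "(int k + 1, z) \<notin> ?V j" by (auto simp: square_def)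
      then have "exits (?V j) (conf \<eta>) (0, j)" using j(2) by (auto simp: exits_def)
      then have "(1::real) = of_bool (exits (?V j) (conf \<eta>) (0, j))" by simp
      also have "\<dots> \<le> (\<Sum>j\<in>{0..int k}. of_bool (exits (?V j) (conf \<eta>) (0, j)))"
        by (rule member_le_sum[OF j(1)]) auto
      finally show ?thesis using True by simp
    qed (auto intro!: sum_nonneg)
  qed auto
  also have "\<dots> \<le> (\<Sum>j\<in>{0..int k}. exitp (square k) (bw (1/2)))"
    unfolding bexp_sum by (intro sum_mono bexp_exits_le_translate finite_rect) auto
  finally show ?thesis by (simp add: add.commute)
qed

text \<open>With \<open>q = p * psi p S < 1\<close>, the escape probability from radius
  \<open>n = k * Suc r\<close> would be at most \<open>q ^ k\<close>. By monotonicity in the density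
  it is at least \<open>1 / (2 * (n + 1))\<close>, which is larger for large
  \<open>k\<close>.\<close>

lemma psi_ge_1:
  assumes p: "1 / 2 \<le> p" "p \<le> 1" and S: "finite S" "(0,0) \<in> S"
  shows "1 \<le> p * psi p S"
proof (rule ccontr)
  assume n: "\<not> 1 \<le> p * psi p S"
  define q where "q = p * psi p S"
  have p0: "0 \<le> p" using p by simp
  have q: "0 \<le> q" "q < 1" using n psi_nonneg[OF p0 p(2)] p0 by (auto simp: q_def)
  obtain r where r: "S \<subseteq> square r" using finite_subset_square[OF S(1)] .
  have le: "1 / 2 \<le> (real (Suc r) * (real k * q ^ k) + q ^ k)" for k
  proof -
    have "1 / 2 \<le> (real (k * Suc r) + 1) * exitp (square (k * Suc r)) (bw (1/2))" by (rule exitp_half_ge)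
    also have "\<dots> \<le> (real (k * Suc r) + 1) * exitp (square (k * Suc r)) (bw p)"
      using p by (intro mult_left_mono exitp_bw_mono) auto
    also have "\<dots> \<le> (real (k * Suc r) + 1) * q ^ k"
      unfolding q_def by (intro mult_left_mono exitp_square_power S r p0 p) auto
    finally show ?thesis by (simp add: algebra_simps)
  qed
  have "(\<lambda>k. real (Suc r) * (real k * q ^ k) + q ^ k) \<longlonglongrightarrow> real (Suc r) * 0 + 0"
    using q by (intro tendsto_intros powser_times_n_limit_0 LIMSEQ_power_zero) auto
  then have "1 / 2 \<le> real (Suc r) * 0 + (0::real)"
    by (rule LIMSEQ_le_const) (use le in auto)
  then show False by simp
qed

text \<open>The derivative bound says that \<open>1 - exitp V (bw t)\<close> times
  \<open>exp t\<close> is nonincreasing for \<open>t \<ge> 1 / 2\<close>. Starting from the trivial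
  bound at \<open>1 / 2\<close>, this gives an estimate that does not depend on
  \<open>V\<close>.\<close>

lemma exitp_bw_supercritical:
  assumes V: "finite V" "(0,0) \<in> V" and h: "0 \<le> h" "h \<le> 1 / 2"
  shows "1 - exp (- h) \<le> exitp V (bw (1 / 2 + h))"
proof -
  let ?g = "\<lambda>t. (1 - exitp V (bw t)) * exp t"
  have "?g (1 / 2 + h) \<le> ?g (1 / 2)"
  proof (rule DERIV_nonpos_imp_nonincreasing[of "1 / 2" "1 / 2 + h" ?g])
    fix p assume p: "1 / 2 \<le> p" "p \<le> 1 / 2 + h"
    obtain D where D: "((\<lambda>t. exitp V (bw t)) has_real_derivative D) (at p)" "1 - exitp V (bw p) \<le> D"
      using exitp_bw_derivative_ge[OF V, of p] psi_ge_1[of p] p h by auto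
    have "(?g has_real_derivative (1 - exitp V (bw p) - D) * exp p) (at p)"
      by (auto intro!: derivative_eq_intros D simp: algebra_simps)
    moreover have "(1 - exitp V (bw p) - D) * exp p \<le> 0"
      using D(2) by (intro mult_nonpos_nonneg) auto
    ultimately show "\<exists>y. (?g has_real_derivative y) (at p) \<and> y \<le> 0" by blast
  qed (use h in auto)
  also have "\<dots> \<le> 1 * exp (1 / 2)"
    by (intro mult_right_mono) (auto intro!: exitp_nonneg bw_nonneg)
  finally have "(1 - exitp V (bw (1 / 2 + h))) * exp (1 / 2 + h) * exp (- (1 / 2 + h)) \<le> exp (1 / 2) * exp (- (1 / 2 + h))"
    by (intro mult_right_mono) auto
  then show ?thesis by (simp add: mult.assoc exp_add[symmetric])
qed

section \<open>Local surgery\<close>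

definition opp :: "dir set \<Rightarrow> bool" where
  "opp A \<longleftrightarrow> {East, West} \<subseteq> A \<or> {North, South} \<subseteq> A"

lemma opp_mono: "A \<subseteq> B \<Longrightarrow> opp A \<Longrightarrow> opp B"
  unfolding opp_def by blast

definition adj :: "int \<times> int \<Rightarrow> int \<times> int \<Rightarrow> bool" where
  "adj u v \<longleftrightarrow> (\<exists>d. v = u + step d)"

lemma ex_dir: "(\<exists>d. P d) \<longleftrightarrow> P East \<or> P North \<or> P West \<or> P South"
  by (metis dir.exhaust)

lemma adj_iff: "adj (a, b) (c, d) \<longleftrightarrow>
    c = a + 1 \<and> d = b \<or> c = a \<and> d = b + 1 \<or> c = a - 1 \<and> d = b \<or> c = a \<and> d = b - 1"
  unfolding adj_def ex_dir by auto

lemma adj_translate [simp]: "adj (x + u) (x + v) \<longleftrightarrow> adj u v"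
  unfolding adj_def by (simp add: add.assoc)

lemma adj_sym: "adj u v \<Longrightarrow> adj v u"
  by (cases u; cases v) (auto simp: adj_iff)

text \<open>No step of the relation starts at the last vertex, because the surgery closes all edges
  there.\<close>

lemma path_reach_last:
  assumes "successively adj p" "distinct p" "p \<noteq> []"
  shows "(hd p, last p) \<in> {(u, v). u \<in> set p - {last p} \<and> v \<in> set p \<and> adj u v}\<^sup>*"
  using assms
proof (induction p)
  case (Cons u q)
  show ?case
  proof (cases q)
    case Nil
    then show ?thesis by simp
  next
    case (Cons v r)
    let ?R = "\<lambda>p. {(u, v). u \<in> set p - {last p} \<and> v \<in> set p \<and> adj u v}"
    have "(v, last q) \<in> (?R q)\<^sup>*" using Cons.IH Cons.prems Cons by (simp add: successively_Cons)
    moreover have "?R q \<subseteq> ?R (u # q)" using Cons by auto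
    ultimately have 1: "(v, last q) \<in> (?R (u # q))\<^sup>*" by (blast intro: rtrancl_mono[THEN subsetD])
    have "(u, v) \<in> ?R (u # q)" using Cons Cons.prems by (auto simp: successively_Cons)
    then have "(u, last q) \<in> (?R (u # q))\<^sup>*" using 1 by (rule converse_rtrancl_into_rtrancl)
    moreover have "last (u # q) = last q" using Cons by simp
    ultimately show ?thesis by (simp only: list.sel)
  qed
qed simp

lemma successively_connected:
  assumes "successively adj l" "u \<in> set l" "v \<in> set l"
  shows "(u, v) \<in> {(u, v). u \<in> set l \<and> v \<in> set l \<and> adj u v}\<^sup>*"
  using assms
proof (induction l arbitrary: u v)
  case (Cons a l)
  let ?R = "\<lambda>l. {(u, v). u \<in> set l \<and> v \<in> set l \<and> adj u v}"
  show ?case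
  proof (cases l)
    case Nil
    then show ?thesis using Cons.prems by simp
  next
    case (Cons b m)
    have sub: "(?R l)\<^sup>* \<subseteq> (?R (a # l))\<^sup>*" by (rule rtrancl_mono) auto
    have l: "successively adj l" and ab: "adj a b"
      using Cons.prems(1) Cons by (simp_all add: successively_Cons)
    have b: "b \<in> set l" using Cons by simp
    have in_l: "(s, t) \<in> (?R (a # l))\<^sup>*" if "s \<in> set l" "t \<in> set l" for s t
      using Cons.IH[OF l that] sub by auto
    have e: "(a, b) \<in> ?R (a # l)" "(b, a) \<in> ?R (a # l)" using ab adj_sym b by auto
    have from_a: "(a, t) \<in> (?R (a # l))\<^sup>*" if "t \<in> set (a # l)" for t
    proof (cases "t \<in> set l")
      case True
      show ?thesis by (rule converse_rtrancl_into_rtrancl[OF e(1) in_l[OF b True]])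
    next
      case False
      then show ?thesis using that by simp
    qed
    show ?thesis
    proof (cases "u \<in> set l")
      case True
      show ?thesis
      proof (cases "v \<in> set l")
        case False
        then have "v = a" using Cons.prems(3) by simp
        then show ?thesis using rtrancl_into_rtrancl[OF in_l[OF True b] e(2)] by simp
      qed (rule in_l[OF True])
    next
      case False
      then have "u = a" using Cons.prems(2) by simp
      then show ?thesis using from_a[OF Cons.prems(3)] by simp
    qed
  qed
qed simp

text \<open>An entry \<open>\<alpha>\<close> into the \<open>3 \<times> 3\<close> block around the origin, a path \<open>p\<close> from \<open>\<alpha>\<close> into the block and an arc
  \<open>l\<close> of the block that contains two opposite neighbours of the last vertex of \<open>p\<close>.\<close>

definition gadget :: "int \<times> int \<Rightarrow> (int \<times> int) list \<Rightarrow> (int \<times> int) list \<Rightarrow> bool" where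
  "gadget \<alpha> p l \<longleftrightarrow> p \<noteq> [] \<and> hd p = \<alpha> \<and> successively adj p \<and> distinct p \<and>
    set p \<subseteq> {0, fst \<alpha>} \<times> {0, snd \<alpha>} \<and> set l \<subseteq> {-1..1} \<times> {-1..1} \<and> set p \<inter> set l = {} \<and>
    successively adj l \<and> opp {d. last p + step d \<in> set l}"

text \<open>If \<open>\<alpha>\<close> is the centre or the midpoint of a side, it serves itself as
  the new pivotal vertex, with the rest of the ring as arc. From a corner the path runs to the
  centre, and the two ways around are both needed: \<open>\<beta>\<close> may be the vertex in
  between on one of them.\<close>

lemma gadget_exists:
  assumes \<alpha>: "\<alpha> \<in> {-1..1} \<times> {-1..1}" and \<beta>: "\<beta> \<in> {-1..1} \<times> {-1..1}" "\<beta> \<noteq> (0,0)" "\<beta> \<noteq> \<alpha>"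
  shows "\<exists>p l. gadget \<alpha> p l \<and> \<beta> \<in> set l"
proof -
  note g = gadget_def adj_iff opp_def
  have i: "{-1..1::int} = {-1, 0, 1}" by auto
  have \<beta>': "\<beta> \<in> {(1,0),(1,1),(0,1),(-1,1),(-1,0),(-1,-1),(0,-1),(1,-1)}"
    using \<beta> unfolding i by auto
  have 0: "gadget (0,0) [(0,0)] [(1,0),(1,1),(0,1),(-1,1),(-1,0),(-1,-1),(0,-1),(1,-1)]"
    by (simp add: g)
  have s1: "gadget (1,0) [(1,0)] [(1,1),(0,1),(-1,1),(-1,0),(-1,-1),(0,-1),(1,-1)]"
    by (simp add: g)
  have s2: "gadget (0,1) [(0,1)] [(-1,1),(-1,0),(-1,-1),(0,-1),(1,-1),(1,0),(1,1)]"
    by (simp add: g)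
  have s3: "gadget (-1,0) [(-1,0)] [(-1,-1),(0,-1),(1,-1),(1,0),(1,1),(0,1),(-1,1)]"
    by (simp add: g)
  have s4: "gadget (0,-1) [(0,-1)] [(1,-1),(1,0),(1,1),(0,1),(-1,1),(-1,0),(-1,-1)]"
    by (simp add: g)
  have c1: "gadget (1,1) [(1,1),(0,1),(0,0)] [(-1,1),(-1,0),(-1,-1),(0,-1),(1,-1),(1,0)]"
    "gadget (1,1) [(1,1),(1,0),(0,0)] [(0,1),(-1,1),(-1,0),(-1,-1),(0,-1),(1,-1)]"
    by (simp_all add: g)
  have c2: "gadget (-1,1) [(-1,1),(-1,0),(0,0)] [(-1,-1),(0,-1),(1,-1),(1,0),(1,1),(0,1)]"
    "gadget (-1,1) [(-1,1),(0,1),(0,0)] [(-1,0),(-1,-1),(0,-1),(1,-1),(1,0),(1,1)]"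
    by (simp_all add: g)
  have c3: "gadget (-1,-1) [(-1,-1),(0,-1),(0,0)] [(1,-1),(1,0),(1,1),(0,1),(-1,1),(-1,0)]"
    "gadget (-1,-1) [(-1,-1),(-1,0),(0,0)] [(0,-1),(1,-1),(1,0),(1,1),(0,1),(-1,1)]"
    by (simp_all add: g)
  have c4: "gadget (1,-1) [(1,-1),(1,0),(0,0)] [(1,1),(0,1),(-1,1),(-1,0),(-1,-1),(0,-1)]"
    "gadget (1,-1) [(1,-1),(0,-1),(0,0)] [(1,0),(1,1),(0,1),(-1,1),(-1,0),(-1,-1)]"
    by (simp_all add: g)
  have ex: "\<exists>p l. gadget \<alpha> p l \<and> \<beta> \<in> set l" if "gadget \<alpha> p l" "\<beta> \<in> set l" for p l
    using that by blast
  have two: "\<exists>p l. gadget \<alpha> p l \<and> \<beta> \<in> set l" if "gadget \<alpha> p l" "gadget \<alpha> p' l'" "\<beta> \<in> set l \<union> set l'" for p l p' l'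
    using that by blast
  consider "\<alpha> = (0,0)" | "\<alpha> = (1,0)" | "\<alpha> = (0,1)" | "\<alpha> = (-1,0)" | "\<alpha> = (0,-1)"
    | "\<alpha> = (1,1)" | "\<alpha> = (-1,1)" | "\<alpha> = (-1,-1)" | "\<alpha> = (1,-1)"
    using \<alpha> unfolding i by auto
  then show ?thesis
  proof cases
    case 1 show ?thesis by (rule ex[OF 0[folded 1]]) (use \<beta>' in auto)
  next
    case 2 show ?thesis by (rule ex[OF s1[folded 2]]) (use \<beta>' \<beta> 2 in auto)
  next
    case 3 show ?thesis by (rule ex[OF s2[folded 3]]) (use \<beta>' \<beta> 3 in auto)
  next
    case 4 show ?thesis by (rule ex[OF s3[folded 4]]) (use \<beta>' \<beta> 4 in auto)
  next
    case 5 show ?thesis by (rule ex[OF s4[folded 5]]) (use \<beta>' \<beta> 5 in auto)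
  next
    case 6 show ?thesis by (rule two[OF c1[folded 6]]) (use \<beta>' \<beta> 6 in auto)
  next
    case 7 show ?thesis by (rule two[OF c2[folded 7]]) (use \<beta>' \<beta> 7 in auto)
  next
    case 8 show ?thesis by (rule two[OF c3[folded 8]]) (use \<beta>' \<beta> 8 in auto)
  next
    case 9 show ?thesis by (rule two[OF c4[folded 9]]) (use \<beta>' \<beta> 9 in auto)
  qed
qed

definition block :: "int \<Rightarrow> int \<times> int \<Rightarrow> (int \<times> int) set" where
  "block r x = (+) x ` ({-r..r} \<times> {-r..r})"

lemma mem_block: "v \<in> block r x \<longleftrightarrow> \<bar>fst v - fst x\<bar> \<le> r \<and> \<bar>snd v - snd x\<bar> \<le> r"
proof
  assume "v \<in> block r x"
  then show "\<bar>fst v - fst x\<bar> \<le> r \<and> \<bar>snd v - snd x\<bar> \<le> r" by (auto simp: block_def)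
next
  assume *: "\<bar>fst v - fst x\<bar> \<le> r \<and> \<bar>snd v - snd x\<bar> \<le> r"
  have "v = x + (v - x)" by simp
  moreover have "v - x \<in> {-r..r} \<times> {-r..r}" using * by (cases v; cases x) auto
  ultimately show "v \<in> block r x" unfolding block_def by (rule image_eqI)
qed

lemma step_into_block: "v + step d \<in> block r x \<Longrightarrow> v \<in> block (r + 1) x"
  unfolding mem_block by (cases d) auto

lemma first_entrance:
  assumes "(a, x) \<in> (edges \<xi>)\<^sup>*" "x \<in> B"
  shows "\<exists>y\<in>B. (a, y) \<in> {(u, v) \<in> edges \<xi>. u \<notin> B}\<^sup>*"
proof -
  have "(a, x) \<in> {(u, v) \<in> edges \<xi>. u \<notin> B}\<^sup>* \<or> (\<exists>y\<in>B. (a, y) \<in> {(u, v) \<in> edges \<xi>. u \<notin> B}\<^sup>*)"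
    using assms(1)
  proof (induction rule: rtrancl_induct)
    case (step y z)
    then show ?case by (cases "y \<in> B") (auto intro: rtrancl_into_rtrancl)
  qed simp
  then show ?thesis using assms(2) by blast
qed

text \<open>Take the last vertex of \<open>B\<close> on an escape path. The block may stick out of
  \<open>V\<close>, so this vertex may already lie outside \<open>V\<close>.\<close>

lemma last_exit:
  assumes "exits V \<xi> y" "y \<in> B"
  defines "good \<equiv> \<lambda>u. \<exists>z. z \<notin> V \<and> (u, z) \<in> {(u, v) \<in> edges \<xi>. u \<notin> B}\<^sup>*"
  shows "\<exists>b\<in>B. b \<notin> V \<or> (\<exists>d\<in>\<xi> b. good (b + step d))"
proof -
  have "(y \<notin> B \<and> good y) \<or> (\<exists>b\<in>B. b \<notin> V \<or> (\<exists>d\<in>\<xi> b. good (b + step d)))"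
    using assms(1)
  proof (induction rule: exits_induct)
    case (outside z)
    then show ?case unfolding good_def by blast
  next
    case (step u d)
    show ?case
    proof (cases "u \<in> B")
      case True
      then show ?thesis using step by blast
    next
      case False
      have "(u, u + step d) \<in> {(u, v) \<in> edges \<xi>. u \<notin> B}"
        using False step(1) by (auto intro: edgesI)
      then show ?thesis using step(4) False unfolding good_def
        by (meson converse_rtrancl_into_rtrancl)
    qed
  qed
  with assms(2) show ?thesis by blast
qed

text \<open>The local surgery of Aizenman and Grimmett: the block \<open>B\<close> is entered only at \<open>a\<close>, from where the path
  \<open>T\<close> leads to \<open>x'\<close>, and left only through the arc \<open>L\<close>.\<close>

lemma surgery:
  assumes ne: "\<not> exits V \<xi> (0,0)" and V: "\<xi> \<in> confs V" "(0,0) \<in> V"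
    and a: "((0,0), a) \<in> {(u, v) \<in> edges \<xi>. u \<notin> B}\<^sup>*" "a \<in> T"
    and TL: "T \<subseteq> B" "T \<subseteq> V" "L \<subseteq> B" "T \<inter> L = {}"
    and x': "x' \<in> T" "(a, x') \<in> {(u, v). u \<in> T - {x'} \<and> v \<in> T \<and> adj u v}\<^sup>*"
    and L: "\<And>u. u \<in> L \<Longrightarrow> (u, b) \<in> {(u, v). u \<in> L \<and> v \<in> L \<and> adj u v}\<^sup>*"
    and b: "b \<in> L" "b \<notin> V \<or> (\<exists>d\<in>\<xi> b. \<exists>z. z \<notin> V \<and> (b + step d, z) \<in> {(u, v) \<in> edges \<xi>. u \<notin> B}\<^sup>*)"
    and o: "opp {d. x' + step d \<in> L}"
  shows "\<exists>\<xi>'\<in>confs V. \<xi>' x' = {} \<and> opp (ctx V x' \<xi>') \<and>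
    (\<forall>v. v \<notin> B \<longrightarrow> (\<forall>d. v + step d \<notin> B) \<longrightarrow> \<xi>' v = \<xi> v)"
proof -
  let ?P = "{(u, v) \<in> edges \<xi>. u \<notin> B}"
  define S where "S = stuck V \<xi>"
  define good where "good u \<longleftrightarrow> (\<exists>z. z \<notin> V \<and> (u, z) \<in> ?P\<^sup>*)" for u
  \<comment> \<open>On \<open>T\<close> and \<open>L\<close> the edges staying in the same set are
    opened, except that \<open>x'\<close> is closed, and \<open>L\<close> keeps its ways out.
    Vertices that could not escape lose their edges into the block other than those to
    \<open>a\<close>, so that they cannot reach \<open>L\<close>; vertices outside the block that
    could escape are left alone, so that the old way out survives.\<close>
  define \<xi>' where "\<xi>' v = (if v \<notin> V then {} else if v \<in> T then (if v = x' then {} else {d. v + step d \<in> T})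
    else if v \<in> L then {d. v + step d \<in> L \<or> good (v + step d)}
    else if v \<in> B then {} else if v \<in> S then {d \<in> \<xi> v. v + step d \<notin> B \<or> v + step d = a} else \<xi> v)" for v
  have SV: "S \<subseteq> V" by (auto simp: S_def stuck_def)
  have S_step: "v + step d \<in> S" if "v \<in> S" "d \<in> \<xi> v" for v d
    using that exits_step[of d \<xi> v V] exits_outside[of "v + step d" V] by (auto simp: S_def stuck_def)
  have 0: "(0,0) \<in> S" using ne V by (auto simp: S_def stuck_def)
  have 1: "\<xi>' \<in> confs V" by (simp add: confs_def \<xi>'_def)
  have 2: "\<xi>' x' = {}" using x' TL by (simp add: \<xi>'_def)
  have reach: "y \<in> S \<and> (y \<notin> B \<or> y = a \<longrightarrow> ((0,0), y) \<in> (edges \<xi>')\<^sup>*)" if "((0,0), y) \<in> ?P\<^sup>*" for y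
    using that
  proof (induction rule: rtrancl_induct)
    case base
    show ?case using 0 by simp
  next
    case (step y z)
    then obtain d where d: "d \<in> \<xi> y" "z = y + step d" "y \<notin> B" by (auto simp: edges_iff)
    have y: "y \<in> S" "y \<in> V" "y \<notin> T" "y \<notin> L" using step d SV TL by auto
    have "((0,0), z) \<in> (edges \<xi>')\<^sup>*" if "z \<notin> B \<or> z = a"
    proof -
      have "d \<in> \<xi>' y" using d y that by (auto simp: \<xi>'_def)
      then have "(y, z) \<in> edges \<xi>'" unfolding d by (rule edgesI)
      then show ?thesis using step d by (auto intro: rtrancl_into_rtrancl)
    qed
    then show ?case using S_step[OF y(1) d(1)] d(2) by simp
  qed
  have ra: "((0,0), a) \<in> (edges \<xi>')\<^sup>*" using reach[OF a(1)] by simp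
  have "{(u, v). u \<in> T - {x'} \<and> v \<in> T \<and> adj u v} \<subseteq> edges \<xi>'"
  proof (rule subrelI)
    fix u v assume "(u, v) \<in> {(u, v). u \<in> T - {x'} \<and> v \<in> T \<and> adj u v}"
    then have u: "u \<in> T" "u \<noteq> x'" and v: "v \<in> T" "adj u v" by auto
    obtain d where d: "v = u + step d" using v by (auto simp: adj_def)
    have "d \<in> \<xi>' u" using u v d TL by (auto simp: \<xi>'_def)
    then show "(u, v) \<in> edges \<xi>'" unfolding d by (rule edgesI)
  qed
  from rtrancl_mono[OF this] have "(a, x') \<in> (edges \<xi>')\<^sup>*" using x'(2) by blast
  with ra have rx: "((0,0), x') \<in> (edges \<xi>')\<^sup>*" by (rule rtrancl_trans)
  \<comment> \<open>The set \<open>(S - B) \<union> T\<close> is a trap: from \<open>S - B\<close>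
    the block can be entered only at \<open>a\<close>, which lies in \<open>T\<close>, and no open
    edge leaves \<open>T\<close>.\<close>
  have ne': "\<not> exits V \<xi>' (0,0)"
  proof (rule not_exits_closed)
    show "(0,0) \<in> (S - B) \<union> T"
    proof (cases "(0,0) \<in> B")
      case True
      from a(1) have "(0,0) = a" by (rule converse_rtranclE) (use True in auto)
      then show ?thesis using a(2) by simp
    qed (use 0 in simp)
    show "(S - B) \<union> T \<subseteq> V" using SV TL by auto
    fix y d assume y: "y \<in> (S - B) \<union> T" "d \<in> \<xi>' y"
    show "y + step d \<in> (S - B) \<union> T"
    proof (cases "y \<in> T")
      case True
      then show ?thesis using y TL by (auto simp: \<xi>'_def split: if_splits)
    next
      case False
      then have yS: "y \<in> S" "y \<notin> B" "y \<in> V" "y \<notin> L" using y SV TL by auto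
      then have "d \<in> \<xi> y" "y + step d \<notin> B \<or> y + step d = a"
        using y(2) False by (auto simp: \<xi>'_def)
      then show ?thesis using S_step[OF yS(1)] a(2) by auto
    qed
  qed
  \<comment> \<open>Inside \<open>V\<close>, each tail on such a route lies outside \<open>B\<close>
    and escapes in \<open>\<xi>\<close>, so it is not in \<open>S\<close> and keeps its
    state.\<close>
  have good_exits: "exits V \<xi>' u" if u: "good u" for u
  proof -
    obtain z where z: "z \<notin> V" "(u, z) \<in> ?P\<^sup>*" using u unfolding good_def by blast
    have "exits V \<xi> u \<and> exits V \<xi>' u" using z(2)
    proof (induction rule: converse_rtrancl_induct)
      case base
      show ?case using z(1) by (simp add: exits_outside)
    next
      case (step y v)
      then obtain d where d: "d \<in> \<xi> y" "v = y + step d" "y \<notin> B" by (auto simp: edges_iff)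
      have ex: "exits V \<xi> y" using d step exits_step by blast
      show ?case
      proof (cases "y \<in> V")
        case True
        have "y \<notin> S" using ex by (simp add: S_def stuck_def)
        then have "\<xi>' y = \<xi> y" using True d TL by (auto simp: \<xi>'_def)
        then have "exits V \<xi>' y" using d step exits_step[of d \<xi>' y V] by simp
        with ex show ?thesis by simp
      qed (simp add: exits_outside)
    qed
    then show ?thesis by simp
  qed
  have L_exits: "exits V \<xi>' u" if "u \<in> L" for u
    using L[OF that] that
  proof (induction rule: converse_rtrancl_induct)
    case base
    show ?case
    proof (cases "b \<in> V")
      case True
      then obtain d where "d \<in> \<xi> b" "good (b + step d)" using b(2) unfolding good_def by blast
      moreover have "b \<notin> T" using b(1) TL by auto
      ultimately have "d \<in> \<xi>' b" "exits V \<xi>' (b + step d)"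
        using True b(1) good_exits by (auto simp: \<xi>'_def)
      then show ?thesis by (rule exits_step)
    qed (simp add: exits_outside)
  next
    case (step y v)
    then obtain d where d: "v = y + step d" by (auto simp: adj_def)
    have y: "y \<in> L" "v \<in> L" "y \<notin> T" using step TL by auto
    show ?case
    proof (cases "y \<in> V")
      case True
      then have "d \<in> \<xi>' y" using y d by (auto simp: \<xi>'_def)
      then show ?thesis using step y d exits_step by blast
    qed (simp add: exits_outside)
  qed
  have "{d. x' + step d \<in> L} \<subseteq> ctx V x' \<xi>'"
  proof -
    have "ctx V x' \<xi>' = {d. exits V \<xi>' (x' + step d)}" using ne' rx by (simp add: ctx_def)
    then show ?thesis using L_exits by blast
  qed
  then have 3: "opp (ctx V x' \<xi>')" using o by (rule opp_mono)
  have 4: "\<xi>' v = \<xi> v" if v: "v \<notin> B" "\<And>d. v + step d \<notin> B" for v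
  proof (cases "v \<in> V")
    case True
    have "v \<notin> T" "v \<notin> L" using v TL by auto
    with True v show ?thesis by (auto simp: \<xi>'_def)
  next
    case False
    with V(1) show ?thesis by (simp add: \<xi>'_def confs_def)
  qed
  show ?thesis using 1 2 3 4 by blast
qed

lemma mem_square: "v \<in> square n \<longleftrightarrow> fst v \<in> {- int n..int n} \<and> snd v \<in> {- int n..int n}"
  by (cases v) (simp add: square_def)

lemma surgery_square:
  assumes x: "x \<in> square n" and \<xi>: "\<xi> \<in> confs (square n)" "\<xi> x = {}" "ctx (square n) x \<xi> \<noteq> {}"
  shows "\<exists>x'\<in>square n. x \<in> block 1 x' \<and> (\<exists>\<xi>'\<in>confs (square n). \<xi>' x' = {} \<and> opp (ctx (square n) x' \<xi>') \<and>
    (\<forall>v. v \<notin> block 2 x \<longrightarrow> \<xi>' v = \<xi> v))"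
proof -
  let ?V = "square n" and ?B = "block 1 x"
  let ?P = "{(u, v) \<in> edges \<xi>. u \<notin> ?B}"
  have ne: "\<not> exits ?V \<xi> (0,0)" and rx: "((0,0), x) \<in> (edges \<xi>)\<^sup>*"
    and "\<exists>d. exits ?V \<xi> (x + step d)"
    using \<xi>(3) unfolding ctx_def by (auto split: if_splits)
  then obtain d where d: "exits ?V \<xi> (x + step d)" by auto
  have xB: "x \<in> ?B" "x + step d \<in> ?B" by (auto simp: mem_block) (cases d; simp)+
  obtain a where a: "a \<in> ?B" "((0,0), a) \<in> ?P\<^sup>*" using first_entrance[OF rx xB(1)] by blast
  obtain b where b: "b \<in> ?B" "b \<notin> ?V \<or> (\<exists>d\<in>\<xi> b. \<exists>z. z \<notin> ?V \<and> (b + step d, z) \<in> ?P\<^sup>*)"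
    using last_exit[OF d xB(2)] by blast
  have sub: "?P\<^sup>* \<subseteq> (edges \<xi>)\<^sup>*" by (rule rtrancl_mono) auto
  have b_exits: "exits ?V \<xi> b"
    using b(2)
  proof
    assume "b \<notin> ?V"
    then show ?thesis by (rule exits_outside)
  next
    assume "\<exists>d\<in>\<xi> b. \<exists>z. z \<notin> ?V \<and> (b + step d, z) \<in> ?P\<^sup>*"
    then obtain d z where dz: "d \<in> \<xi> b" "z \<notin> ?V" "(b + step d, z) \<in> ?P\<^sup>*" by blast
    have "exits ?V \<xi> (b + step d)" unfolding exits_def using dz(2) subsetD[OF sub dz(3)] by blast
    with dz(1) show ?thesis by (rule exits_step)
  qed
  have a_stuck: "\<not> exits ?V \<xi> a"
    using ne exits_rtrancl[OF subsetD[OF sub a(2)]] by blast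
  \<comment> \<open>The entry cannot escape but the exit can; and \<open>x\<close> has no open edge
    and lies in the square, so it is not the exit either. These are the two inequalities that a
    gadget requires.\<close>
  have ab: "b \<noteq> a" using b_exits a_stuck by auto
  have bx: "b \<noteq> x" using b(2) x \<xi>(2) by auto
  have aV: "a \<in> ?V" using a_stuck exits_outside[of a ?V \<xi>] by blast
  obtain \<alpha> where \<alpha>: "a = x + \<alpha>" "\<alpha> \<in> {-1..1} \<times> {-1..1}" using a(1) by (auto simp: block_def)
  obtain \<beta> where \<beta>: "b = x + \<beta>" "\<beta> \<in> {-1..1} \<times> {-1..1}" using b(1) by (auto simp: block_def)
  have "\<beta> \<noteq> (0,0)" "\<beta> \<noteq> \<alpha>" using ab bx \<alpha>(1) \<beta>(1) by (auto simp: zero_prod_def[symmetric])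
  from gadget_exists[OF \<alpha>(2) \<beta>(2) this] obtain p l where g: "gadget \<alpha> p l" "\<beta> \<in> set l" by auto
  let ?p = "map ((+) x) p" and ?l = "map ((+) x) l"
  have pB: "set p \<subseteq> {-1..1} \<times> {-1..1}" using g(1) \<alpha>(2) unfolding gadget_def by fastforce
  have suc: "successively adj ?p" "successively adj ?l"
    using g(1) by (simp_all add: gadget_def successively_map)
  have p: "?p \<noteq> []" "hd ?p = a" "last ?p = x + last p" "distinct ?p"
    using g(1) \<alpha>(1) by (auto simp: gadget_def hd_map last_map distinct_map inj_on_def)
  \<comment> \<open>Each coordinate of a path vertex is one of \<open>x\<close> or of
    \<open>a\<close>, and both lie in the square. The arc is free to leave the square, since
    vertices outside have escaped.\<close>
  have pV: "set ?p \<subseteq> ?V"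
  proof
    fix v assume "v \<in> set ?p"
    then obtain u where u: "v = x + u" "u \<in> {0, fst \<alpha>} \<times> {0, snd \<alpha>}" using g(1) by (auto simp: gadget_def)
    then have "fst v = fst x \<or> fst v = fst a" "snd v = snd x \<or> snd v = snd a"
      unfolding \<alpha>(1) by auto
    then show "v \<in> ?V" using x aV unfolding mem_square by metis
  qed
  have o: "opp {d. last ?p + step d \<in> set ?l}"
  proof -
    have "last ?p + step d \<in> set ?l" if "last p + step d \<in> set l" for d
      unfolding p(3) add.assoc using that by simp
    then have "{d. last p + step d \<in> set l} \<subseteq> {d. last ?p + step d \<in> set ?l}" by blast
    then show ?thesis by (rule opp_mono) (use g(1) in \<open>simp add: gadget_def\<close>)
  qed
  have lp: "last ?p \<in> set ?p" using p(1) by (rule last_in_set)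
  have ap: "a \<in> set ?p" using hd_in_set[OF p(1)] unfolding p(2) .
  have "\<exists>\<xi>'\<in>confs ?V. \<xi>' (last ?p) = {} \<and> opp (ctx ?V (last ?p) \<xi>') \<and>
    (\<forall>v. v \<notin> ?B \<longrightarrow> (\<forall>d. v + step d \<notin> ?B) \<longrightarrow> \<xi>' v = \<xi> v)"
  proof (rule surgery[OF ne \<xi>(1) origin_in_square a(2) ap _ pV _ _ lp _ _ _ b(2) o])
    show "set ?p \<subseteq> ?B" using pB by (auto simp: block_def)
    show "set ?l \<subseteq> ?B" using g(1) by (auto simp: block_def gadget_def)
    show "set ?p \<inter> set ?l = {}" using g(1) by (auto simp: gadget_def)
    show "(a, last ?p) \<in> {(u, v). u \<in> set ?p - {last ?p} \<and> v \<in> set ?p \<and> adj u v}\<^sup>*"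
      using path_reach_last[OF suc(1) p(4,1)] unfolding p(2) .
    show bl: "b \<in> set ?l" using g(2) \<beta>(1) by simp
    show "(u, b) \<in> {(u, v). u \<in> set ?l \<and> v \<in> set ?l \<and> adj u v}\<^sup>*" if "u \<in> set ?l" for u
      using successively_connected[OF suc(2) that bl] .
  qed
  then obtain \<xi>' where \<xi>': "\<xi>' \<in> confs ?V" "\<xi>' (last ?p) = {}" "opp (ctx ?V (last ?p) \<xi>')"
    "\<And>v. v \<notin> ?B \<Longrightarrow> (\<forall>d. v + step d \<notin> ?B) \<Longrightarrow> \<xi>' v = \<xi> v" by blast
  \<comment> \<open>The surgery also alters vertices with a neighbour in the block, hence radius
    2.\<close>
  have far: "\<xi>' v = \<xi> v" if "v \<notin> block 2 x" for v
  proof (rule \<xi>'(4))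
    show "v \<notin> ?B" using that by (auto simp: mem_block)
    show "\<forall>d. v + step d \<notin> ?B" using that step_into_block[of v _ 1 x] by auto
  qed
  have "last ?p \<in> ?B" using lp pB by (auto simp: block_def)
  then have "x \<in> block 1 (last ?p)" by (auto simp: mem_block)
  then show ?thesis using \<xi>' far lp pV by blast
qed

section \<open>Weight and multiplicity of the surgery\<close>

lemma card_confs: "finite N \<Longrightarrow> card (confs N) = card (UNIV :: dir set set) ^ card N"
proof -
  assume N: "finite N"
  have "confs N = PiE_dflt N {} (\<lambda>_. UNIV)" by (auto simp: PiE_dflt_def confs_def)
  then show ?thesis by (simp add: card_PiE_dflt N)
qed

lemma card_confs_agree:
  assumes "finite N"
  shows "card {\<xi> \<in> confs V. \<forall>v. v \<notin> N \<longrightarrow> \<xi> v = \<xi>' v} \<le> card (UNIV :: dir set set) ^ card N"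
  unfolding card_confs[OF assms, symmetric]
proof (rule card_inj_on_le)
  let ?f = "\<lambda>\<xi> v. if v \<in> N then \<xi> v else {}"
  let ?A = "{\<xi> \<in> confs V. \<forall>v. v \<notin> N \<longrightarrow> \<xi> v = \<xi>' v}"
  show "inj_on ?f ?A"
  proof (rule inj_onI)
    fix \<xi>1 \<xi>2 assume A: "\<xi>1 \<in> ?A" "\<xi>2 \<in> ?A" and eq: "?f \<xi>1 = ?f \<xi>2"
    show "\<xi>1 = \<xi>2"
    proof
      fix v show "\<xi>1 v = \<xi>2 v" using A fun_cong[OF eq, of v] by (cases "v \<in> N") auto
    qed
  qed
  show "?f ` ?A \<subseteq> confs N" by (auto simp: confs_def)
qed (simp add: assms)

lemma card_block_1: "card (block 1 x) \<le> 9" and card_block_2: "card (block 2 x) \<le> 25"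
  and finite_block [simp]: "finite (block r x)"
proof -
  show "card (block 1 x) \<le> 9"
    unfolding block_def by (rule order.trans[OF card_image_le]) (auto simp: card_cartesian_product)
  show "card (block 2 x) \<le> 25"
    unfolding block_def by (rule order.trans[OF card_image_le]) (auto simp: card_cartesian_product)
  show "finite (block r x)" by (simp add: block_def)
qed

text \<open>Only the at most \<open>m\<close> factors at vertices of \<open>N\<close> change: the
  old ones are at most 1 and the new ones at least \<open>\<kappa>\<close>.\<close>

lemma weight_ratio:
  fixes w :: "dir set \<Rightarrow> real"
  assumes V: "finite V" and N: "finite N" "card N \<le> m"
    and w: "\<And>s. \<kappa> \<le> w s" "\<And>s. w s \<le> 1" "0 < \<kappa>" "\<kappa> \<le> 1"
    and agree: "\<And>v. v \<notin> N \<Longrightarrow> \<xi>' v = \<xi> v"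
  shows "\<kappa> ^ m * (\<Prod>v\<in>V. w (\<xi> v)) \<le> (\<Prod>v\<in>V. w (\<xi>' v))"
proof -
  have w0: "0 \<le> w s" for s using w(1)[of s] w(3) by simp
  have "(\<Prod>v\<in>V. w (\<xi> v)) = (\<Prod>v\<in>V \<inter> N. w (\<xi> v)) * (\<Prod>v\<in>V - N. w (\<xi> v))"
    by (rule prod.Int_Diff[OF V])
  also have "\<dots> \<le> 1 * (\<Prod>v\<in>V - N. w (\<xi> v))"
    by (intro mult_right_mono prod_le_1 prod_nonneg) (use w0 w in auto)
  finally have 1: "(\<Prod>v\<in>V. w (\<xi> v)) \<le> (\<Prod>v\<in>V - N. w (\<xi>' v))" by (simp add: agree)
  have "card (V \<inter> N) \<le> m" using N card_mono[of N "V \<inter> N"] by auto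
  then have "\<kappa> ^ m \<le> (\<Prod>v\<in>V \<inter> N. \<kappa>)" using w by (simp add: power_decreasing)
  also have "\<dots> \<le> (\<Prod>v\<in>V \<inter> N. w (\<xi>' v))" by (intro prod_mono) (use w in auto)
  finally have "\<kappa> ^ m * (\<Prod>v\<in>V. w (\<xi> v)) \<le> (\<Prod>v\<in>V \<inter> N. w (\<xi>' v)) * (\<Prod>v\<in>V - N. w (\<xi>' v))"
    using 1 by (intro mult_mono) (auto intro!: prod_nonneg simp: w0)
  also have "\<dots> = (\<Prod>v\<in>V. w (\<xi>' v))" by (rule prod.Int_Diff[OF V, symmetric])
  finally show ?thesis .
qed

text \<open>A configuration on \<open>V - {x}\<close> is represented by one on \<open>V\<close> with
  empty state at \<open>x\<close>, at the price of the factor \<open>w {}\<close>. Pairs with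
  different \<open>x\<close> then live on the same vertex set, so the surgery can move the pivotal
  vertex.\<close>

lemma sum_ctx_pairs:
  assumes V: "finite V"
  shows "(\<Sum>g\<in>{(x, \<xi>). x \<in> V \<and> \<xi> \<in> confs V \<and> \<xi> x = {} \<and> P (ctx V x \<xi>)}. \<Prod>v\<in>V. w (snd g v)) =
    w {} * (\<Sum>x\<in>V. wexp (V - {x}) w (\<lambda>\<xi>. of_bool (P (ctx V x \<xi>))))"
proof -
  let ?G = "\<lambda>x. {\<xi> \<in> confs V. \<xi> x = {} \<and> P (ctx V x \<xi>)}"
  have "{(x, \<xi>). x \<in> V \<and> \<xi> \<in> confs V \<and> \<xi> x = {} \<and> P (ctx V x \<xi>)} = Sigma V ?G" by auto
  then have "(\<Sum>g\<in>{(x, \<xi>). x \<in> V \<and> \<xi> \<in> confs V \<and> \<xi> x = {} \<and> P (ctx V x \<xi>)}. \<Prod>v\<in>V. w (snd g v)) =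
      (\<Sum>x\<in>V. \<Sum>\<xi>\<in>?G x. \<Prod>v\<in>V. w (\<xi> v))"
    using V by (simp add: sum.Sigma case_prod_unfold)
  also have "\<dots> = (\<Sum>x\<in>V. w {} * wexp (V - {x}) w (\<lambda>\<xi>. of_bool (P (ctx V x \<xi>))))"
  proof (rule sum.cong[OF refl])
    fix x assume x: "x \<in> V"
    have "(\<Sum>\<xi>\<in>?G x. \<Prod>v\<in>V. w (\<xi> v)) = wexp V w (\<lambda>\<xi>. of_bool (\<xi> x = {} \<and> P (ctx V x \<xi>)))"
      unfolding wexp_def of_bool_def using V by (subst sum.inter_filter) (auto intro!: sum.cong)
    also have "\<dots> = (\<Sum>s\<in>UNIV. w s * wexp (V - {x}) w (\<lambda>\<xi>. of_bool (s = {} \<and> P (ctx V x (\<xi>(x := s))))))"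
      unfolding wexp_split[OF V x] by simp
    also have "\<dots> = (\<Sum>s\<in>{{}}. w s * wexp (V - {x}) w (\<lambda>\<xi>. of_bool (s = {} \<and> P (ctx V x (\<xi>(x := s))))))"
      by (rule sum.mono_neutral_right) (auto simp: wexp_def)
    also have "\<dots> = w {} * wexp (V - {x}) w (\<lambda>\<xi>. of_bool (P (ctx V x \<xi>)))"
    proof -
      have "wexp (V - {x}) w (\<lambda>\<xi>. of_bool (P (ctx V x (\<xi>(x := {}))))) =
          wexp (V - {x}) w (\<lambda>\<xi>. of_bool (P (ctx V x \<xi>)))"
      proof (rule wexp_cong)
        fix \<xi> assume "\<xi> \<in> confs (V - {x})"
        then have "\<xi>(x := {}) = \<xi>" by (auto simp: confs_def fun_eq_iff)
        then show "of_bool (P (ctx V x (\<xi>(x := {})))) = (of_bool (P (ctx V x \<xi>)) :: real)" by simp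
      qed
      then show ?thesis by simp
    qed
    finally show "(\<Sum>\<xi>\<in>?G x. \<Prod>v\<in>V. w (\<xi> v)) = w {} * wexp (V - {x}) w (\<lambda>\<xi>. of_bool (P (ctx V x \<xi>)))" .
  qed
  finally show ?thesis by (simp add: sum_distrib_left)
qed

text \<open>The surgery is a map from pivotal pairs to pairs with opposite pivotal directions. It
  changes at most 25 vertices, which bounds the loss of weight, and its fibres have bounded
  size.\<close>

lemma pivotal_le_opposite_pivotal:
  fixes w :: "dir set \<Rightarrow> real"
  assumes w: "\<And>s. \<kappa> \<le> w s" "(\<Sum>s\<in>UNIV. w s) = 1" "0 < \<kappa>"
  shows "\<kappa> ^ 25 * (\<Sum>x\<in>square n. wexp (square n - {x}) w (\<lambda>\<xi>. of_bool (ctx (square n) x \<xi> \<noteq> {}))) \<le>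
    9 * real (card (UNIV :: dir set set)) ^ 25 *
    (\<Sum>x\<in>square n. wexp (square n - {x}) w (\<lambda>\<xi>. of_bool (opp (ctx (square n) x \<xi>))))"
proof -
  let ?V = "square n" and ?M = "card (UNIV :: dir set set)"
  let ?Pr = "\<lambda>g. \<Prod>v\<in>?V. w (snd g v)"
  define G where "G = {(x, \<xi>). x \<in> ?V \<and> \<xi> \<in> confs ?V \<and> \<xi> x = {} \<and> ctx ?V x \<xi> \<noteq> {}}"
  define H where "H = {(x, \<xi>). x \<in> ?V \<and> \<xi> \<in> confs ?V \<and> \<xi> x = {} \<and> opp (ctx ?V x \<xi>)}"
  have w0: "0 \<le> w s" for s using w(1)[of s] w(3) by simp
  have w1: "w s \<le> 1" for s
    using member_le_sum[of s UNIV w] w0 w(2) by simp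
  have \<kappa>1: "\<kappa> \<le> 1" using w(1)[of "{}"] w1[of "{}"] by simp
  have fin: "finite G" "finite H"
    by (rule finite_subset[of _ "?V \<times> confs ?V"]; auto simp: G_def H_def)+
  have "\<forall>g\<in>G. \<exists>h. h \<in> H \<and> fst g \<in> block 1 (fst h) \<and> (\<forall>v. v \<notin> block 2 (fst g) \<longrightarrow> snd h v = snd g v)"
  proof
    fix g assume g: "g \<in> G"
    then have "fst g \<in> ?V" "snd g \<in> confs ?V" "snd g (fst g) = {}" "ctx ?V (fst g) (snd g) \<noteq> {}"
      by (auto simp: G_def)
    from surgery_square[OF this] obtain x' \<xi>' where
      "x' \<in> ?V" "fst g \<in> block 1 x'" "\<xi>' \<in> confs ?V" "\<xi>' x' = {}" "opp (ctx ?V x' \<xi>')"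
      "\<forall>v. v \<notin> block 2 (fst g) \<longrightarrow> \<xi>' v = snd g v" by blast
    then show "\<exists>h. h \<in> H \<and> fst g \<in> block 1 (fst h) \<and> (\<forall>v. v \<notin> block 2 (fst g) \<longrightarrow> snd h v = snd g v)"
      by (intro exI[of _ "(x', \<xi>')"]) (auto simp: H_def)
  qed
  from bchoice[OF this] obtain \<phi> where \<phi>: "\<And>g. g \<in> G \<Longrightarrow> \<phi> g \<in> H"
    "\<And>g. g \<in> G \<Longrightarrow> fst g \<in> block 1 (fst (\<phi> g))"
    "\<And>g v. g \<in> G \<Longrightarrow> v \<notin> block 2 (fst g) \<Longrightarrow> snd (\<phi> g) v = snd g v" by blast
  \<comment> \<open>Given the image, the old vertex is one of 9 in the unit block around the new
    one, and only the states in the block of 25 vertices around the old vertex are unknown.\<close>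
  have fibre: "card {g \<in> G. \<phi> g = h} \<le> 9 * ?M ^ 25" for h
  proof -
    let ?F = "\<lambda>x. {\<xi> \<in> confs ?V. \<forall>v. v \<notin> block 2 x \<longrightarrow> \<xi> v = snd h v}"
    have M: "1 \<le> ?M" by (simp add: Suc_leI finite_UNIV_card_ge_0)
    have "{g \<in> G. \<phi> g = h} \<subseteq> Sigma (block 1 (fst h)) ?F"
    proof
      fix g assume "g \<in> {g \<in> G. \<phi> g = h}"
      then have g: "g \<in> G" "\<phi> g = h" by auto
      have "fst g \<in> block 1 (fst h)" using \<phi>(2)[OF g(1)] g(2) by simp
      moreover have "snd g \<in> confs ?V" using g(1) by (auto simp: G_def)
      moreover have "\<forall>v. v \<notin> block 2 (fst g) \<longrightarrow> snd g v = snd h v" using \<phi>(3)[OF g(1)] g(2) by simp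
      ultimately show "g \<in> Sigma (block 1 (fst h)) ?F" by (simp add: mem_Sigma_iff[of "fst g" "snd g", simplified])
    qed
    then have "card {g \<in> G. \<phi> g = h} \<le> card (Sigma (block 1 (fst h)) ?F)"
      by (intro card_mono) auto
    also have "\<dots> = (\<Sum>x\<in>block 1 (fst h). card (?F x))" by (rule card_SigmaI) auto
    also have "\<dots> \<le> (\<Sum>x\<in>block 1 (fst h). ?M ^ 25)"
    proof (rule sum_mono)
      fix x
      have "card (?F x) \<le> ?M ^ card (block 2 x)" by (rule card_confs_agree) simp
      also have "\<dots> \<le> ?M ^ 25" using M card_block_2[of x] by (intro power_increasing)
      finally show "card (?F x) \<le> ?M ^ 25" .
    qed
    also have "\<dots> \<le> 9 * ?M ^ 25" using card_block_1[of "fst h"] by simp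
    finally show ?thesis .
  qed
  have "\<kappa> ^ 25 * (\<Sum>g\<in>G. ?Pr g) \<le> (\<Sum>g\<in>G. ?Pr (\<phi> g))"
    unfolding sum_distrib_left
  proof (rule sum_mono)
    fix g assume g: "g \<in> G"
    show "\<kappa> ^ 25 * ?Pr g \<le> ?Pr (\<phi> g)"
      by (rule weight_ratio[OF finite_square finite_block card_block_2 w(1) w1 w(3) \<kappa>1 \<phi>(3)[OF g]])
  qed
  also have "\<dots> = (\<Sum>h\<in>H. \<Sum>g\<in>{g \<in> G. \<phi> g = h}. ?Pr (\<phi> g))"
    by (rule sum.group[symmetric]) (use fin \<phi>(1) in auto)
  also have "\<dots> = (\<Sum>h\<in>H. real (card {g \<in> G. \<phi> g = h}) * ?Pr h)"
    by (intro sum.cong refl) simp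
  also have "\<dots> \<le> (\<Sum>h\<in>H. real (9 * ?M ^ 25) * ?Pr h)"
    using fibre by (intro sum_mono mult_right_mono prod_nonneg) (auto simp: w0 simp del: of_nat_mult of_nat_power)
  also have "\<dots> = 9 * real ?M ^ 25 * (\<Sum>h\<in>H. ?Pr h)" by (simp add: sum_distrib_left)
  finally have le: "\<kappa> ^ 25 * (\<Sum>g\<in>G. ?Pr g) \<le> 9 * real ?M ^ 25 * (\<Sum>h\<in>H. ?Pr h)" .
  have wp: "0 < w {}" using w(1)[of "{}"] w(3) by simp
  have "w {} * (\<kappa> ^ 25 * (\<Sum>x\<in>?V. wexp (?V - {x}) w (\<lambda>\<xi>. of_bool (ctx ?V x \<xi> \<noteq> {})))) \<le>
    w {} * (9 * real ?M ^ 25 * (\<Sum>x\<in>?V. wexp (?V - {x}) w (\<lambda>\<xi>. of_bool (opp (ctx ?V x \<xi>)))))"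
    using le unfolding G_def H_def sum_ctx_pairs[OF finite_square, where P = "\<lambda>A. A \<noteq> {}"]
      sum_ctx_pairs[OF finite_square, where P = opp] by (simp only: mult_ac)
  with wp show ?thesis by (simp only: mult_le_cancel_left_pos)
qed

text \<open>By convexity the lower bound \<open>\<kappa>\<close> holds along the whole segment, so
  opposite pivotal vertices form a fixed fraction of all pivotal ones there. Their gain
  \<open>g\<close> then outweighs the loss \<open>\<epsilon>\<close> in the sum over all
  vertices.\<close>

lemma exitp_mono_opposite:
  fixes w0 w1 :: "dir set \<Rightarrow> real"
  assumes k: "\<And>s. \<kappa> \<le> w0 s" "\<And>s. \<kappa> \<le> w1 s" "0 < \<kappa>"
    and s: "(\<Sum>s\<in>UNIV. w0 s) = 1" "(\<Sum>s\<in>UNIV. w1 s) = 1"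
    and e: "\<And>A. hit w0 A - \<epsilon> \<le> hit w1 A" "\<And>A. opp A \<Longrightarrow> hit w0 A + g \<le> hit w1 A"
    and g: "0 \<le> \<epsilon>" "\<epsilon> * (9 * real (card (UNIV :: dir set set)) ^ 25) \<le> g * \<kappa> ^ 25"
  shows "exitp (square n) w0 \<le> exitp (square n) w1"
proof (rule exitp_interpolate[OF finite_square s])
  fix t :: real assume t: "0 \<le> t" "t \<le> 1"
  let ?V = "square n"
  let ?w = "\<lambda>s. (1 - t) * w0 s + t * w1 s"
  let ?K = "9 * real (card (UNIV :: dir set set)) ^ 25"
  let ?a = "\<Sum>x\<in>?V. wexp (?V - {x}) ?w (\<lambda>\<xi>. of_bool (ctx ?V x \<xi> \<noteq> {}))"
  let ?b = "\<Sum>x\<in>?V. wexp (?V - {x}) ?w (\<lambda>\<xi>. of_bool (opp (ctx ?V x \<xi>)))"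
  have kw: "\<kappa> \<le> ?w s" for s
  proof -
    have "(1 - t) * \<kappa> + t * \<kappa> \<le> ?w s" using t k by (intro add_mono mult_left_mono) auto
    then show ?thesis by (simp add: algebra_simps)
  qed
  have w0: "0 \<le> ?w s" for s using kw[of s] k(3) by linarith
  have sw: "(\<Sum>s\<in>UNIV. ?w s) = 1" by (simp add: sum.distrib sum_distrib_left[symmetric] s)
  have b0: "0 \<le> ?b" by (intro sum_nonneg wexp_nonneg w0) auto
  have K: "\<kappa> ^ 25 * ?a \<le> ?K * ?b" by (rule pivotal_le_opposite_pivotal[OF kw sw k(3)])
  have "\<epsilon> * (\<kappa> ^ 25 * ?a) \<le> \<epsilon> * (?K * ?b)" by (rule mult_left_mono[OF K g(1)])
  also have "\<dots> = (\<epsilon> * ?K) * ?b" by simp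
  also have "\<dots> \<le> (g * \<kappa> ^ 25) * ?b" by (rule mult_right_mono[OF g(2) b0])
  finally have "\<kappa> ^ 25 * (\<epsilon> * ?a) \<le> \<kappa> ^ 25 * (g * ?b)" by (simp only: mult_ac)
  then have ab: "\<epsilon> * ?a \<le> g * ?b" using k(3) by (simp only: mult_le_cancel_left_pos zero_less_power)
  have "0 \<le> - \<epsilon> * ?a + g * ?b" using ab by simp
  also have "\<dots> = (\<Sum>x\<in>?V. wexp (?V - {x}) ?w (\<lambda>\<xi>. - \<epsilon> * of_bool (ctx ?V x \<xi> \<noteq> {}) + g * of_bool (opp (ctx ?V x \<xi>))))"
    unfolding wexp_add wexp_cmult sum.distrib sum_distrib_left ..
  also have "\<dots> \<le> (\<Sum>x\<in>?V. wexp (?V - {x}) ?w (\<lambda>\<xi>. hit w1 (ctx ?V x \<xi>) - hit w0 (ctx ?V x \<xi>)))"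
  proof (intro sum_mono wexp_mono w0)
    fix x \<xi>
    let ?A = "ctx ?V x \<xi>"
    have "opp ?A \<Longrightarrow> ?A \<noteq> {}" by (auto simp: opp_def)
    then show "- \<epsilon> * of_bool (?A \<noteq> {}) + g * of_bool (opp ?A) \<le> hit w1 ?A - hit w0 ?A"
      using e(1)[of ?A] e(2)[of ?A] g(1) by (cases "?A = {}"; cases "opp ?A") auto
  qed
  finally show "0 \<le> (\<Sum>x\<in>?V. wexp (?V - {x}) ?w (\<lambda>\<xi>. hit w1 (ctx ?V x \<xi>) - hit w0 (ctx ?V x \<xi>)))" .
qed

section \<open>The corner law\<close>

lemma hit_mono:
  assumes "\<And>s. 0 \<le> w s" "A \<subseteq> B"
  shows "hit w A \<le> hit w B"
  unfolding hit_def by (rule sum_mono2) (use assms in auto)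

lemma hit_bind_pmf_of_set:
  assumes "finite X" "X \<noteq> {}"
  shows "hit (pmf (bind_pmf (pmf_of_set X) f)) A = (\<Sum>x\<in>X. hit (pmf (f x)) A) / card X"
  unfolding hit_def pmf_bind_pmf_of_set[OF assms(2,1)] sum_divide_distrib[symmetric]
  by (subst sum.swap) simp

lemma hit_bind_bernoulli:
  assumes "0 \<le> e" "e \<le> 1"
  shows "hit (pmf (bind_pmf (bernoulli_pmf e) f)) A =
    e * hit (pmf (f True)) A + (1 - e) * hit (pmf (f False)) A"
proof -
  have "pmf (bind_pmf (bernoulli_pmf e) f) s = e * pmf (f True) s + (1 - e) * pmf (f False) s" for s
    unfolding pmf_bind
    by (subst integral_measure_pmf_real[of UNIV]) (use assms in \<open>auto simp: UNIV_bool\<close>)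
  then show ?thesis by (simp add: hit_def sum.distrib sum_distrib_left)
qed

lemma hit_return: "hit (pmf (return_pmf s)) A = of_bool (s \<inter> A \<noteq> {})"
proof -
  have "hit (pmf (return_pmf s)) A = measure (measure_pmf (return_pmf s)) {s. s \<inter> A \<noteq> {}}"
    unfolding hit_def by (rule measure_measure_pmf_finite[symmetric]) simp
  then show ?thesis by (simp add: indicator_def of_bool_def)
qed

lemma hit_map_pmf_of_set:
  assumes "finite X" "X \<noteq> {}"
  shows "hit (pmf (map_pmf g (pmf_of_set X))) A = (\<Sum>x\<in>X. of_bool (g x \<inter> A \<noteq> {})) / card X"
  unfolding map_pmf_def hit_bind_pmf_of_set[OF assms] hit_return ..

lemma mem_orth: "e \<in> orth d \<longleftrightarrow> fst (step d) * fst (step e) + snd (step d) * snd (step e) = 0"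
  by (simp add: orth_def)

lemma orth_simps:
  "orth East = {North, South}" "orth West = {North, South}"
  "orth North = {East, West}" "orth South = {East, West}"
proof -
  have "e \<in> orth East \<longleftrightarrow> e \<in> {North, South}" "e \<in> orth West \<longleftrightarrow> e \<in> {North, South}"
    "e \<in> orth North \<longleftrightarrow> e \<in> {East, West}" "e \<in> orth South \<longleftrightarrow> e \<in> {East, West}" for e
    unfolding mem_orth by (cases e; simp)+
  then show "orth East = {North, South}" "orth West = {North, South}"
    "orth North = {East, West}" "orth South = {East, West}" by blast+
qed

definition corners :: "dir set set" where
  "corners = {{North, East}, {North, West}, {South, East}, {South, West}}"

text \<open>The hitting function of the corner law at \<open>p = 1 / 2\<close>.\<close>

definition corner_hit :: "dir set \<Rightarrow> real" where
  "corner_hit A = (\<Sum>C\<in>corners. of_bool (C \<inter> A \<noteq> {})) / 4"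

lemma sum_corners:
  "(\<Sum>C\<in>corners. f C) = f {North, East} + f {North, West} + f {South, East} + (f {South, West} :: real)"
proof -
  have "{North, East} \<noteq> {North, West}" "{North, East} \<noteq> {South, East}" "{North, East} \<noteq> {South, West}"
    "{North, West} \<noteq> {South, East}" "{North, West} \<noteq> {South, West}" "{South, East} \<noteq> {South, West}" by auto
  then show ?thesis by (simp add: corners_def)
qed

lemma card_corners: "card corners = 4"
  using sum_corners[of "\<lambda>_. 1"] by simp

lemma sum_dir: "(\<Sum>d\<in>UNIV. f d) = f East + f North + f West + (f South :: real)"
  by (simp add: UNIV_dir)

lemma card_UNIV_dir: "card (UNIV :: dir set) = 4"
  by (simp add: UNIV_dir)

text \<open>On the first three kinds of sets \<open>corner_hit\<close> agrees with independent edges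
  of density \<open>1 / 2\<close>. The last kind contains every set of at least three
  directions.\<close>

lemma dir_set_cases:
  obtains "A = {}" | a where "A = {a}" | a b where "A = {a, b}" "b \<in> orth a" | "opp A"
proof -
  show ?thesis
  proof (cases "opp A")
    case False
    then have n: "East \<notin> A \<or> West \<notin> A" "North \<notin> A \<or> South \<notin> A" by (auto simp: opp_def)
    have "x \<in> A \<longleftrightarrow> x \<in> (A \<inter> {East, West}) \<union> (A \<inter> {North, South})" for x
      by (cases x) simp_all
    then have sub: "A = (A \<inter> {East, West}) \<union> (A \<inter> {North, South})" by (rule set_eqI)
    have 1: "A \<inter> {East, West} = {} \<or> (\<exists>a\<in>{East, West}. A \<inter> {East, West} = {a})" using n(1) by auto
    have 2: "A \<inter> {North, South} = {} \<or> (\<exists>a\<in>{North, South}. A \<inter> {North, South} = {a})" using n(2) by auto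
    from 1 2 show ?thesis
    proof (elim disjE bexE)
      fix a b assume ab: "a \<in> {East, West}" "A \<inter> {East, West} = {a}" "b \<in> {North, South}" "A \<inter> {North, South} = {b}"
      have "A = {a} \<union> {b}" by (subst sub) (simp only: ab)
      also have "{a} \<union> {b} = {a, b}" by auto
      finally show ?thesis by (rule that(3)) (use ab(1,3) in \<open>auto simp: orth_simps\<close>)
    next
      assume e: "A \<inter> {East, West} = {}" "A \<inter> {North, South} = {}"
      have "A = {} \<union> {}" by (subst sub) (simp only: e)
      then show ?thesis using that(1) by simp
    next
      fix b assume e: "A \<inter> {East, West} = {}" "A \<inter> {North, South} = {b}"
      have "A = {} \<union> {b}" by (subst sub) (simp only: e)
      then show ?thesis using that(2) by simp
    next
      fix a assume e: "A \<inter> {East, West} = {a}" "A \<inter> {North, South} = {}"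
      have "A = {a} \<union> {}" by (subst sub) (simp only: e)
      then show ?thesis using that(2) by simp
    qed
  qed (rule that)
qed

lemma corner_hit_values:
  "corner_hit {} = 0" "corner_hit {a} = 1 / 2" "b \<in> orth a \<Longrightarrow> corner_hit {a, b} = 3 / 4"
  "opp A \<Longrightarrow> corner_hit A = 1"
proof -
  show "corner_hit {} = 0" by (simp add: corner_hit_def)
  show "corner_hit {a} = 1 / 2" unfolding corner_hit_def sum_corners by (cases a) simp_all
  show "b \<in> orth a \<Longrightarrow> corner_hit {a, b} = 3 / 4"
    unfolding corner_hit_def sum_corners by (cases a) (auto simp: orth_simps)
  show "opp A \<Longrightarrow> corner_hit A = 1"
    unfolding corner_hit_def sum_corners opp_def by auto
qed

text \<open>Two opposite directions are both missed only if the first edge is orthogonal to them and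
  no second edge is opened; with \<open>\<epsilon> = 4 * p - 1\<close> this leaves
  \<open>1 / 2 + \<epsilon> / 2 = 2 * p\<close>.\<close>

lemma corner_pmf_hit_1:
  assumes p: "1 / 4 \<le> p" "p < 1 / 2"
  shows "hit (pmf (corner_pmf p)) {a} = p"
    and "b \<in> orth a \<Longrightarrow> hit (pmf (corner_pmf p)) {a, b} = p + 1 / 4"
    and "opp A \<Longrightarrow> 2 * p \<le> hit (pmf (corner_pmf p)) A"
proof -
  have k: "\<lfloor>4 * p\<rfloor> = 1" using p by linarith
  have orth: "orth d \<noteq> {}" "card (orth d) = 2" for d by (cases d; simp add: orth_simps)+
  have c: "corner_pmf p = bind_pmf (pmf_of_set UNIV) (\<lambda>d. bind_pmf (bernoulli_pmf (4 * p - 1))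
      (\<lambda>b. if b then map_pmf (\<lambda>e. {d, e}) (pmf_of_set (orth d)) else return_pmf {d}))"
    unfolding corner_pmf_def Let_def k by simp
  have e: "0 \<le> 4 * p - 1" "4 * p - 1 \<le> 1" using p by auto
  have h: "hit (pmf (corner_pmf p)) A = (\<Sum>d\<in>UNIV. (4 * p - 1) * ((\<Sum>e\<in>orth d. of_bool ({d, e} \<inter> A \<noteq> {})) / 2) +
      (1 - (4 * p - 1)) * of_bool ({d} \<inter> A \<noteq> {})) / 4" for A
    unfolding c hit_bind_pmf_of_set[OF finite UNIV_not_empty] card_UNIV_dir hit_bind_bernoulli[OF e]
      if_True if_False hit_return hit_map_pmf_of_set[OF finite orth(1)] orth(2) of_nat_numeral ..
  show "hit (pmf (corner_pmf p)) {a} = p"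
    unfolding h sum_dir by (cases a) (simp_all add: orth_simps field_simps)
  show "b \<in> orth a \<Longrightarrow> hit (pmf (corner_pmf p)) {a, b} = p + 1 / 4"
    unfolding h sum_dir by (cases a) (auto simp: orth_simps field_simps)
  have "2 * p \<le> hit (pmf (corner_pmf p)) {East, West}" "2 * p \<le> hit (pmf (corner_pmf p)) {North, South}"
    unfolding h sum_dir by (simp_all add: orth_simps field_simps)
  moreover assume "opp A"
  ultimately show "2 * p \<le> hit (pmf (corner_pmf p)) A"
    unfolding opp_def using hit_mono[of "pmf (corner_pmf p)" _ A] by (meson order.trans pmf_nonneg)
qed

text \<open>A third edge can only help, so the uniform corner underneath gives the lower
  bound.\<close>

lemma corner_pmf_hit_2:
  assumes p: "1 / 2 \<le> p" "p < 3 / 4"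
  shows "corner_hit A \<le> hit (pmf (corner_pmf p)) A"
proof -
  have k: "\<lfloor>4 * p\<rfloor> = 2" using p by linarith
  have ne: "corners \<noteq> {}" "finite corners" by (simp_all add: corners_def)
  have le: "of_bool (C \<inter> A \<noteq> {}) \<le> (4 * p - 2) * ((\<Sum>e\<in>- C. of_bool (insert e C \<inter> A \<noteq> {})) / card (- C)) +
      (1 - (4 * p - 2)) * of_bool (C \<inter> A \<noteq> {})" if C: "C \<in> corners" for C
  proof (cases "C \<inter> A = {}")
    case True
    then show ?thesis using p by (auto intro!: mult_nonneg_nonneg divide_nonneg_nonneg sum_nonneg)
  next
    case False
    then have "insert e C \<inter> A \<noteq> {}" for e by auto
    moreover have "- C \<noteq> {}" using C by (auto simp: corners_def)
    ultimately show ?thesis using False by simp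
  qed
  have eq: "hit (pmf (corner_pmf p)) A = (\<Sum>C\<in>corners. (4 * p - 2) * ((\<Sum>e\<in>- C. of_bool (insert e C \<inter> A \<noteq> {})) / card (- C)) +
      (1 - (4 * p - 2)) * of_bool (C \<inter> A \<noteq> {})) / 4"
  proof -
    have nC: "- C \<noteq> {}" if "C \<in> corners" for C using that by (auto simp: corners_def)
    show ?thesis
      unfolding corner_pmf_def Let_def k corners_def[symmetric] using p
      by (simp add: hit_bind_pmf_of_set ne card_corners hit_bind_bernoulli hit_return hit_map_pmf_of_set nC cong: sum.cong)
  qed
  show ?thesis unfolding corner_hit_def eq by (intro divide_right_mono sum_mono le) auto
qed

lemma card_3_dir_sets: "{T :: dir set. card T = 3} = (\<lambda>d. - {d}) ` UNIV"
proof -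
  have c: "card (- T) = 4 - card T" for T :: "dir set"
    unfolding Compl_eq_Diff_UNIV by (simp add: card_Diff_subset card_UNIV_dir)
  show ?thesis
  proof (intro set_eqI iffI)
    fix T :: "dir set" assume "T \<in> {T. card T = 3}"
    then have "card (- T) = 1" using c[of T] by simp
    then obtain d where "- T = {d}" by (rule card_1_singletonE)
    then have "T = - {d}" by blast
    then show "T \<in> (\<lambda>d. - {d}) ` UNIV" by blast
  next
    fix T :: "dir set" assume "T \<in> (\<lambda>d. - {d}) ` UNIV"
    then obtain d where "T = - {d}" by blast
    then show "T \<in> {T. card T = 3}" using c[of "{d}"] by simp
  qed
qed

lemma corner_pmf_hit_3:
  assumes p: "3 / 4 \<le> p" "p \<le> 1" and A: "A \<noteq> {}"
  shows "corner_hit A \<le> hit (pmf (corner_pmf p)) A"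
proof (cases "p = 1")
  case True
  have "hit (pmf (corner_pmf p)) A = 1"
    unfolding corner_pmf_def True Let_def using A by (simp add: hit_return)
  moreover have "corner_hit A \<le> 1"
    unfolding corner_hit_def sum_corners by simp
  ultimately show ?thesis by simp
next
  case False
  then have k: "\<lfloor>4 * p\<rfloor> = 3" using p by linarith
  let ?T = "{T :: dir set. card T = 3}"
  have inj: "inj (\<lambda>d. - {d} :: dir set)" by (auto simp: inj_on_def)
  have T4: "card ?T = 4" unfolding card_3_dir_sets using card_image[OF inj] by (simp add: UNIV_dir)
  have neT: "?T \<noteq> {}" unfolding card_3_dir_sets by simp
  have "hit (pmf (corner_pmf p)) A = (\<Sum>T\<in>?T. (4 * p - 3) + (1 - (4 * p - 3)) * of_bool (T \<inter> A \<noteq> {})) / 4"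
    unfolding corner_pmf_def Let_def k using p False A neT
    by (simp add: hit_bind_pmf_of_set T4 hit_bind_bernoulli hit_return)
  also have "\<dots> \<ge> (\<Sum>T\<in>?T. of_bool (T \<inter> A \<noteq> {})) / 4"
  proof (intro divide_right_mono sum_mono)
    fix T :: "dir set"
    show "of_bool (T \<inter> A \<noteq> {}) \<le> (4 * p - 3) + (1 - (4 * p - 3)) * of_bool (T \<inter> A \<noteq> {})"
      using p by (cases "T \<inter> A = {}") auto
  qed simp
  also have "(\<Sum>T\<in>?T. of_bool (T \<inter> A \<noteq> {})) = (\<Sum>d\<in>UNIV. (of_bool (- {d} \<inter> A \<noteq> {}) :: real))"
    unfolding card_3_dir_sets by (simp add: sum.reindex[OF inj])
  also have "corner_hit A \<le> (\<Sum>d\<in>UNIV. (of_bool (- {d} \<inter> A \<noteq> {}) :: real)) / 4"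
  proof -
    \<comment> \<open>A matching of the four corners with four distinct triples that contain
      them.\<close>
    have "(of_bool ({North, East} \<inter> A \<noteq> {}) :: real) \<le> of_bool (- {South} \<inter> A \<noteq> {})"
      "(of_bool ({North, West} \<inter> A \<noteq> {}) :: real) \<le> of_bool (- {East} \<inter> A \<noteq> {})"
      "(of_bool ({South, East} \<inter> A \<noteq> {}) :: real) \<le> of_bool (- {West} \<inter> A \<noteq> {})"
      "(of_bool ({South, West} \<inter> A \<noteq> {}) :: real) \<le> of_bool (- {North} \<inter> A \<noteq> {})"
      by (auto simp: of_bool_def)
    then show ?thesis unfolding corner_hit_def sum_corners sum_dir by simp
  qed
  finally show ?thesis .
qed

section \<open>Comparison and passage to the infinite lattice\<close>

text \<open>Half Bernoulli with parameter slightly above \<open>1 / 2\<close>, half the corner law at \<open>p = 1 / 2\<close>, thinned.\<close>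

definition mix :: "real \<Rightarrow> dir set \<Rightarrow> real" where
  "mix h s = (bw (1 / 2 + h) s +
    ((1 - 4 * h) * (if s \<in> corners then 1 / 4 else 0) + 4 * h * (if s = {} then 1 else 0))) / 2"

lemma sum_mix:
  "(\<Sum>s\<in>X. mix h s) = ((\<Sum>s\<in>X. bw (1 / 2 + h) s) +
    ((1 - 4 * h) * (\<Sum>s\<in>corners. if s \<in> X then 1 / 4 else 0) + 4 * h * of_bool ({} \<in> X))) / 2"
proof -
  have 1: "(\<Sum>s\<in>X. if s \<in> corners then 1 / 4 else (0 :: real)) = (\<Sum>s\<in>corners. if s \<in> X then 1 / 4 else 0)"
    by (simp add: sum.If_cases Int_commute)
  have 2: "(\<Sum>s\<in>X. if s = {} then 1 else (0 :: real)) = of_bool ({} \<in> X)" by simp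
  show ?thesis
    unfolding mix_def sum_divide_distrib[symmetric] sum.distrib sum_distrib_left[symmetric] 1 2 ..
qed

lemma sum_mix_UNIV: "(\<Sum>s\<in>UNIV. mix h s) = 1"
  unfolding sum_mix sum_bw by (simp add: card_corners)

lemma hit_mix: "hit (mix h) A = (hit (bw (1 / 2 + h)) A + (1 - 4 * h) * corner_hit A) / 2"
proof -
  have "(\<Sum>s\<in>corners. if s \<in> {s. s \<inter> A \<noteq> {}} then 1 / 4 else 0) = corner_hit A"
    unfolding corner_hit_def sum_divide_distrib by (intro sum.cong) auto
  then show ?thesis unfolding hit_def sum_mix by simp
qed

text \<open>Both \<open>p\<close> and \<open>1 - p\<close> are at least \<open>2 / 5\<close>, and
  each state is a product of four such factors.\<close>

lemma bw_ge:
  assumes "0 \<le> h" "h \<le> 1 / 10"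
  shows "2 / 100 \<le> bw (1 / 2 + h) s"
proof -
  have "card s + card (- s) = card (s \<union> - s)" by (rule card_Un_disjoint[symmetric]) auto
  then have "card s + card (- s) = 4" by (simp add: card_UNIV_dir)
  then have "(2 / 5 :: real) ^ card s * (2 / 5) ^ card (- s) = (2 / 5) ^ 4"
    by (metis power_add)
  moreover have "(2 / 5) ^ card s * (2 / 5) ^ card (- s) \<le> bw (1 / 2 + h) s"
    unfolding bw_def using assms by (intro mult_mono power_mono) auto
  moreover have "(2 / 100 :: real) \<le> (2 / 5) ^ 4" by (simp add: power4_eq_xxxx)
  ultimately show ?thesis by linarith
qed

lemma mix_ge:
  assumes "0 \<le> h" "h \<le> 1 / 10"
  shows "1 / 100 \<le> mix h s"
proof -
  define r where "r = (1 - 4 * h) * (if s \<in> corners then 1 / 4 else 0) + 4 * h * (if s = {} then 1 else 0)"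
  have "0 \<le> r"
    unfolding r_def using assms by (intro add_nonneg_nonneg mult_nonneg_nonneg) auto
  then show ?thesis unfolding mix_def r_def[symmetric] using bw_ge[OF assms, of s] by simp
qed

lemma card_orth_pair: "b \<in> orth a \<Longrightarrow> card {a, b} = 2"
  by (cases a) (auto simp: orth_simps)

lemma hit_bw_values:
  "hit (bw (1 / 2 + h)) {a} = 1 / 2 + h"
  "b \<in> orth a \<Longrightarrow> hit (bw (1 / 2 + h)) {a, b} = 3 / 4 + h - h\<^sup>2"
  "0 \<le> h \<Longrightarrow> h \<le> 1 / 10 \<Longrightarrow> hit (bw (1 / 2 + h)) A \<le> 1 - 25 / 1000"
proof -
  show "hit (bw (1 / 2 + h)) {a} = 1 / 2 + h" unfolding hit_bw by simp
  show "b \<in> orth a \<Longrightarrow> hit (bw (1 / 2 + h)) {a, b} = 3 / 4 + h - h\<^sup>2"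
    unfolding hit_bw by (simp add: card_orth_pair power2_eq_square field_simps)
  assume h: "0 \<le> h" "h \<le> 1 / 10"
  have "card A \<le> 4" using card_mono[of UNIV A] by (simp add: card_UNIV_dir)
  then have "(2 / 5) ^ 4 \<le> (2 / 5 :: real) ^ card A" by (intro power_decreasing) auto
  also have "\<dots> \<le> (1 - (1 / 2 + h)) ^ card A" using h by (intro power_mono) auto
  finally have "25 / 1000 \<le> (1 - (1 / 2 + h)) ^ card A" by (simp add: power4_eq_xxxx)
  then show "hit (bw (1 / 2 + h)) A \<le> 1 - 25 / 1000" unfolding hit_bw by linarith
qed

text \<open>The loss \<open>2 * h\<close> comes from orthogonal pairs, where mixing costs
  \<open>2 * h - h\<^sup>2 / 2\<close>. With opposite directions the thinned corner law has the
  value \<open>1 - 4 * h\<close> against at most \<open>975 / 1000\<close>, and half of the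
  difference exceeds \<open>1 / 1000\<close>.\<close>

lemma hit_mix_ge_bw:
  assumes h: "0 \<le> h" "h \<le> 1 / 1000"
  shows "hit (bw (1 / 2 + h)) A - 2 * h \<le> hit (mix h) A"
    and "opp A \<Longrightarrow> hit (bw (1 / 2 + h)) A + 1 / 1000 \<le> hit (mix h) A"
proof -
  have x: "hit (bw (1 / 2 + h)) A \<le> 1 - 25 / 1000" using h by (intro hit_bw_values) auto
  show "hit (bw (1 / 2 + h)) A - 2 * h \<le> hit (mix h) A"
  proof (cases A rule: dir_set_cases)
    case 1
    then show ?thesis using h by simp
  next
    case (2 a)
    show ?thesis unfolding 2 hit_mix hit_bw_values corner_hit_values using h by (simp add: field_simps)
  next
    case (3 a b)
    show ?thesis unfolding 3(1) hit_mix hit_bw_values(2)[OF 3(2)] corner_hit_values(3)[OF 3(2)]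
      by (simp add: field_simps)
  next
    case 4
    show ?thesis unfolding hit_mix corner_hit_values(4)[OF 4] using x by (simp add: field_simps)
  qed
  show "opp A \<Longrightarrow> hit (bw (1 / 2 + h)) A + 1 / 1000 \<le> hit (mix h) A"
    unfolding hit_mix using corner_hit_values(4)[of A] x h by (simp add: field_simps)
qed

text \<open>Single directions fix the range of \<open>p\<close>: the thinning by
  \<open>4 * h\<close> brings the mixture to exactly \<open>1 / 2 - h / 2\<close> there. From
  \<open>p = 1 / 2\<close> on, \<open>corner_hit\<close> is the lower bound.\<close>

lemma hit_mix_le_corner:
  assumes h: "0 \<le> h" "h \<le> 1 / 1000" and p: "1 / 2 - h / 2 \<le> p" "p \<le> 1"
  shows "hit (mix h) A \<le> hit (pmf (corner_pmf p)) A"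
proof (cases "A = {}")
  case False
  have x: "hit (bw (1 / 2 + h)) A \<le> 1 - 25 / 1000" using h by (intro hit_bw_values) auto
  have c: "corner_hit A \<le> hit (pmf (corner_pmf p)) A" if "1 / 2 \<le> p"
    using corner_pmf_hit_2[of p A] corner_pmf_hit_3[of p A] that p False by (cases "p < 3 / 4") auto
  have k1: "1 / 4 \<le> p" using p h by simp
  show ?thesis
  proof (cases A rule: dir_set_cases)
    case (2 a)
    have "min p (1 / 2) \<le> hit (pmf (corner_pmf p)) A"
      using c corner_pmf_hit_1(1)[OF k1, of a] unfolding 2 corner_hit_values by (cases "p < 1 / 2") auto
    moreover have "hit (mix h) A = 1 / 2 - h / 2"
      unfolding 2 hit_mix hit_bw_values corner_hit_values by (simp add: field_simps)
    ultimately show ?thesis using p h by linarith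
  next
    case (3 a b)
    have "min (p + 1 / 4) (3 / 4) \<le> hit (pmf (corner_pmf p)) A"
      using c corner_pmf_hit_1(2)[OF k1 _ 3(2)] unfolding 3(1) corner_hit_values(3)[OF 3(2)]
      by (cases "p < 1 / 2") auto
    moreover have "hit (mix h) A = 3 / 4 - h - h\<^sup>2 / 2"
      unfolding 3(1) hit_mix hit_bw_values(2)[OF 3(2)] corner_hit_values(3)[OF 3(2)] by (simp add: field_simps)
    moreover have "0 \<le> h\<^sup>2" by simp
    ultimately show ?thesis using p h by linarith
  next
    case 4
    have "min (2 * p) 1 \<le> hit (pmf (corner_pmf p)) A"
      using c corner_pmf_hit_1(3)[OF k1 _ 4] unfolding corner_hit_values(4)[OF 4]
      by (cases "p < 1 / 2") auto
    moreover have "hit (mix h) A \<le> 1 - 2 * h"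
      unfolding hit_mix corner_hit_values(4)[OF 4] using x by (simp add: field_simps)
    ultimately show ?thesis using p h by linarith
  qed (use False in simp)
qed simp

lemma sum_pmf_UNIV: "(\<Sum>s\<in>UNIV. pmf (M :: dir set pmf) s) = 1"
  by (rule sum_pmf_eq_1) auto

lemma exitp_corner_uniform:
  "\<exists>p0 c. p0 < 1 / 2 \<and> 0 < p0 \<and> 0 < c \<and>
    (\<forall>p n. p0 \<le> p \<longrightarrow> p \<le> 1 \<longrightarrow> c \<le> exitp (square n) (pmf (corner_pmf p)))"
proof -
  define K where "K = 9 * real (card (UNIV :: dir set set)) ^ 25"
  \<comment> \<open>\<open>K\<close> is the bound on the fibres of the surgery. The second term
    makes the loss \<open>2 * h\<close> times \<open>K\<close> at most the gain
    \<open>1 / 1000\<close> times the 25th power of the smallest weight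
    \<open>1 / 100\<close>.\<close>
  define h where "h = min (1 / 1000) (1 / 1000 * (1 / 100) ^ 25 / (2 * K))"
  have "0 < real (card (UNIV :: dir set set))" by (simp add: finite_UNIV_card_ge_0)
  then have K: "0 < K" unfolding K_def by (intro mult_pos_pos zero_less_power) auto
  have h: "0 < h" "h \<le> 1 / 1000" using K by (auto simp: h_def)
  have "h \<le> 1 / 1000 * (1 / 100) ^ 25 / (2 * K)" by (simp only: h_def min.cobounded2)
  then have hK: "2 * h * K \<le> 1 / 1000 * (1 / 100) ^ 25" using K by (simp add: field_simps)
  have ge: "1 - exp (- h) \<le> exitp (square n) (pmf (corner_pmf p))" if p: "1 / 2 - h / 2 \<le> p" "p \<le> 1" for p n
  proof -
    have "1 - exp (- h) \<le> exitp (square n) (bw (1 / 2 + h))"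
      using h by (intro exitp_bw_supercritical) auto
    also have "\<dots> \<le> exitp (square n) (mix h)"
    proof (rule exitp_mono_opposite[where \<kappa> = "1 / 100" and \<epsilon> = "2 * h" and g = "1 / 1000"])
      show "1 / 100 \<le> bw (1 / 2 + h) s" for s using bw_ge[of h s] h by simp
      show "1 / 100 \<le> mix h s" for s using h by (intro mix_ge) auto
      show "2 * h * (9 * real (card (UNIV :: dir set set)) ^ 25) \<le> 1 / 1000 * (1 / 100) ^ 25"
        using hK unfolding K_def .
    qed (use h hit_mix_ge_bw[of h] in \<open>auto simp: sum_bw sum_mix_UNIV\<close>)
    also have "\<dots> \<le> exitp (square n) (pmf (corner_pmf p))"
    proof (rule exitp_mono_hit)
      show "0 \<le> mix h s" for s using mix_ge[of h s] h by simp
      show "hit (mix h) A \<le> hit (pmf (corner_pmf p)) A" for A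
        using h p by (intro hit_mix_le_corner) auto
    qed (simp_all add: sum_mix_UNIV sum_pmf_UNIV)
    finally show ?thesis .
  qed
  show ?thesis by (intro exI[of _ "1 / 2 - h / 2"] exI[of _ "1 - exp (- h)"]) (use h ge in auto)
qed

section \<open>Koenig's lemma: escape from every box yields a self-avoiding path\<close>

lemma open_edge_iff: "open_edge \<xi> x y \<longleftrightarrow> (x, y) \<in> edges \<xi>"
  by (simp add: open_edge_def edges_iff)

definition avoiding :: "config \<Rightarrow> (int \<times> int) set \<Rightarrow> int \<times> int \<Rightarrow> (int \<times> int) set" where
  "avoiding \<xi> F x = {z. (x, z) \<in> (edges \<xi> \<inter> UNIV \<times> (- F))\<^sup>*}"

text \<open>Split a walk at its last visit to \<open>x\<close>: what follows starts at a neighbour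
  and avoids \<open>x\<close> as well as \<open>F\<close>.\<close>

lemma avoiding_subset:
  "avoiding \<xi> F x \<subseteq> insert x (\<Union>d\<in>{d \<in> \<xi> x. x + step d \<notin> insert x F}. avoiding \<xi> (insert x F) (x + step d))"
proof
  fix z assume "z \<in> avoiding \<xi> F x"
  then have "(x, z) \<in> (edges \<xi> \<inter> UNIV \<times> (- F))\<^sup>*" by (simp add: avoiding_def)
  then show "z \<in> insert x (\<Union>d\<in>{d \<in> \<xi> x. x + step d \<notin> insert x F}. avoiding \<xi> (insert x F) (x + step d))"
  proof (induction rule: rtrancl_induct)
    case (step y z)
    show ?case
    proof (cases "z = x")
      case False
      have z: "(y, z) \<in> edges \<xi>" "z \<notin> insert x F" using step(2) False by auto
      show ?thesis
      proof (cases "y = x")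
        case True
        then obtain d where d: "d \<in> \<xi> x" "z = x + step d" using z(1) by (auto simp: edges_iff)
        moreover have "z \<in> avoiding \<xi> (insert x F) z" by (simp add: avoiding_def)
        ultimately show ?thesis using z(2) by blast
      next
        case False
        then obtain d where d: "d \<in> {d \<in> \<xi> x. x + step d \<notin> insert x F}"
          "y \<in> avoiding \<xi> (insert x F) (x + step d)" using step(3) by blast
        then have "(x + step d, y) \<in> (edges \<xi> \<inter> UNIV \<times> (- insert x F))\<^sup>*" by (simp add: avoiding_def)
        moreover have "(y, z) \<in> edges \<xi> \<inter> UNIV \<times> (- insert x F)" using z by simp
        ultimately have "z \<in> avoiding \<xi> (insert x F) (x + step d)"
          unfolding avoiding_def by (auto intro: rtrancl_into_rtrancl)
        with d(1) show ?thesis by blast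
      qed
    qed simp
  qed simp
qed

lemma infinite_avoiding_step:
  assumes "infinite (avoiding \<xi> F x)"
  shows "\<exists>y. (x, y) \<in> edges \<xi> \<and> y \<notin> insert x F \<and> infinite (avoiding \<xi> (insert x F) y)"
proof -
  have "infinite (\<Union>d\<in>{d \<in> \<xi> x. x + step d \<notin> insert x F}. avoiding \<xi> (insert x F) (x + step d))"
    using assms avoiding_subset[of \<xi> F x] by (meson finite.insertI finite_subset)
  then obtain d where "d \<in> \<xi> x" "x + step d \<notin> insert x F" "infinite (avoiding \<xi> (insert x F) (x + step d))"
    by (auto simp: finite_UN)
  then show ?thesis using edgesI by blast
qed

lemma percolates_if_exits:
  assumes "\<And>n. exits (square n) \<xi> (0,0)"
  shows "percolates \<xi>"
proof -
  \<comment> \<open>A state consists of the vertices already visited and the current vertex; the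
    invariant is that infinitely many vertices can still be reached without entering visited
    ones.\<close>
  define P where "P s \<longleftrightarrow> snd s \<notin> fst s \<and> infinite (avoiding \<xi> (fst s) (snd s))" for s
  define R where "R s t \<longleftrightarrow> fst t = insert (snd s) (fst s) \<and> (snd s, snd t) \<in> edges \<xi>" for s t
  have "infinite (avoiding \<xi> {} (0,0))"
  proof
    assume "finite (avoiding \<xi> {} (0,0))"
    then obtain n where n: "avoiding \<xi> {} (0,0) \<subseteq> square n" by (rule finite_subset_square)
    obtain z where z: "z \<notin> square n" "((0,0), z) \<in> (edges \<xi>)\<^sup>*" using assms[of n] unfolding exits_def by blast
    have "avoiding \<xi> {} (0,0) = {z. ((0,0), z) \<in> (edges \<xi>)\<^sup>*}" by (simp add: avoiding_def)
    with z n show False by blast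
  qed
  then have P0: "P ({}, (0,0))" by (simp add: P_def)
  have stepR: "\<exists>t. P t \<and> R s t" if "P s" for s
  proof -
    from that have "infinite (avoiding \<xi> (fst s) (snd s))" by (simp add: P_def)
    from infinite_avoiding_step[OF this] obtain y where
      "(snd s, y) \<in> edges \<xi>" "y \<notin> insert (snd s) (fst s)" "infinite (avoiding \<xi> (insert (snd s) (fst s)) y)"
      by blast
    then have "P (insert (snd s) (fst s), y) \<and> R s (insert (snd s) (fst s), y)" by (simp add: P_def R_def)
    then show ?thesis by (rule exI)
  qed
  have "\<exists>f. \<forall>n. (P (f n) \<and> (n = 0 \<longrightarrow> f n = ({}, (0,0)))) \<and> R (f n) (f (Suc n))"
  proof (rule dependent_nat_choice)
    show "\<exists>s. P s \<and> (0 = (0::nat) \<longrightarrow> s = ({}, (0,0)))" using P0 by blast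
  next
    fix s n assume "P s \<and> (n = (0::nat) \<longrightarrow> s = ({}, (0,0)))"
    then show "\<exists>t. (P t \<and> (Suc n = 0 \<longrightarrow> t = ({}, (0,0)))) \<and> R s t"
      using stepR[of s] by blast
  qed
  then obtain f where f: "f 0 = ({}, (0,0))" "\<And>n. P (f n)" "\<And>n. R (f n) (f (Suc n))" by blast
  define \<gamma> where "\<gamma> n = snd (f n)" for n
  have F: "fst (f (Suc n)) = insert (\<gamma> n) (fst (f n))" and e: "(\<gamma> n, \<gamma> (Suc n)) \<in> edges \<xi>" for n
    using f(3)[of n] by (simp_all add: \<gamma>_def R_def)
  have visited: "\<gamma> m \<in> fst (f n)" if "m < n" for m n
    using that by (induction n) (auto simp: F less_Suc_eq)
  have new: "\<gamma> n \<notin> fst (f n)" for n using f(2)[of n] by (simp add: \<gamma>_def P_def)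
  have "inj \<gamma>"
  proof (rule linorder_injI)
    fix m n :: nat assume "m < n"
    then show "\<gamma> m \<noteq> \<gamma> n" using visited new by metis
  qed
  moreover have "\<gamma> 0 = (0,0)" using f(1) by (simp add: \<gamma>_def)
  ultimately show ?thesis unfolding percolates_def open_edge_iff using e by blast
qed

lemma exits_if_percolates:
  assumes "percolates \<xi>"
  shows "exits (square n) \<xi> (0,0)"
proof -
  obtain \<gamma> where g: "\<gamma> 0 = (0,0)" "inj \<gamma>" "\<And>n. (\<gamma> n, \<gamma> (Suc n)) \<in> edges \<xi>"
    using assms unfolding percolates_def open_edge_iff by blast
  have "infinite (range \<gamma>)" using g(2) by (simp add: finite_image_iff)
  then have "\<not> range \<gamma> \<subseteq> square n" using finite_subset finite_square by blast
  then obtain m where m: "\<gamma> m \<notin> square n" by blast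
  have "((0,0), \<gamma> m) \<in> (edges \<xi>)\<^sup>*" for m
    by (induction m) (use g in \<open>auto intro: rtrancl_into_rtrancl\<close>)
  then show ?thesis unfolding exits_def using m by blast
qed

lemma percolates_iff_exits: "percolates \<xi> \<longleftrightarrow> (\<forall>n. exits (square n) \<xi> (0,0))"
  using percolates_if_exits exits_if_percolates by blast

section \<open>Box events under the product measure\<close>

context
  fixes M :: "dir set pmf"
begin

interpretation product_prob_space "\<lambda>_ :: int \<times> int. measure_pmf M" UNIV ..

lemma cylinder_sets:
  assumes "finite (V :: (int \<times> int) set)"
  shows "{\<xi>. \<forall>v\<in>V. \<xi> v = \<xi>' v} \<in> sets (\<Pi>\<^sub>M x\<in>UNIV. measure_pmf M)"
proof -
  have "{\<xi>. \<forall>v\<in>V. \<xi> v = \<xi>' v} = prod_emb UNIV (\<lambda>_. measure_pmf M) V (\<Pi>\<^sub>E v\<in>V. {\<xi>' v})"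
    by (auto simp: prod_emb_def PiE_def Pi_iff)
  then show ?thesis using assms by (simp add: sets_PiM_I)
qed

lemma measure_cylinder:
  assumes "finite (V :: (int \<times> int) set)"
  shows "measure (\<Pi>\<^sub>M x\<in>UNIV. measure_pmf M) {\<xi>. \<forall>v\<in>V. \<xi> v = \<xi>' v} = (\<Prod>v\<in>V. pmf M (\<xi>' v))"
proof -
  have "{\<xi>. \<forall>v\<in>V. \<xi> v = \<xi>' v} = prod_emb UNIV (\<lambda>_. measure_pmf M) V (\<Pi>\<^sub>E v\<in>V. {\<xi>' v})"
    by (auto simp: prod_emb_def PiE_def Pi_iff)
  then show ?thesis
    using measure_PiM_emb[OF subset_UNIV assms, of "\<lambda>v. {\<xi>' v}"] by (simp add: measure_pmf_single)
qed

text \<open>Escape from \<open>V\<close> is decided by the states in \<open>V\<close>, so for finite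
  \<open>V\<close> it is a finite union of cylinders; this yields both measurability and the value
  of the measure.\<close>

lemma exits_eq_Union_cylinders:
  "{\<xi>. exits V \<xi> a} = (\<Union>\<xi>'\<in>{\<xi>' \<in> confs V. exits V \<xi>' a}. {\<xi>. \<forall>v\<in>V. \<xi> v = \<xi>' v})"
proof (intro set_eqI iffI)
  fix \<xi> assume "\<xi> \<in> {\<xi>. exits V \<xi> a}"
  moreover have "exits V \<xi> a = exits V (\<lambda>v. if v \<in> V then \<xi> v else {}) a" by (rule exits_cong) simp
  moreover have "(\<lambda>v. if v \<in> V then \<xi> v else {}) \<in> confs V" by (simp add: confs_def)
  ultimately show "\<xi> \<in> (\<Union>\<xi>'\<in>{\<xi>' \<in> confs V. exits V \<xi>' a}. {\<xi>. \<forall>v\<in>V. \<xi> v = \<xi>' v})"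
    by (intro UN_I[of "\<lambda>v. if v \<in> V then \<xi> v else {}"]) auto
next
  fix \<xi> assume "\<xi> \<in> (\<Union>\<xi>'\<in>{\<xi>' \<in> confs V. exits V \<xi>' a}. {\<xi>. \<forall>v\<in>V. \<xi> v = \<xi>' v})"
  then obtain \<xi>' where \<xi>': "exits V \<xi>' a" "\<forall>v\<in>V. \<xi> v = \<xi>' v" by blast
  have "exits V \<xi> a = exits V \<xi>' a" by (rule exits_cong) (use \<xi>'(2) in blast)
  with \<xi>'(1) show "\<xi> \<in> {\<xi>. exits V \<xi> a}" by simp
qed

lemma exits_sets: "finite V \<Longrightarrow> {\<xi>. exits V \<xi> a} \<in> sets (\<Pi>\<^sub>M x\<in>UNIV. measure_pmf M)"
  unfolding exits_eq_Union_cylinders by (intro sets.finite_UN) (auto intro: cylinder_sets)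

lemma measure_exits:
  assumes V: "finite V"
  shows "measure (\<Pi>\<^sub>M x\<in>UNIV. measure_pmf M) {\<xi>. exits V \<xi> (0,0)} = exitp V (pmf M)"
proof -
  let ?C = "{\<xi>' \<in> confs V. exits V \<xi>' (0,0)}"
  have "measure (\<Pi>\<^sub>M x\<in>UNIV. measure_pmf M) {\<xi>. exits V \<xi> (0,0)} =
      (\<Sum>\<xi>'\<in>?C. measure (\<Pi>\<^sub>M x\<in>UNIV. measure_pmf M) {\<xi>. \<forall>v\<in>V. \<xi> v = \<xi>' v})"
    unfolding exits_eq_Union_cylinders
  proof (rule finite_measure_finite_Union)
    show "finite ?C" using V by simp
    show "(\<lambda>\<xi>'. {\<xi>. \<forall>v\<in>V. \<xi> v = \<xi>' v}) ` ?C \<subseteq> sets (\<Pi>\<^sub>M x\<in>UNIV. measure_pmf M)"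
      using cylinder_sets[OF V] by blast
    show "disjoint_family_on (\<lambda>\<xi>'. {\<xi>. \<forall>v\<in>V. \<xi> v = \<xi>' v}) ?C"
      unfolding disjoint_family_on_def
    proof (intro ballI impI equals0I)
      fix \<xi>1 \<xi>2 \<xi> assume c: "\<xi>1 \<in> ?C" "\<xi>2 \<in> ?C" "\<xi>1 \<noteq> \<xi>2"
        and x: "\<xi> \<in> {\<xi>. \<forall>v\<in>V. \<xi> v = \<xi>1 v} \<inter> {\<xi>. \<forall>v\<in>V. \<xi> v = \<xi>2 v}"
      have "\<xi>1 v = \<xi>2 v" for v using c x by (cases "v \<in> V") (auto simp: confs_def)
      with c(3) show False by blast
    qed
  qed
  also have "\<dots> = (\<Sum>\<xi>'\<in>?C. \<Prod>v\<in>V. pmf M (\<xi>' v))" by (simp add: measure_cylinder V)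
  also have "\<dots> = exitp V (pmf M)"
    unfolding exitp_def wexp_def of_bool_def using V by (subst sum.inter_filter) (auto intro!: sum.cong)
  finally show ?thesis .
qed

lemma measure_percolates_ge:
  assumes c: "\<And>n. c \<le> exitp (square n) (pmf M)"
  shows "c \<le> measure (\<Pi>\<^sub>M x\<in>UNIV. measure_pmf M) {\<xi>. percolates \<xi>}"
proof -
  let ?A = "\<lambda>n. {\<xi>. exits (square n) \<xi> (0,0)}"
  have "(\<lambda>n. measure (\<Pi>\<^sub>M x\<in>UNIV. measure_pmf M) (?A n)) \<longlonglongrightarrow> measure (\<Pi>\<^sub>M x\<in>UNIV. measure_pmf M) (\<Inter>n. ?A n)"
  proof (rule finite_Lim_measure_decseq)
    show "range ?A \<subseteq> sets (\<Pi>\<^sub>M x\<in>UNIV. measure_pmf M)" using exits_sets by auto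
    show "decseq ?A" using exits_antimono[OF square_mono] by (auto simp: decseq_def)
  qed
  moreover have "(\<Inter>n. ?A n) = {\<xi>. percolates \<xi>}" by (auto simp: percolates_iff_exits)
  ultimately show ?thesis
    using c by (intro LIMSEQ_le_const[where X = "\<lambda>n. measure (\<Pi>\<^sub>M x\<in>UNIV. measure_pmf M) (?A n)"])
      (auto simp: measure_exits)
qed

end

lemma space_corner_measure: "space (corner_measure p) = UNIV"
  by (simp add: corner_measure_def space_PiM)

text \<open>Makes the set in \<open>pc_corn\<close> nonempty, without which its supremum could not
  be bounded. At \<open>p = 0\<close> every vertex has the empty state almost surely.\<close>

lemma theta_corn_0: "theta_corn 0 = 0"
proof -
  have c: "corner_pmf 0 = return_pmf {}"
  proof (rule pmf_eqI)
    fix s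
    have "corner_pmf 0 = bind_pmf (bernoulli_pmf 0)
        (\<lambda>b. if b then map_pmf (\<lambda>d. {d}) (pmf_of_set UNIV) else return_pmf {})"
      by (simp add: corner_pmf_def)
    then show "pmf (corner_pmf 0) s = pmf (return_pmf {}) s"
      by (simp add: pmf_bind integral_measure_pmf_real[of UNIV] UNIV_bool)
  qed
  have "exitp (square 0) (pmf (return_pmf {})) = 0"
    unfolding exitp_def wexp_def
  proof (intro sum.neutral ballI)
    fix \<xi> assume \<xi>: "\<xi> \<in> confs (square 0)"
    show "(\<Prod>v\<in>square 0. pmf (return_pmf {}) (\<xi> v)) * of_bool (exits (square 0) \<xi> (0,0)) = 0"
    proof (cases "\<xi> (0,0) = {}")
      case True
      have "\<not> exits (square 0) \<xi> (0,0)"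
        by (rule not_exits_closed[of _ "{(0,0)}"]) (use True in auto)
      then show ?thesis by simp
    next
      case False
      have "(\<Prod>v\<in>square 0. pmf (return_pmf {}) (\<xi> v)) = 0"
        by (rule prod_zero) (use False in \<open>auto simp: indicator_def intro!: bexI[of _ "(0,0)"]\<close>)
      then show ?thesis by simp
    qed
  qed
  then have 0: "measure (corner_measure 0) {\<xi>. exits (square 0) \<xi> (0,0)} = 0"
    unfolding corner_measure_def c by (simp add: measure_exits)
  interpret prob_space "corner_measure 0"
    unfolding corner_measure_def by (intro prob_space_PiM measure_pmf.prob_space_axioms)
  have "theta_corn 0 \<le> measure (corner_measure 0) {\<xi>. exits (square 0) \<xi> (0,0)}"
    unfolding theta_corn_def space_corner_measure
  proof (rule finite_measure_mono)
    show "{\<xi> \<in> UNIV. percolates \<xi>} \<subseteq> {\<xi>. exits (square 0) \<xi> (0,0)}"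
      by (auto simp: percolates_iff_exits)
    show "{\<xi>. exits (square 0) \<xi> (0,0)} \<in> sets (corner_measure 0)"
      unfolding corner_measure_def by (rule exits_sets) simp
  qed
  with 0 show ?thesis by (simp add: theta_corn_def measure_le_0_iff)
qed

text \<open>Positivity of \<open>theta_corn\<close> on the whole interval from \<open>p0\<close> to
  1 leaves only zeros below \<open>p0\<close>, so the supremum is at most \<open>p0\<close>.\<close>

theorem theorem2p8: "pc_corn < 1 / 2"
proof -
  obtain p0 c where p0: "p0 < 1 / 2" "0 < p0" and c: "0 < c"
    "\<And>p n. p0 \<le> p \<Longrightarrow> p \<le> 1 \<Longrightarrow> c \<le> exitp (square n) (pmf (corner_pmf p))"
    using exitp_corner_uniform by blast
  have "theta_corn p \<noteq> 0" if "p0 \<le> p" "p \<le> 1" for p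
  proof -
    have "c \<le> theta_corn p"
      unfolding theta_corn_def space_corner_measure using measure_percolates_ge[OF c(2)[OF that]]
      by (simp add: corner_measure_def)
    with c(1) show ?thesis by simp
  qed
  then have "p \<le> p0" if "p \<in> {p \<in> {0..1}. theta_corn p = 0}" for p
    using that by (cases "p0 \<le> p") auto
  moreover have "0 \<in> {p \<in> {0..1}. theta_corn p = 0}" by (simp add: theta_corn_0)
  ultimately have "pc_corn \<le> p0" unfolding pc_corn_def by (intro cSup_least) blast+
  with p0 show ?thesis by simp
qed

end
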